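(* For the discrete-time adjacent transposition shuffle on $S_N$, for every $\varepsilon\in(0,1)$, $$\lim_{N\to\infty}\frac{\pi^2\,\mathbf T^N_{\mathrm{mix}}(\varepsilon)}{N^3\log N}=1 .$$
   Context: For $N\ge2$, $S_N$ is the symmetric group on $\{1,\dots,N\}$ and $\tau_x=(x,x+1)$. The discrete-time adjacent transposition shuffle is the Markov chain $(\sigma_n)_{n\ge0}$ on $S_N$ started from the identity such that at each step $x$ is chosen uniformly in $\{1,\dots,N-1\}$ and, independently, with probability $1/2$ the current permutation $\sigma$ is replaced by $\sigma\circ\tau_x$, and with probability $1/2$ it is left unchanged. $\mathbf P_n$ is the law of $\sigma_n$, $\mu$ the uniform probability on $S_N$, $\|\alpha-\beta\|_{\mathrm{TV}}=\frac12\sum_\omega|\alpha(\omega)-\beta(\omega)|$, and $\mathbf T^N_{\mathrm{mix}}(\varepsilon)=\inf\{n\ge0:\|\mathbf P_n-\mu\|_{\mathrm{TV}}\le\varepsilon\}$. *)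

theory Defs
  imports "HOL-Probability.Probability" "HOL-Combinatorics.Permutations"
begin

text \<open>Permutations of \<open>{1..N}\<close> are functions on \<^typ>\<open>nat\<close> that fix every point outside \<open>{1..N}\<close>.\<close>

definition sym_grp :: "nat \<Rightarrow> (nat \<Rightarrow> nat) set" where
  "sym_grp N = {p. p permutes {1..N}}"

definition adj_transp :: "nat \<Rightarrow> nat \<Rightarrow> nat" where
  "adj_transp x = Transposition.transpose x (x + 1)"

text \<open>The shuffle is meaningful for \<open>N \<ge> 2\<close> only: for smaller \<open>N\<close> the set \<open>{1..N - 1}\<close> is empty
  and \<^const>\<open>pmf_of_set\<close> is unspecified.\<close>

definition shuffle_step :: "nat \<Rightarrow> (nat \<Rightarrow> nat) \<Rightarrow> (nat \<Rightarrow> nat) pmf" where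
  "shuffle_step N \<sigma> =
     bind_pmf (pmf_of_set {1..N - 1}) (\<lambda>x.
     bind_pmf (bernoulli_pmf (1 / 2)) (\<lambda>b.
     return_pmf (if b then \<sigma> \<circ> adj_transp x else \<sigma>)))"

primrec shuffle_law :: "nat \<Rightarrow> nat \<Rightarrow> (nat \<Rightarrow> nat) pmf" where
  "shuffle_law N 0 = return_pmf id"
| "shuffle_law N (Suc n) = bind_pmf (shuffle_law N n) (shuffle_step N)"

definition tv_dist :: "'a set \<Rightarrow> 'a pmf \<Rightarrow> 'a pmf \<Rightarrow> real" where
  "tv_dist \<Omega> \<alpha> \<beta> = 1 / 2 * (\<Sum>\<omega>\<in>\<Omega>. \<bar>pmf \<alpha> \<omega> - pmf \<beta> \<omega>\<bar>)"

text \<open>For \<open>N \<ge> 2\<close> and \<open>\<epsilon> > 0\<close> the set below is nonempty, because the chain is irreducible and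
  aperiodic; so the infimum in \<^typ>\<open>nat\<close> is a genuine minimum.\<close>

definition mixing_time :: "nat \<Rightarrow> real \<Rightarrow> nat" where
  "mixing_time N \<epsilon> = Inf {n. tv_dist (sym_grp N) (shuffle_law N n) (pmf_of_set (sym_grp N)) \<le> \<epsilon>}"

end

theory Submission
  imports Defs "HOL-Real_Asymp.Real_Asymp"
begin

text \<open>Lower bound (Wilson): the first Fourier mode of the height function is an eigenfunction of the
  chain with eigenvalue \<open>1 - gap N\<close>, \<open>gap N \<sim> \<pi>\<^sup>2 / (2 N\<^sup>3)\<close>; its mean beats its standard deviation until
  time \<open>N\<^sup>3 log N / \<pi>\<^sup>2\<close>.

  Upper bound (after Lacoin): in the Bruhat order the identity is maximal and the chain preserves increasing
  functions, so densities stay increasing and censoring applies: it suffices to treat \<open>U P\<^sup>t U\<close>, where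
  \<open>U\<close> shuffles positions uniformly inside \<open>K\<close> blocks of equal size (shuffling inside blocks takes a time
  \<open>N\<^sup>3 log N / K\<^sup>2\<close> only). The resulting increasing density \<open>\<rho>\<close> is a function of the \<open>K \<times> K\<close> table
  counting the labels of block \<open>j\<close> in block \<open>i\<close>. For \<open>t\<close> slightly above the cutoff the heat equation makes all
  mean heights agree with equilibrium up to \<open>\<eta> \<lless> \<surd>N\<close>. As \<open>\<rho>\<close> is increasing, its \<open>L\<^sup>1\<close> gradient along an
  elementary move of the table equals the \<open>\<rho>\<close>-mean of a \<open>2 \<times> 2\<close> minor and is of order \<open>\<eta> / N\<close>. Tables
  fluctuate on scale \<open>\<surd>N\<close>, where their uniform weights are comparable, so \<open>\<rho>\<close> oscillates by at most
  \<open>\<surd>N \<eta> / N \<longlonglongrightarrow> 0\<close> over the typical tables.\<close>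

section \<open>Heights and the Bruhat order\<close>

text \<open>The cutoff is the time at which the excess of the mean heights over equilibrium,
  initially of order N and decaying like exp (- gap t), falls below the equilibrium fluctuation sqrt
  N; Wilson's mode becomes invisible at the same time, so the two bounds meet. The obstacle is to
  get from mean heights to total variation, since means alone say little about a law on
  permutations. Monotonicity closes this gap, and it is used without couplings: a law that dominates
  equilibrium and has nearly the right mean heights has nearly the right mean of every function that
  is Lipschitz in a height; and a signed quantity, the minor, controls an L1 norm because all
  increments have the same sign. The number K of blocks depends only on the slack above the cutoff,
  the window A sqrt N only on K and \<epsilon>, and N grows last. Crossing the window takes of order
  A K^2 sqrt N elementary moves, each changing uniform weights by a factor 1 + O(A K^2 / sqrt N), so
  the total distortion is bounded uniformly in N.\<close>

definition lazy :: "nat \<Rightarrow> ((nat \<Rightarrow> nat) \<Rightarrow> real) \<Rightarrow> (nat \<Rightarrow> nat) \<Rightarrow> real" where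
  "lazy x f \<sigma> = (f \<sigma> + f (\<sigma> \<circ> adj_transp x)) / 2"

text \<open>Positions outside \<open>X\<close> are censored: drawing one of them uses up a step
  without an update, so the censored chain runs on the same clock.\<close>

definition avg_op :: "nat \<Rightarrow> nat set \<Rightarrow> ((nat \<Rightarrow> nat) \<Rightarrow> real) \<Rightarrow> (nat \<Rightarrow> nat) \<Rightarrow> real" where
  "avg_op N X f \<sigma> = (\<Sum>x\<in>{1..N - 1}. if x \<in> X then lazy x f \<sigma> else f \<sigma>) / real (N - 1)"

definition dirac :: "(nat \<Rightarrow> nat) \<Rightarrow> real" where
  "dirac \<sigma> = (if \<sigma> = id then 1 else 0)"

lemma adj_transp_invol [simp]: "\<sigma> \<circ> adj_transp x \<circ> adj_transp x = \<sigma>"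
  by (simp add: adj_transp_def comp_assoc)

lemma adj_transp_permutes: "x \<in> {1..N - 1} \<Longrightarrow> adj_transp x permutes {1..N}"
  unfolding adj_transp_def by (rule permutes_swap_id) auto

lemma sym_grp_finite [simp, intro]: "finite (sym_grp N)"
  unfolding sym_grp_def by (rule finite_permutations) simp

lemma card_sym_grp: "card (sym_grp N) = fact N"
  unfolding sym_grp_def using card_permutations[of "{1..N}" N] by simp

lemma id_in_sym_grp [simp, intro]: "id \<in> sym_grp N"
  unfolding sym_grp_def by (simp add: permutes_id)

lemma pmf_uniform_sym_grp: "\<sigma> \<in> sym_grp N \<Longrightarrow> pmf (pmf_of_set (sym_grp N)) \<sigma> = 1 / fact N"
  using id_in_sym_grp[of N] by (subst pmf_of_set) (auto simp: card_sym_grp)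

lemma sym_grp_comp: "\<sigma> \<in> sym_grp N \<Longrightarrow> \<tau> \<in> sym_grp N \<Longrightarrow> \<sigma> \<circ> \<tau> \<in> sym_grp N"
  unfolding sym_grp_def using permutes_compose by auto

lemma adj_transp_in_sym_grp: "x \<in> {1..N - 1} \<Longrightarrow> adj_transp x \<in> sym_grp N"
  unfolding sym_grp_def using adj_transp_permutes by auto

lemma sym_grp_step: "\<sigma> \<in> sym_grp N \<Longrightarrow> x \<in> {1..N - 1} \<Longrightarrow> \<sigma> \<circ> adj_transp x \<in> sym_grp N"
  using sym_grp_comp adj_transp_in_sym_grp by blast

lemma sum_sym_grp_comp:
  assumes "\<tau> \<in> sym_grp N"
  shows "(\<Sum>\<sigma>\<in>sym_grp N. f (\<sigma> \<circ> \<tau>)) = (\<Sum>\<sigma>\<in>sym_grp N. f \<sigma>)"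
  using sum_permutations_compose_right[of \<tau> "{1..N}" f] assms
  unfolding sym_grp_def by simp

text \<open>Adjacent transpositions are involutions, so mass reaches \<sigma> only from \<sigma> and
  \<sigma> \<circ> \<open>adj_transp x\<close>. Hence densities and observables evolve under one and
  the same operator.\<close>

lemma pmf_shuffle_step:
  assumes "N \<ge> 2"
  shows "pmf (bind_pmf p (shuffle_step N)) \<sigma> = avg_op N UNIV (pmf p) \<sigma>"
proof -
  have fin: "finite {1..N - 1}" "{1..N - 1} \<noteq> {}" using assms by auto
  have inner: "pmf (shuffle_step N \<sigma>') \<sigma> =
     (\<Sum>x\<in>{1..N - 1}. (indicator {\<sigma>} \<sigma>' + indicator {\<sigma> \<circ> adj_transp x} \<sigma>') / 2) / real (N - 1)" for \<sigma>'
  proof -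
    have eq: "\<sigma>' \<circ> adj_transp x = \<sigma> \<longleftrightarrow> \<sigma>' = \<sigma> \<circ> adj_transp x" for x
      using adj_transp_invol by metis
    have "pmf (shuffle_step N \<sigma>') \<sigma> = (\<Sum>x\<in>{1..N - 1}. pmf (bind_pmf (bernoulli_pmf (1 / 2)) (\<lambda>b.
        return_pmf (if b then \<sigma>' \<circ> adj_transp x else \<sigma>'))) \<sigma>) / real (card {1..N - 1})"
      unfolding shuffle_step_def by (rule pmf_bind_pmf_of_set[OF fin(2) fin(1)])
    also have "\<dots> = (\<Sum>x\<in>{1..N - 1}. (indicator {\<sigma>} \<sigma>' + indicator {\<sigma> \<circ> adj_transp x} \<sigma>') / 2) / real (N - 1)"
      by (intro arg_cong2[where f="(/)"] sum.cong) (auto simp: pmf_bind indicator_def eq)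
    finally show ?thesis .
  qed
  have "pmf (bind_pmf p (shuffle_step N)) \<sigma> = measure_pmf.expectation p (\<lambda>\<sigma>'. pmf (shuffle_step N \<sigma>') \<sigma>)"
    by (simp add: pmf_bind)
  also have "\<dots> = measure_pmf.expectation p (\<lambda>\<sigma>'. (\<Sum>x\<in>{1..N - 1}. (indicator {\<sigma>} \<sigma>' + indicator {\<sigma> \<circ> adj_transp x} \<sigma>') / 2) / real (N - 1))"
    by (simp add: inner)
  also have "\<dots> = avg_op N UNIV (pmf p) \<sigma>"
  proof -
    have ind: "integrable (measure_pmf p) (\<lambda>\<sigma>'. indicat_real A \<sigma>')" for A
      by (intro measure_pmf.integrable_const_bound[where B=1]) auto
    have "measure_pmf.expectation p (\<lambda>\<sigma>'. \<Sum>x\<in>{1..N - 1}. (indicat_real {\<sigma>} \<sigma>' + indicator {\<sigma> \<circ> adj_transp x} \<sigma>') / 2)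
      = (\<Sum>x\<in>{1..N - 1}. measure_pmf.expectation p (\<lambda>\<sigma>'. (indicat_real {\<sigma>} \<sigma>' + indicator {\<sigma> \<circ> adj_transp x} \<sigma>') / 2))"
      by (intro Bochner_Integration.integral_sum integrable_divide Bochner_Integration.integrable_add ind)
    also have "\<dots> = (\<Sum>x\<in>{1..N - 1}. (pmf p \<sigma> + pmf p (\<sigma> \<circ> adj_transp x)) / 2)"
      by (intro sum.cong refl) (simp add: Bochner_Integration.integral_add[OF ind ind] measure_pmf_single)
    finally show ?thesis unfolding avg_op_def lazy_def by simp
  qed
  finally show ?thesis .
qed

lemma pmf_shuffle_law:
  assumes "N \<ge> 2"
  shows "pmf (shuffle_law N n) = (avg_op N UNIV ^^ n) dirac"
proof (induction n)
  case 0
  show ?case by (rule ext) (simp add: dirac_def indicator_def)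
next
  case (Suc n)
  show ?case by (rule ext) (simp add: pmf_shuffle_step[OF assms] Suc)
qed

section \<open>Height functions and their order\<close>

definition ht :: "(nat \<Rightarrow> nat) \<Rightarrow> nat \<Rightarrow> nat \<Rightarrow> nat" where
  "ht \<sigma> x y = card {z \<in> {1..x}. \<sigma> z \<le> y}"

text \<open>For fixed \<open>y\<close> the labels at most \<open>y\<close> perform an exclusion
  process with height function \<open>ht \<sigma> _ y\<close>. Comparing all heights gives the
  Bruhat order turned upside down: a permutation is large if small labels sit far to the left, so
  the identity is on top.\<close>

definition bruhat_le :: "(nat \<Rightarrow> nat) \<Rightarrow> (nat \<Rightarrow> nat) \<Rightarrow> bool" where
  "bruhat_le \<sigma> \<tau> \<longleftrightarrow> (\<forall>x y. ht \<sigma> x y \<le> ht \<tau> x y)"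

definition bruhat_mono :: "nat \<Rightarrow> ((nat \<Rightarrow> nat) \<Rightarrow> real) \<Rightarrow> bool" where
  "bruhat_mono N f \<longleftrightarrow> (\<forall>\<sigma>\<in>sym_grp N. \<forall>\<tau>\<in>sym_grp N. bruhat_le \<sigma> \<tau> \<longrightarrow> f \<sigma> \<le> f \<tau>)"

lemma ht_0 [simp]: "ht \<sigma> 0 y = 0"
  by (simp add: ht_def)

lemma ht_Suc: "ht \<sigma> (Suc x) y = ht \<sigma> x y + (if \<sigma> (Suc x) \<le> y then 1 else 0)"
proof -
  have "{z \<in> {1..Suc x}. \<sigma> z \<le> y} = (if \<sigma> (Suc x) \<le> y then insert (Suc x) {z \<in> {1..x}. \<sigma> z \<le> y} else {z \<in> {1..x}. \<sigma> z \<le> y})"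
    by (auto simp: le_Suc_eq)
  then show ?thesis unfolding ht_def by simp
qed

lemma ht_cong: "(\<And>z. z \<in> {1..x} \<Longrightarrow> \<sigma> z = \<tau> z) \<Longrightarrow> ht \<sigma> x y = ht \<tau> x y"
  unfolding ht_def by (intro arg_cong[where f=card]) auto

lemma ht_comp_permutes:
  assumes "a permutes {1..x}"
  shows "ht (\<sigma> \<circ> a) x y = ht \<sigma> x y"
proof -
  have "bij_betw a {z \<in> {1..x}. (\<sigma> \<circ> a) z \<le> y} {z \<in> {1..x}. \<sigma> z \<le> y}"
    by (rule bij_betw_Collect[OF permutes_imp_bij[OF assms]]) simp
  then show ?thesis unfolding ht_def by (rule bij_betw_same_card)
qed

lemma ht_adj_transp_other:
  assumes "x \<ge> 1" "x' \<noteq> x"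
  shows "ht (\<sigma> \<circ> adj_transp x) x' y = ht \<sigma> x' y"
proof (cases "x' < x")
  case True
  then show ?thesis by (intro ht_cong) (auto simp: adj_transp_def Transposition.transpose_def)
next
  case False
  have "adj_transp x permutes {1..x'}"
    using assms False unfolding adj_transp_def by (intro permutes_swap_id) auto
  then show ?thesis by (rule ht_comp_permutes)
qed

lemma ht_adj_transp_same:
  assumes "x \<ge> 1"
  shows "ht (\<sigma> \<circ> adj_transp x) x y = ht \<sigma> (x - 1) y + (if \<sigma> (Suc x) \<le> y then 1 else 0)"
proof -
  obtain x0 where x0: "x = Suc x0" using assms by (cases x) auto
  have "ht (\<sigma> \<circ> adj_transp x) x0 y = ht \<sigma> x0 y"
    using ht_adj_transp_other[OF assms, of x0] x0 by auto
  then show ?thesis by (simp add: x0 ht_Suc adj_transp_def)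
qed

lemma ht_pred: "x \<ge> 1 \<Longrightarrow> ht \<sigma> x y = ht \<sigma> (x - 1) y + (if \<sigma> x \<le> y then 1 else 0)"
  using ht_Suc[of \<sigma> "x - 1" y] by simp

lemma lazy_ht_same:
  assumes "x \<ge> 1"
  shows "lazy x (\<lambda>\<sigma>. real (ht \<sigma> x y)) \<sigma> = (real (ht \<sigma> (x - 1) y) + real (ht \<sigma> (x + 1) y)) / 2"
  unfolding lazy_def using ht_adj_transp_same[OF assms, of \<sigma> y] ht_pred[OF assms, of \<sigma> y] ht_Suc[of \<sigma> x y]
  by simp

lemma lazy_ht_other:
  assumes "x \<ge> 1" "x' \<noteq> x"
  shows "lazy x (\<lambda>\<sigma>. real (ht \<sigma> x' y)) \<sigma> = real (ht \<sigma> x' y)"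
  unfolding lazy_def using ht_adj_transp_other[OF assms] by simp

section \<open>Sorting a neighbouring pair: monotonicity of the updates\<close>

definition sort_up :: "nat \<Rightarrow> (nat \<Rightarrow> nat) \<Rightarrow> nat \<Rightarrow> nat" where
  "sort_up x \<sigma> = (if \<sigma> x \<le> \<sigma> (Suc x) then \<sigma> else \<sigma> \<circ> adj_transp x)"

definition sort_down :: "nat \<Rightarrow> (nat \<Rightarrow> nat) \<Rightarrow> nat \<Rightarrow> nat" where
  "sort_down x \<sigma> = (if \<sigma> x \<le> \<sigma> (Suc x) then \<sigma> \<circ> adj_transp x else \<sigma>)"

text \<open>A fair coin between the two sorted orders has the same effect as one between swapping
  and staying, but now each of the two outcomes is an order-preserving map.\<close>

lemma lazy_sort: "lazy x f \<sigma> = (f (sort_up x \<sigma>) + f (sort_down x \<sigma>)) / 2"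
  by (auto simp: lazy_def sort_up_def sort_down_def)

text \<open>Sorting replaces the old height at \<open>x\<close> by the largest value that the
  neighbouring heights allow, an increasing function of them; monotonicity of the update can be read
  off this formula.\<close>

lemma ht_sort_up:
  assumes "x \<ge> 1"
  shows "ht (sort_up x \<sigma>) x' y = (if x' = x then min (ht \<sigma> (x - 1) y + 1) (ht \<sigma> (x + 1) y) else ht \<sigma> x' y)"
  using ht_adj_transp_other[OF assms, of x'] ht_adj_transp_same[OF assms, of \<sigma> y] ht_pred[OF assms, of \<sigma> y]
    ht_Suc[of \<sigma> x y] by (auto simp: sort_up_def)

text \<open>The truncated subtraction is harmless: if the height at \<open>x + 1\<close> is 0, then
  so is the one at \<open>x - 1\<close>, and the maximum is 0 either way.\<close>

lemma ht_sort_down: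
  assumes "x \<ge> 1"
  shows "ht (sort_down x \<sigma>) x' y = (if x' = x then max (ht \<sigma> (x - 1) y) (ht \<sigma> (x + 1) y - 1) else ht \<sigma> x' y)"
  using ht_adj_transp_other[OF assms, of x'] ht_adj_transp_same[OF assms, of \<sigma> y] ht_pred[OF assms, of \<sigma> y]
    ht_Suc[of \<sigma> x y] by (auto simp: sort_down_def)

lemma bruhat_le_refl [simp]: "bruhat_le \<sigma> \<sigma>"
  by (simp add: bruhat_le_def)

lemma bruhat_le_sort_up:
  assumes "x \<ge> 1" "bruhat_le \<sigma> \<tau>"
  shows "bruhat_le (sort_up x \<sigma>) (sort_up x \<tau>)"
  unfolding bruhat_le_def
proof (intro allI)
  fix x' y
  have "ht \<sigma> (x - 1) y \<le> ht \<tau> (x - 1) y" "ht \<sigma> (x + 1) y \<le> ht \<tau> (x + 1) y" "ht \<sigma> x' y \<le> ht \<tau> x' y"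
    using assms(2) unfolding bruhat_le_def by blast+
  then show "ht (sort_up x \<sigma>) x' y \<le> ht (sort_up x \<tau>) x' y"
    unfolding ht_sort_up[OF assms(1)] by (auto simp: min_def max_def)
qed

lemma bruhat_le_sort_down:
  assumes "x \<ge> 1" "bruhat_le \<sigma> \<tau>"
  shows "bruhat_le (sort_down x \<sigma>) (sort_down x \<tau>)"
  unfolding bruhat_le_def
proof (intro allI)
  fix x' y
  have "ht \<sigma> (x - 1) y \<le> ht \<tau> (x - 1) y" "ht \<sigma> (x + 1) y \<le> ht \<tau> (x + 1) y" "ht \<sigma> x' y \<le> ht \<tau> x' y"
    using assms(2) unfolding bruhat_le_def by blast+
  then show "ht (sort_down x \<sigma>) x' y \<le> ht (sort_down x \<tau>) x' y"
    unfolding ht_sort_down[OF assms(1)] by (auto simp: min_def max_def)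
qed

lemma bruhat_le_comparable:
  assumes "x \<ge> 1"
  shows "bruhat_le \<sigma> (\<sigma> \<circ> adj_transp x) \<or> bruhat_le (\<sigma> \<circ> adj_transp x) \<sigma>"
proof -
  have "bruhat_le (sort_down x \<sigma>) (sort_up x \<sigma>)"
    unfolding bruhat_le_def using ht_Suc[of \<sigma> x] ht_pred[OF assms, of \<sigma>]
    by (auto simp: ht_sort_up[OF assms] ht_sort_down[OF assms])
  then show ?thesis by (auto simp: sort_up_def sort_down_def split: if_splits)
qed

lemma sort_in_sym_grp:
  assumes "\<sigma> \<in> sym_grp N" "x \<in> {1..N - 1}"
  shows "sort_up x \<sigma> \<in> sym_grp N" "sort_down x \<sigma> \<in> sym_grp N"
  using assms sym_grp_step by (auto simp: sort_up_def sort_down_def)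

lemma bruhat_mono_avg_op:
  assumes "bruhat_mono N f"
  shows "bruhat_mono N (avg_op N X f)"
  unfolding bruhat_mono_def
proof (intro ballI impI)
  fix \<sigma> \<tau> assume a: "\<sigma> \<in> sym_grp N" "\<tau> \<in> sym_grp N" "bruhat_le \<sigma> \<tau>"
  have "lazy x f \<sigma> \<le> lazy x f \<tau>" if "x \<in> {1..N - 1}" for x
  proof -
    have "f (sort_up x \<sigma>) \<le> f (sort_up x \<tau>)" "f (sort_down x \<sigma>) \<le> f (sort_down x \<tau>)"
      using assms sort_in_sym_grp[OF a(1) that] sort_in_sym_grp[OF a(2) that] that
        bruhat_le_sort_up[OF _ a(3), of x] bruhat_le_sort_down[OF _ a(3), of x]
      unfolding bruhat_mono_def by auto
    then show ?thesis by (simp add: lazy_sort)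
  qed
  moreover have "f \<sigma> \<le> f \<tau>" using assms a unfolding bruhat_mono_def by auto
  ultimately show "avg_op N X f \<sigma> \<le> avg_op N X f \<tau>"
    unfolding avg_op_def by (intro divide_right_mono sum_mono) auto
qed

lemma bruhat_mono_avg_op_funpow: "bruhat_mono N f \<Longrightarrow> bruhat_mono N ((avg_op N X ^^ n) f)"
  by (induction n) (auto intro: bruhat_mono_avg_op)

lemma sym_grp_eqI:
  assumes "\<sigma> \<in> sym_grp N" "\<tau> \<in> sym_grp N" "\<And>x y. ht \<sigma> x y = ht \<tau> x y"
  shows "\<sigma> = \<tau>"
proof
  fix x
  show "\<sigma> x = \<tau> x"
  proof (cases x)
    case 0
    then show ?thesis using assms(1,2) unfolding sym_grp_def permutes_def by auto
  next
    case (Suc x')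
    have "(\<sigma> x \<le> y) = (\<tau> x \<le> y)" for y
      using assms(3)[of x y] assms(3)[of x' y] Suc by (auto simp: ht_Suc split: if_splits)
    then show ?thesis by (metis order_antisym order_refl)
  qed
qed

lemma sym_grp_inj: "\<sigma> \<in> sym_grp N \<Longrightarrow> inj \<sigma>"
  unfolding sym_grp_def using permutes_inj by auto

lemma sym_grp_0: "\<sigma> \<in> sym_grp N \<Longrightarrow> \<sigma> 0 = 0"
  unfolding sym_grp_def permutes_def by auto

lemma sym_grp_pos: "\<sigma> \<in> sym_grp N \<Longrightarrow> z \<ge> 1 \<Longrightarrow> \<sigma> z \<ge> 1"
  using sym_grp_inj[of \<sigma> N] sym_grp_0[of \<sigma> N] by (metis One_nat_def Suc_leI inj_eq le_zero_eq not_gr_zero zero_neq_one)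

lemma ht_id: "ht id x y = min x y"
proof -
  have "{z \<in> {1..x}. id z \<le> y} = {1..min x y}" by auto
  then show ?thesis by (simp add: ht_def)
qed

lemma ht_le_min:
  assumes "\<sigma> \<in> sym_grp N"
  shows "ht \<sigma> x y \<le> min x y"
proof -
  have "ht \<sigma> x y \<le> card {1..x}" unfolding ht_def by (intro card_mono) auto
  moreover have "ht \<sigma> x y \<le> card {1..y}" unfolding ht_def
  proof (rule card_inj_on_le[where f=\<sigma>])
    show "inj_on \<sigma> {z \<in> {1..x}. \<sigma> z \<le> y}" using sym_grp_inj[OF assms] by (rule inj_on_subset) simp
    show "\<sigma> ` {z \<in> {1..x}. \<sigma> z \<le> y} \<subseteq> {1..y}" 
    proof (rule image_subsetI)
      fix z assume "z \<in> {z \<in> {1..x}. \<sigma> z \<le> y}"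
      then show "\<sigma> z \<in> {1..y}" using sym_grp_pos[OF assms, of z] by simp
    qed
  qed simp
  ultimately show ?thesis by simp
qed

lemma bruhat_le_id: "\<sigma> \<in> sym_grp N \<Longrightarrow> bruhat_le \<sigma> id"
  unfolding bruhat_le_def using ht_le_min by (auto simp: ht_id)

text \<open>The identity is the maximum of the order and heights determine a permutation, so nothing
  else lies above it.\<close>

lemma bruhat_mono_dirac: "bruhat_mono N dirac"
  unfolding bruhat_mono_def
proof (intro ballI impI)
  fix \<sigma> \<tau> assume a: "\<sigma> \<in> sym_grp N" "\<tau> \<in> sym_grp N" "bruhat_le \<sigma> \<tau>"
  show "dirac \<sigma> \<le> dirac \<tau>"
  proof (cases "\<sigma> = id")
    case True
    have "\<tau> = id"
      by (rule sym_grp_eqI[OF a(2)]) (use a(3) True bruhat_le_id[OF a(2)] in \<open>auto simp: bruhat_le_def intro: antisym\<close>)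
    then show ?thesis by (simp add: dirac_def)
  qed (simp add: dirac_def)
qed

lemma ht_full:
  assumes "\<sigma> \<in> sym_grp N" "y \<le> N"
  shows "ht \<sigma> N y = y"
proof -
  have p: "\<sigma> permutes {1..N}" using assms(1) by (simp add: sym_grp_def)
  have "bij_betw \<sigma> {z \<in> {1..N}. \<sigma> z \<le> y} {z \<in> {1..N}. z \<le> y}"
    by (rule bij_betw_Collect[OF permutes_imp_bij[OF p]]) (rule refl)
  then have "ht \<sigma> N y = card {z \<in> {1..N}. z \<le> y}" unfolding ht_def by (rule bij_betw_same_card)
  also have "{z \<in> {1..N}. z \<le> y} = {1..y}" using assms(2) by auto
  finally show ?thesis by simp
qed

lemma bruhat_le_transpose:
  assumes "z \<ge> 1" "z < z'" "\<sigma> z' \<le> \<sigma> z"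
  shows "bruhat_le \<sigma> (\<sigma> \<circ> Transposition.transpose z z')"
  unfolding bruhat_le_def
proof (intro allI)
  fix x y
  consider "x < z" | "x \<ge> z'" | "z \<le> x" "x < z'" by linarith
  then show "ht \<sigma> x y \<le> ht (\<sigma> \<circ> Transposition.transpose z z') x y"
  proof cases
    case 1
    then have "ht (\<sigma> \<circ> Transposition.transpose z z') x y = ht \<sigma> x y"
      using assms by (intro ht_cong) (auto simp: Transposition.transpose_def)
    then show ?thesis by simp
  next
    case 2
    then have "Transposition.transpose z z' permutes {1..x}" using assms by (intro permutes_swap_id) auto
    then show ?thesis by (simp add: ht_comp_permutes)
  next
    case 3
    have "{w \<in> {1..x}. \<sigma> w \<le> y} \<subseteq> {w \<in> {1..x}. (\<sigma> \<circ> Transposition.transpose z z') w \<le> y}"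
    proof
      fix w assume "w \<in> {w \<in> {1..x}. \<sigma> w \<le> y}"
      then show "w \<in> {w \<in> {1..x}. (\<sigma> \<circ> Transposition.transpose z z') w \<le> y}"
        using 3 assms by (cases "w = z") (auto simp: Transposition.transpose_def)
    qed
    then show ?thesis unfolding ht_def by (intro card_mono) auto
  qed
qed

section \<open>Averaging operators and censoring\<close>

text \<open>The chain, its censored versions, their powers and block averaging share these
  properties, so the estimates below are proved once. Moves act on positions and hence commute with
  the relabelling \<open>a \<circ> \<sigma>\<close>; this clause transports bounds from the start
  \<open>id\<close> to every other start.\<close>

definition markov_op :: "nat \<Rightarrow> (((nat \<Rightarrow> nat) \<Rightarrow> real) \<Rightarrow> (nat \<Rightarrow> nat) \<Rightarrow> real) \<Rightarrow> bool" where
  "markov_op N Q \<longleftrightarrow>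
     (\<forall>f g c d. Q (\<lambda>\<sigma>. c * f \<sigma> + d * g \<sigma>) = (\<lambda>\<sigma>. c * Q f \<sigma> + d * Q g \<sigma>)) \<and>
     (\<forall>f g. (\<forall>\<sigma>\<in>sym_grp N. f \<sigma> \<le> g \<sigma>) \<longrightarrow> (\<forall>\<sigma>\<in>sym_grp N. Q f \<sigma> \<le> Q g \<sigma>)) \<and>
     (\<forall>c. Q (\<lambda>_. c) = (\<lambda>_. c)) \<and>
     (\<forall>f a. Q (\<lambda>\<sigma>. f (a \<circ> \<sigma>)) = (\<lambda>\<sigma>. Q f (a \<circ> \<sigma>))) \<and>
     (\<forall>f. (\<Sum>\<sigma>\<in>sym_grp N. Q f \<sigma>) = (\<Sum>\<sigma>\<in>sym_grp N. f \<sigma>))"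

lemma markov_linear: "markov_op N Q \<Longrightarrow> Q (\<lambda>\<sigma>. c * f \<sigma> + d * g \<sigma>) = (\<lambda>\<sigma>. c * Q f \<sigma> + d * Q g \<sigma>)"
  unfolding markov_op_def by blast

lemma markov_mono: "markov_op N Q \<Longrightarrow> (\<And>\<sigma>. \<sigma> \<in> sym_grp N \<Longrightarrow> f \<sigma> \<le> g \<sigma>) \<Longrightarrow> \<sigma> \<in> sym_grp N \<Longrightarrow> Q f \<sigma> \<le> Q g \<sigma>"
  unfolding markov_op_def by blast

lemma markov_const: "markov_op N Q \<Longrightarrow> Q (\<lambda>_. c) = (\<lambda>_. c)"
  unfolding markov_op_def by blast

lemma markov_comp_left: "markov_op N Q \<Longrightarrow> Q (\<lambda>\<sigma>. f (a \<circ> \<sigma>)) = (\<lambda>\<sigma>. Q f (a \<circ> \<sigma>))"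
  unfolding markov_op_def by blast

lemma markov_sum_sym_grp: "markov_op N Q \<Longrightarrow> (\<Sum>\<sigma>\<in>sym_grp N. Q f \<sigma>) = (\<Sum>\<sigma>\<in>sym_grp N. f \<sigma>)"
  unfolding markov_op_def by blast

lemma markov_add: "markov_op N Q \<Longrightarrow> Q (\<lambda>\<sigma>. f \<sigma> + g \<sigma>) = (\<lambda>\<sigma>. Q f \<sigma> + Q g \<sigma>)"
  using markov_linear[of N Q 1 f 1 g] by simp

lemma markov_diff: "markov_op N Q \<Longrightarrow> Q (\<lambda>\<sigma>. f \<sigma> - g \<sigma>) = (\<lambda>\<sigma>. Q f \<sigma> - Q g \<sigma>)"
  using markov_linear[of N Q 1 f "-1" g] by simp

lemma markov_scale: "markov_op N Q \<Longrightarrow> Q (\<lambda>\<sigma>. c * f \<sigma>) = (\<lambda>\<sigma>. c * Q f \<sigma>)"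
  using markov_linear[of N Q c f 0 f] by simp

lemma markov_sum:
  assumes "markov_op N Q" "finite I"
  shows "Q (\<lambda>\<sigma>. \<Sum>i\<in>I. f i \<sigma>) = (\<lambda>\<sigma>. \<Sum>i\<in>I. Q (f i) \<sigma>)"
  using assms(2)
proof (induction I)
  case empty
  show ?case using markov_const[OF assms(1), of 0] by simp
next
  case (insert i I)
  then show ?case using markov_add[OF assms(1), of "f i" "\<lambda>\<sigma>. \<Sum>i\<in>I. f i \<sigma>"] by simp
qed

lemma markov_dist:
  assumes "markov_op N Q" "\<And>\<sigma>. \<sigma> \<in> sym_grp N \<Longrightarrow> \<bar>f \<sigma> - g \<sigma>\<bar> \<le> e" "\<sigma> \<in> sym_grp N"
  shows "\<bar>Q f \<sigma> - Q g \<sigma>\<bar> \<le> e"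
proof -
  have "Q (\<lambda>\<sigma>. f \<sigma> - g \<sigma>) \<sigma> \<le> Q (\<lambda>_. e) \<sigma>"
    by (rule markov_mono[OF assms(1) _ assms(3)]) (use assms(2) in \<open>force simp: abs_le_iff\<close>)
  moreover have "Q (\<lambda>_. - e) \<sigma> \<le> Q (\<lambda>\<sigma>. f \<sigma> - g \<sigma>) \<sigma>"
    by (rule markov_mono[OF assms(1) _ assms(3)]) (use assms(2) in \<open>force simp: abs_le_iff\<close>)
  ultimately show ?thesis
    by (simp add: markov_diff[OF assms(1)] markov_const[OF assms(1)] abs_le_iff)
qed

lemma markov_abs:
  assumes "markov_op N Q" "\<And>\<sigma>. \<sigma> \<in> sym_grp N \<Longrightarrow> \<bar>f \<sigma>\<bar> \<le> e" "\<sigma> \<in> sym_grp N"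
  shows "\<bar>Q f \<sigma>\<bar> \<le> e"
  using markov_dist[OF assms(1), of f "\<lambda>_. 0" e \<sigma>] assms(2,3) by (simp add: markov_const[OF assms(1)])

lemma markov_compose:
  assumes "markov_op N Q" "markov_op N R"
  shows "markov_op N (\<lambda>f. Q (R f))"
  unfolding markov_op_def
proof (intro conjI allI impI ballI)
  show "Q (R (\<lambda>\<sigma>. c * f \<sigma> + d * g \<sigma>)) = (\<lambda>\<sigma>. c * Q (R f) \<sigma> + d * Q (R g) \<sigma>)" for f g c d
    by (simp add: markov_linear[OF assms(1)] markov_linear[OF assms(2)])
  show "Q (R f) \<sigma> \<le> Q (R g) \<sigma>" if "\<forall>\<sigma>\<in>sym_grp N. f \<sigma> \<le> g \<sigma>" "\<sigma> \<in> sym_grp N" for f g \<sigma>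
    by (intro markov_mono[OF assms(1)] markov_mono[OF assms(2)]) (use that in auto)
  show "Q (R (\<lambda>_. c)) = (\<lambda>_. c)" for c
    by (simp add: markov_const[OF assms(1)] markov_const[OF assms(2)])
  show "Q (R (\<lambda>\<sigma>. f (a \<circ> \<sigma>))) = (\<lambda>\<sigma>. Q (R f) (a \<circ> \<sigma>))" for f a
    by (simp add: markov_comp_left[OF assms(1)] markov_comp_left[OF assms(2)])
  show "(\<Sum>\<sigma>\<in>sym_grp N. Q (R f) \<sigma>) = (\<Sum>\<sigma>\<in>sym_grp N. f \<sigma>)" for f
    by (simp add: markov_sum_sym_grp[OF assms(1)] markov_sum_sym_grp[OF assms(2)])
qed

lemma markov_funpow: "markov_op N Q \<Longrightarrow> markov_op N (Q ^^ n)"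
proof (induction n)
  case 0
  show ?case by (simp add: markov_op_def)
next
  case (Suc n)
  then show ?case using markov_compose[of N Q "Q ^^ n"] by (simp add: comp_def)
qed

lemma markov_avg_op:
  assumes "N \<ge> 2"
  shows "markov_op N (avg_op N X)"
  unfolding markov_op_def
proof (intro conjI allI impI ballI)
  have N: "real (N - 1) > 0" using assms by simp
  show "avg_op N X (\<lambda>\<sigma>. c * f \<sigma> + d * g \<sigma>) = (\<lambda>\<sigma>. c * avg_op N X f \<sigma> + d * avg_op N X g \<sigma>)" for f g c d
  proof
    fix \<sigma>
    have "(\<Sum>x\<in>{1..N - 1}. if x \<in> X then lazy x (\<lambda>\<sigma>. c * f \<sigma> + d * g \<sigma>) \<sigma> else c * f \<sigma> + d * g \<sigma>)
      = c * (\<Sum>x\<in>{1..N - 1}. if x \<in> X then lazy x f \<sigma> else f \<sigma>) + d * (\<Sum>x\<in>{1..N - 1}. if x \<in> X then lazy x g \<sigma> else g \<sigma>)"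
      unfolding sum_distrib_left sum.distrib[symmetric]
      by (intro sum.cong) (auto simp: lazy_def field_simps)
    then show "avg_op N X (\<lambda>\<sigma>. c * f \<sigma> + d * g \<sigma>) \<sigma> = c * avg_op N X f \<sigma> + d * avg_op N X g \<sigma>"
      unfolding avg_op_def by (simp add: add_divide_distrib)
  qed
  show "avg_op N X f \<sigma> \<le> avg_op N X g \<sigma>" if "\<forall>\<sigma>\<in>sym_grp N. f \<sigma> \<le> g \<sigma>" "\<sigma> \<in> sym_grp N" for f g \<sigma>
    unfolding avg_op_def
    by (intro divide_right_mono sum_mono)
      (use that sym_grp_step in \<open>auto simp: lazy_def intro!: add_mono\<close>)
  show "avg_op N X (\<lambda>_. c) = (\<lambda>_. c)" for c
  proof -
    have "(if x \<in> X then (c + c) / 2 else c) = c" for x by simp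
    then show ?thesis unfolding avg_op_def lazy_def using N by (simp del: of_nat_diff)
  qed
  show "avg_op N X (\<lambda>\<sigma>. f (a \<circ> \<sigma>)) = (\<lambda>\<sigma>. avg_op N X f (a \<circ> \<sigma>))" for f a
    unfolding avg_op_def lazy_def by (simp only: comp_assoc)
  show "(\<Sum>\<sigma>\<in>sym_grp N. avg_op N X f \<sigma>) = (\<Sum>\<sigma>\<in>sym_grp N. f \<sigma>)" for f
  proof -
    have "(\<Sum>\<sigma>\<in>sym_grp N. if x \<in> X then lazy x f \<sigma> else f \<sigma>) = (\<Sum>\<sigma>\<in>sym_grp N. f \<sigma>)" if "x \<in> {1..N - 1}" for x
      using sum_sym_grp_comp[OF adj_transp_in_sym_grp[OF that], of f]
      by (cases "x \<in> X") (simp_all add: lazy_def sum_divide_distrib[symmetric] sum.distrib)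
    then have "(\<Sum>x\<in>{1..N - 1}. \<Sum>\<sigma>\<in>sym_grp N. if x \<in> X then lazy x f \<sigma> else f \<sigma>) = real (N - 1) * (\<Sum>\<sigma>\<in>sym_grp N. f \<sigma>)"
      by simp
    then show ?thesis
      unfolding avg_op_def sum_divide_distrib[symmetric] using N by (subst sum.swap) simp
  qed
qed

section \<open>Reversibility and the censoring inequality\<close>

lemma sum_lazy_adjoint:
  assumes "x \<in> {1..N - 1}"
  shows "(\<Sum>\<sigma>\<in>sym_grp N. lazy x f \<sigma> * g \<sigma>) = (\<Sum>\<sigma>\<in>sym_grp N. f \<sigma> * lazy x g \<sigma>)"
proof -
  have "(\<Sum>\<sigma>\<in>sym_grp N. f (\<sigma> \<circ> adj_transp x) * g \<sigma>) = (\<Sum>\<sigma>\<in>sym_grp N. f \<sigma> * g (\<sigma> \<circ> adj_transp x))"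
    using sum_sym_grp_comp[OF adj_transp_in_sym_grp[OF assms], of "\<lambda>\<sigma>. f (\<sigma> \<circ> adj_transp x) * g \<sigma>"]
    by simp
  then show ?thesis
    by (simp add: lazy_def sum_divide_distrib[symmetric] sum.distrib ring_distribs)
qed

lemma sum_avg_op_mult:
  "(\<Sum>\<sigma>\<in>sym_grp N. avg_op N X f \<sigma> * g \<sigma>) =
     (\<Sum>x\<in>{1..N - 1}. \<Sum>\<sigma>\<in>sym_grp N. (if x \<in> X then lazy x f \<sigma> else f \<sigma>) * g \<sigma>) / real (N - 1)"
  unfolding avg_op_def sum_divide_distrib[symmetric] sum_distrib_right times_divide_eq_left
  by (subst sum.swap) simp

lemma avg_op_adjoint:
  "(\<Sum>\<sigma>\<in>sym_grp N. avg_op N X f \<sigma> * g \<sigma>) = (\<Sum>\<sigma>\<in>sym_grp N. f \<sigma> * avg_op N X g \<sigma>)"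
proof -
  have "(\<Sum>\<sigma>\<in>sym_grp N. f \<sigma> * avg_op N X g \<sigma>) = (\<Sum>\<sigma>\<in>sym_grp N. avg_op N X g \<sigma> * f \<sigma>)"
    by (simp add: mult.commute)
  moreover have "(\<Sum>\<sigma>\<in>sym_grp N. (if x \<in> X then lazy x f \<sigma> else f \<sigma>) * g \<sigma>) =
      (\<Sum>\<sigma>\<in>sym_grp N. (if x \<in> X then lazy x g \<sigma> else g \<sigma>) * f \<sigma>)" if "x \<in> {1..N - 1}" for x
    using sum_lazy_adjoint[OF that, of f g] by (cases "x \<in> X") (simp_all add: mult.commute)
  ultimately show ?thesis unfolding sum_avg_op_mult by simp
qed

lemma avg_op_funpow_adjoint:
  "(\<Sum>\<sigma>\<in>sym_grp N. (avg_op N X ^^ n) f \<sigma> * g \<sigma>) = (\<Sum>\<sigma>\<in>sym_grp N. f \<sigma> * (avg_op N X ^^ n) g \<sigma>)"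
proof (induction n arbitrary: g)
  case (Suc n)
  have "(\<Sum>\<sigma>\<in>sym_grp N. (avg_op N X ^^ Suc n) f \<sigma> * g \<sigma>) = (\<Sum>\<sigma>\<in>sym_grp N. (avg_op N X ^^ n) f \<sigma> * avg_op N X g \<sigma>)"
    by (simp add: avg_op_adjoint)
  also have "\<dots> = (\<Sum>\<sigma>\<in>sym_grp N. f \<sigma> * (avg_op N X ^^ Suc n) g \<sigma>)"
    unfolding Suc.IH by (simp add: funpow_swap1)
  finally show ?case .
qed simp

text \<open>Peres--Winkler censoring: an update makes two increasing functions less correlated, because
  it averages over two comparable permutations.\<close>

lemma censoring_step:
  assumes "bruhat_mono N p" "bruhat_mono N f"
  shows "(\<Sum>\<sigma>\<in>sym_grp N. avg_op N UNIV p \<sigma> * f \<sigma>) \<le> (\<Sum>\<sigma>\<in>sym_grp N. avg_op N X p \<sigma> * f \<sigma>)"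
proof -
  have *: "(\<Sum>\<sigma>\<in>sym_grp N. lazy x p \<sigma> * f \<sigma>) \<le> (\<Sum>\<sigma>\<in>sym_grp N. p \<sigma> * f \<sigma>)" if x: "x \<in> {1..N - 1}" for x
  proof -
    let ?t = "adj_transp x"
    have "0 \<le> (p \<sigma> - p (\<sigma> \<circ> ?t)) * (f \<sigma> - f (\<sigma> \<circ> ?t))" if "\<sigma> \<in> sym_grp N" for \<sigma>
    proof -
      have t: "\<sigma> \<circ> ?t \<in> sym_grp N" using sym_grp_step[OF that x] .
      have "bruhat_le \<sigma> (\<sigma> \<circ> ?t) \<or> bruhat_le (\<sigma> \<circ> ?t) \<sigma>" using x by (intro bruhat_le_comparable) auto
      then show ?thesis
        using assms that t unfolding bruhat_mono_def by (auto intro: mult_nonneg_nonneg mult_nonpos_nonpos)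
    qed
    then have "0 \<le> (\<Sum>\<sigma>\<in>sym_grp N. (p \<sigma> - p (\<sigma> \<circ> ?t)) * (f \<sigma> - f (\<sigma> \<circ> ?t)))"
      by (intro sum_nonneg) auto
    also have "\<dots> = (\<Sum>\<sigma>\<in>sym_grp N. p \<sigma> * f \<sigma>) + (\<Sum>\<sigma>\<in>sym_grp N. p (\<sigma> \<circ> ?t) * f (\<sigma> \<circ> ?t))
        - (\<Sum>\<sigma>\<in>sym_grp N. p \<sigma> * f (\<sigma> \<circ> ?t)) - (\<Sum>\<sigma>\<in>sym_grp N. p (\<sigma> \<circ> ?t) * f \<sigma>)"
      unfolding sum.distrib[symmetric] sum_subtractf[symmetric] by (intro sum.cong) (auto simp: algebra_simps)
    also have "(\<Sum>\<sigma>\<in>sym_grp N. p (\<sigma> \<circ> ?t) * f (\<sigma> \<circ> ?t)) = (\<Sum>\<sigma>\<in>sym_grp N. p \<sigma> * f \<sigma>)"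
      using sum_sym_grp_comp[OF adj_transp_in_sym_grp[OF x], of "\<lambda>\<sigma>. p \<sigma> * f \<sigma>"] by simp
    also have "(\<Sum>\<sigma>\<in>sym_grp N. p \<sigma> * f (\<sigma> \<circ> ?t)) = (\<Sum>\<sigma>\<in>sym_grp N. p (\<sigma> \<circ> ?t) * f \<sigma>)"
      using sum_sym_grp_comp[OF adj_transp_in_sym_grp[OF x], of "\<lambda>\<sigma>. p (\<sigma> \<circ> ?t) * f \<sigma>"]
      by (simp only: adj_transp_invol)
    finally have "(\<Sum>\<sigma>\<in>sym_grp N. p (\<sigma> \<circ> ?t) * f \<sigma>) \<le> (\<Sum>\<sigma>\<in>sym_grp N. p \<sigma> * f \<sigma>)" by linarith
    then show ?thesis
      by (simp add: lazy_def sum_divide_distrib[symmetric] sum.distrib ring_distribs)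
  qed
  have **: "(\<Sum>\<sigma>\<in>sym_grp N. lazy x p \<sigma> * f \<sigma>) \<le> (\<Sum>\<sigma>\<in>sym_grp N. (if x \<in> X then lazy x p \<sigma> else p \<sigma>) * f \<sigma>)"
    if "x \<in> {1..N - 1}" for x
    using *[OF that] by (cases "x \<in> X") simp_all
  show ?thesis
    unfolding sum_avg_op_mult by (rule divide_right_mono[OF sum_mono]) (simp_all only: UNIV_I if_True ** of_nat_0_le_iff)
qed

text \<open>One update is moved onto \<open>f\<close> by self-adjointness, where it leaves an
  increasing function for the induction hypothesis. Moved back, it acts on a censored density, which
  is still increasing, and \<open>censoring_step\<close> removes it.\<close>

lemma censoring:
  assumes "bruhat_mono N p" "bruhat_mono N f"
  shows "(\<Sum>\<sigma>\<in>sym_grp N. (avg_op N UNIV ^^ n) p \<sigma> * f \<sigma>) \<le> (\<Sum>\<sigma>\<in>sym_grp N. (avg_op N X ^^ n) p \<sigma> * f \<sigma>)"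
  using assms(2)
proof (induction n arbitrary: f)
  case (Suc n)
  have "(\<Sum>\<sigma>\<in>sym_grp N. (avg_op N UNIV ^^ Suc n) p \<sigma> * f \<sigma>) = (\<Sum>\<sigma>\<in>sym_grp N. (avg_op N UNIV ^^ n) p \<sigma> * avg_op N UNIV f \<sigma>)"
    by (simp add: avg_op_adjoint)
  also have "\<dots> \<le> (\<Sum>\<sigma>\<in>sym_grp N. (avg_op N X ^^ n) p \<sigma> * avg_op N UNIV f \<sigma>)"
    by (intro Suc.IH bruhat_mono_avg_op Suc.prems)
  also have "\<dots> = (\<Sum>\<sigma>\<in>sym_grp N. avg_op N UNIV ((avg_op N X ^^ n) p) \<sigma> * f \<sigma>)"
    by (simp add: avg_op_adjoint)
  also have "\<dots> \<le> (\<Sum>\<sigma>\<in>sym_grp N. avg_op N X ((avg_op N X ^^ n) p) \<sigma> * f \<sigma>)"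
    by (intro censoring_step bruhat_mono_avg_op_funpow assms(1) Suc.prems)
  finally show ?case by simp
qed simp

lemma sum_dirac: "(\<Sum>\<sigma>\<in>sym_grp N. dirac \<sigma> * g \<sigma>) = g id"
proof -
  have "(\<Sum>\<sigma>\<in>sym_grp N. dirac \<sigma> * g \<sigma>) = (\<Sum>\<sigma>\<in>{id}. dirac \<sigma> * g \<sigma>)"
    by (rule sum.mono_neutral_right) (auto simp: dirac_def)
  then show ?thesis by (simp add: dirac_def)
qed

text \<open>The value at \<open>id\<close> is the mean of \<open>f\<close> over the chain started
  there. Both ends of the run are censored: \<open>censoring\<close> applies to the first stretch
  against an increasing observable and, after transposition, to the last stretch acting on an
  increasing density.\<close>

lemma censoring_sandwich:
  assumes "bruhat_mono N f"
  shows "(avg_op N UNIV ^^ s) ((avg_op N UNIV ^^ t) ((avg_op N UNIV ^^ s) f)) id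
     \<le> (avg_op N X ^^ s) ((avg_op N UNIV ^^ t) ((avg_op N X ^^ s) f)) id"
proof -
  note mono = bruhat_mono_avg_op_funpow
  let ?P = "avg_op N UNIV" and ?C = "avg_op N X"
  have "(?P ^^ s) ((?P ^^ t) ((?P ^^ s) f)) id = (\<Sum>\<sigma>\<in>sym_grp N. (?P ^^ s) dirac \<sigma> * (?P ^^ t) ((?P ^^ s) f) \<sigma>)"
    by (simp add: sum_dirac avg_op_funpow_adjoint)
  also have "\<dots> \<le> (\<Sum>\<sigma>\<in>sym_grp N. (?C ^^ s) dirac \<sigma> * (?P ^^ t) ((?P ^^ s) f) \<sigma>)"
    by (intro censoring mono bruhat_mono_dirac assms)
  also have "\<dots> = (\<Sum>\<sigma>\<in>sym_grp N. (?P ^^ s) ((?P ^^ t) ((?C ^^ s) dirac)) \<sigma> * f \<sigma>)"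
    by (simp add: avg_op_funpow_adjoint)
  also have "\<dots> \<le> (\<Sum>\<sigma>\<in>sym_grp N. (?C ^^ s) ((?P ^^ t) ((?C ^^ s) dirac)) \<sigma> * f \<sigma>)"
    by (intro censoring mono bruhat_mono_dirac assms)
  also have "\<dots> = (?C ^^ s) ((?P ^^ t) ((?C ^^ s) f)) id"
    by (simp add: sum_dirac avg_op_funpow_adjoint)
  finally show ?thesis .
qed

section \<open>Mixing inside blocks\<close>

lemma avg_op_ht:
  assumes "N \<ge> 2" "x \<in> {1..N - 1}"
  shows "avg_op N X (\<lambda>\<sigma>. real (ht \<sigma> x y)) \<sigma> = real (ht \<sigma> x y) +
     (if x \<in> X then ((real (ht \<sigma> (x - 1) y) + real (ht \<sigma> (x + 1) y)) / 2 - real (ht \<sigma> x y)) / real (N - 1) else 0)"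
proof -
  let ?d = "if x \<in> X then ((real (ht \<sigma> (x - 1) y) + real (ht \<sigma> (x + 1) y)) / 2 - real (ht \<sigma> x y)) else 0"
  have "(\<Sum>x'\<in>{1..N - 1}. if x' \<in> X then lazy x' (\<lambda>\<sigma>. real (ht \<sigma> x y)) \<sigma> else real (ht \<sigma> x y))
     = (\<Sum>x'\<in>{1..N - 1}. real (ht \<sigma> x y) + (if x' = x then ?d else 0))"
  proof (rule sum.cong)
    fix x' assume x': "x' \<in> {1..N - 1}"
    show "(if x' \<in> X then lazy x' (\<lambda>\<sigma>. real (ht \<sigma> x y)) \<sigma> else real (ht \<sigma> x y))
        = real (ht \<sigma> x y) + (if x' = x then ?d else 0)"
      using lazy_ht_same[of x y \<sigma>] lazy_ht_other[of x' x y \<sigma>] x' by (cases "x' = x") auto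
  qed simp
  also have "\<dots> = real (N - 1) * real (ht \<sigma> x y) + ?d"
    using assms by (simp add: sum.distrib del: of_nat_diff)
  finally have eq: "(\<Sum>x'\<in>{1..N - 1}. if x' \<in> X then lazy x' (\<lambda>\<sigma>. real (ht \<sigma> x y)) \<sigma> else real (ht \<sigma> x y))
     = real (N - 1) * real (ht \<sigma> x y) + ?d" .
  have "real (N - 1) \<noteq> 0" using assms by simp
  then show ?thesis
    unfolding avg_op_def eq by (simp add: add_divide_distrib del: of_nat_diff)
qed

text \<open>Censored positions keep their height forever and form, together with 0 and
  \<open>N\<close>, the boundary of the heat equation.\<close>

lemma avg_op_ht_fixed:
  assumes "N \<ge> 2" "x = 0 \<or> x \<notin> X \<or> x \<ge> N"
  shows "avg_op N X (\<lambda>\<sigma>. real (ht \<sigma> x y)) = (\<lambda>\<sigma>. real (ht \<sigma> x y))"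
proof
  fix \<sigma>
  have "(\<Sum>x'\<in>{1..N - 1}. if x' \<in> X then lazy x' (\<lambda>\<sigma>. real (ht \<sigma> x y)) \<sigma> else real (ht \<sigma> x y))
     = (\<Sum>x'\<in>{1..N - 1}. real (ht \<sigma> x y))"
  proof (rule sum.cong)
    fix x' assume x': "x' \<in> {1..N - 1}"
    show "(if x' \<in> X then lazy x' (\<lambda>\<sigma>. real (ht \<sigma> x y)) \<sigma> else real (ht \<sigma> x y)) = real (ht \<sigma> x y)"
      using lazy_ht_other[of x' x y \<sigma>] x' assms(2) by (cases "x' = x") auto
  qed simp
  then show "avg_op N X (\<lambda>\<sigma>. real (ht \<sigma> x y)) \<sigma> = real (ht \<sigma> x y)"
    unfolding avg_op_def using assms by (simp del: of_nat_diff)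
qed

lemma avg_op_funpow_ht_fixed:
  assumes "N \<ge> 2" "x = 0 \<or> x \<notin> X \<or> x \<ge> N"
  shows "(avg_op N X ^^ s) (\<lambda>\<sigma>. real (ht \<sigma> x y)) = (\<lambda>\<sigma>. real (ht \<sigma> x y))"
  by (induction s) (simp_all add: avg_op_ht_fixed[OF assms])

lemma avg_op_funpow_ht_Suc:
  assumes "N \<ge> 2" "x \<in> {1..N - 1}" "x \<in> X"
  shows "(avg_op N X ^^ Suc s) (\<lambda>\<sigma>. real (ht \<sigma> x y)) \<sigma> =
     (avg_op N X ^^ s) (\<lambda>\<sigma>. real (ht \<sigma> x y)) \<sigma> +
     (((avg_op N X ^^ s) (\<lambda>\<sigma>. real (ht \<sigma> (x - 1) y)) \<sigma> + (avg_op N X ^^ s) (\<lambda>\<sigma>. real (ht \<sigma> (x + 1) y)) \<sigma>) / 2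
       - (avg_op N X ^^ s) (\<lambda>\<sigma>. real (ht \<sigma> x y)) \<sigma>) / real (N - 1)"
proof -
  define \<alpha> where "\<alpha> = 1 / real (N - 1)"
  have M: "markov_op N (avg_op N X ^^ s)" using markov_funpow[OF markov_avg_op[OF assms(1)]] .
  have "avg_op N X (\<lambda>\<sigma>. real (ht \<sigma> x y)) = (\<lambda>\<sigma>. (1 - \<alpha>) * real (ht \<sigma> x y) +
     (\<alpha> / 2) * (real (ht \<sigma> (x - 1) y) + real (ht \<sigma> (x + 1) y)))"
    unfolding avg_op_ht[OF assms(1,2)] \<alpha>_def using assms by (intro ext) (simp add: field_simps del: of_nat_diff)
  then have "(avg_op N X ^^ Suc s) (\<lambda>\<sigma>. real (ht \<sigma> x y)) = (avg_op N X ^^ s) (\<lambda>\<sigma>. (1 - \<alpha>) * real (ht \<sigma> x y) +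
     (\<alpha> / 2) * (real (ht \<sigma> (x - 1) y) + real (ht \<sigma> (x + 1) y)))"
    by (simp add: funpow_swap1)
  also have "\<dots> = (\<lambda>\<sigma>. (1 - \<alpha>) * (avg_op N X ^^ s) (\<lambda>\<sigma>. real (ht \<sigma> x y)) \<sigma> +
     (\<alpha> / 2) * ((avg_op N X ^^ s) (\<lambda>\<sigma>. real (ht \<sigma> (x - 1) y)) \<sigma> + (avg_op N X ^^ s) (\<lambda>\<sigma>. real (ht \<sigma> (x + 1) y)) \<sigma>))"
    unfolding markov_linear[OF M] markov_add[OF M] ..
  finally show ?thesis
    unfolding \<alpha>_def by (simp add: algebra_simps add_divide_distrib diff_divide_distrib del: of_nat_diff)
qed

text \<open>A maximum principle: as \<alpha> \<le> 1, the update is a convex combination of earlier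
  values, so a supersolution decaying by the factor 1 - \<alpha>\<kappa> per step stays on top. It
  serves twice, with parabolas inside the blocks and with the sine wave on the whole
  interval.\<close>

lemma heat_supersolution:
  fixes D :: "nat \<Rightarrow> nat \<Rightarrow> real" and \<phi> :: "nat \<Rightarrow> real"
  assumes rec: "\<And>s x. x \<in> {1..N - 1} \<Longrightarrow> x \<in> X \<Longrightarrow>
      D (Suc s) x = D s x + \<alpha> * ((D s (x - 1) + D s (x + 1)) / 2 - D s x)"
    and bdry: "\<And>s x. x = 0 \<or> x = N \<or> x \<notin> X \<Longrightarrow> D s x \<le> 0"
    and super: "\<And>x. x \<in> {1..N - 1} \<Longrightarrow> x \<in> X \<Longrightarrow> (\<phi> (x - 1) + \<phi> (x + 1)) / 2 - \<phi> x \<le> - \<kappa> * \<phi> x"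
    and pos: "\<And>x. x \<le> N \<Longrightarrow> \<phi> x \<ge> 0"
    and init: "\<And>x. x \<le> N \<Longrightarrow> D 0 x \<le> B * \<phi> x"
    and "B \<ge> 0" "0 \<le> \<alpha>" "\<alpha> \<le> 1" "\<alpha> * \<kappa> \<le> 1" "x \<le> N"
  shows "D s x \<le> B * (1 - \<alpha> * \<kappa>) ^ s * \<phi> x"
  using \<open>x \<le> N\<close>
proof (induction s arbitrary: x)
  case 0
  then show ?case using init by simp
next
  case (Suc s)
  define c where "c = B * (1 - \<alpha> * \<kappa>) ^ s"
  have c: "c \<ge> 0" unfolding c_def using assms by simp
  show ?case
  proof (cases "x \<in> {1..N - 1} \<and> x \<in> X")
    case True
    have "D (Suc s) x = (1 - \<alpha>) * D s x + \<alpha> * ((D s (x - 1) + D s (x + 1)) / 2)"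
      using rec[of x s] True by (simp add: algebra_simps)
    also have "\<dots> \<le> (1 - \<alpha>) * (c * \<phi> x) + \<alpha> * ((c * \<phi> (x - 1) + c * \<phi> (x + 1)) / 2)"
      using Suc.IH[of x] Suc.IH[of "x - 1"] Suc.IH[of "x + 1"] True assms(7,8) Suc.prems
      unfolding c_def[symmetric]
      by (intro add_mono mult_left_mono divide_right_mono) auto
    also have "\<dots> = c * (\<phi> x + \<alpha> * ((\<phi> (x - 1) + \<phi> (x + 1)) / 2 - \<phi> x))"
      by (simp add: field_simps)
    also have "\<dots> \<le> c * (\<phi> x + \<alpha> * (- \<kappa> * \<phi> x))"
      using super[of x] True c assms(7) by (intro mult_left_mono add_left_mono) auto
    also have "\<dots> = B * (1 - \<alpha> * \<kappa>) ^ Suc s * \<phi> x" unfolding c_def by (simp add: field_simps)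
    finally show ?thesis .
  next
    case False
    then have "D (Suc s) x \<le> 0" using bdry[of x "Suc s"] Suc.prems by (cases "x = 0 \<or> x = N") auto
    also have "0 \<le> B * (1 - \<alpha> * \<kappa>) ^ Suc s * \<phi> x" using pos[OF Suc.prems] assms by simp
    finally show ?thesis .
  qed
qed

section \<open>Young subgroups: shuffles inside the blocks cut out by the censored positions\<close>

definition young :: "nat \<Rightarrow> nat set \<Rightarrow> (nat \<Rightarrow> nat) set" where
  "young N X = {a \<in> sym_grp N. \<forall>x\<in>{1..N - 1} - X. \<forall>z. a z \<le> x \<longleftrightarrow> z \<le> x}"

definition young_avg :: "nat \<Rightarrow> nat set \<Rightarrow> ((nat \<Rightarrow> nat) \<Rightarrow> real) \<Rightarrow> (nat \<Rightarrow> nat) \<Rightarrow> real" where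
  "young_avg N X f \<sigma> = (\<Sum>a\<in>young N X. f (\<sigma> \<circ> a)) / real (card (young N X))"

lemma young_subset: "young N X \<subseteq> sym_grp N"
  by (auto simp: young_def)

lemma young_finite [simp, intro]: "finite (young N X)"
  by (rule finite_subset[OF young_subset sym_grp_finite])

lemma id_in_young [simp, intro]: "id \<in> young N X"
  by (simp add: young_def)

lemma young_card_pos: "card (young N X) > 0"
  by (subst card_gt_0_iff) (use id_in_young[of N X] in auto)

lemma young_comp: "a \<in> young N X \<Longrightarrow> b \<in> young N X \<Longrightarrow> a \<circ> b \<in> young N X"
  unfolding young_def using sym_grp_comp by auto

lemma sym_grp_inv: "a \<in> sym_grp N \<Longrightarrow> inv a \<in> sym_grp N"
  unfolding sym_grp_def by (simp add: permutes_inv)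

lemma young_inv:
  assumes "a \<in> young N X"
  shows "inv a \<in> young N X"
proof -
  have p: "a permutes {1..N}" using assms by (auto simp: young_def sym_grp_def)
  have "inv a z \<le> x \<longleftrightarrow> z \<le> x" if "x \<in> {1..N - 1} - X" for x z
  proof -
    have "a (inv a z) \<le> x \<longleftrightarrow> inv a z \<le> x" using assms that unfolding young_def by blast
    then show ?thesis using permutes_inverses(1)[OF p] by simp
  qed
  then show ?thesis using assms sym_grp_inv by (auto simp: young_def)
qed

lemma sum_young_comp:
  assumes "b \<in> young N X"
  shows "(\<Sum>a\<in>young N X. f (a \<circ> b)) = (\<Sum>a\<in>young N X. f a)"
    "(\<Sum>a\<in>young N X. f (b \<circ> a)) = (\<Sum>a\<in>young N X. f a)"
proof -
  have p: "b permutes {1..N}" using assms by (auto simp: young_def sym_grp_def)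
  have i: "b \<circ> inv b = id" "inv b \<circ> b = id" using permutes_inv_o[OF p] by auto
  note y = young_inv[OF assms]
  show "(\<Sum>a\<in>young N X. f (a \<circ> b)) = (\<Sum>a\<in>young N X. f a)"
    by (rule sum.reindex_bij_witness[of _ "\<lambda>a. a \<circ> inv b" "\<lambda>a. a \<circ> b"])
      (use young_comp assms y i in \<open>auto simp: comp_assoc\<close>)
  show "(\<Sum>a\<in>young N X. f (b \<circ> a)) = (\<Sum>a\<in>young N X. f a)"
    by (rule sum.reindex_bij_witness[of _ "\<lambda>a. inv b \<circ> a" "\<lambda>a. b \<circ> a"])
      (use young_comp assms y i in \<open>auto simp: comp_assoc[symmetric]\<close>)
qed

lemma sum_young_inv: "(\<Sum>a\<in>young N X. f (inv a)) = (\<Sum>a\<in>young N X. f a)"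
proof -
  have "inv (inv a) = a" if "a \<in> young N X" for a
    using that by (intro permutes_inv_inv) (auto simp: young_def sym_grp_def)
  then show ?thesis
    by (intro sum.reindex_bij_witness[of _ inv inv]) (auto intro: young_inv)
qed

lemma adj_transp_in_young:
  assumes "x \<in> {1..N - 1}" "x \<in> X"
  shows "adj_transp x \<in> young N X"
proof -
  have "adj_transp x z \<le> x' \<longleftrightarrow> z \<le> x'" if "x' \<notin> X" for x' z
    using that assms by (cases "x' = x") (auto simp: adj_transp_def Transposition.transpose_def)
  then show ?thesis using adj_transp_in_sym_grp[OF assms(1)] by (auto simp: young_def)
qed

text \<open>Stationarity of the uniform law on the Young subgroup: right multiplication by an active
  transposition maps the subgroup to itself.\<close>

lemma sum_young_avg_op:
  assumes "N \<ge> 2"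
  shows "(\<Sum>a\<in>young N X. avg_op N X f a) = (\<Sum>a\<in>young N X. f a)"
proof -
  have "(\<Sum>a\<in>young N X. if x \<in> X then lazy x f a else f a) = (\<Sum>a\<in>young N X. f a)" if "x \<in> {1..N - 1}" for x
    using sum_young_comp(1)[OF adj_transp_in_young[OF that], of X f]
    by (cases "x \<in> X") (simp_all add: lazy_def sum_divide_distrib[symmetric] sum.distrib)
  then have "(\<Sum>x\<in>{1..N - 1}. \<Sum>a\<in>young N X. if x \<in> X then lazy x f a else f a) = real (N - 1) * (\<Sum>a\<in>young N X. f a)"
    by simp
  then show ?thesis
    unfolding avg_op_def sum_divide_distrib[symmetric] using assms by (subst sum.swap) simp
qed

lemma sum_young_avg_op_funpow:
  assumes "N \<ge> 2"
  shows "(\<Sum>a\<in>young N X. (avg_op N X ^^ s) f a) = (\<Sum>a\<in>young N X. f a)"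
  by (induction s) (simp_all add: sum_young_avg_op[OF assms])

lemma markov_young_avg: "markov_op N (young_avg N X)"
  unfolding markov_op_def
proof (intro conjI allI impI ballI)
  have c: "real (card (young N X)) > 0" using young_card_pos by simp
  show "young_avg N X (\<lambda>\<sigma>. c * f \<sigma> + d * g \<sigma>) = (\<lambda>\<sigma>. c * young_avg N X f \<sigma> + d * young_avg N X g \<sigma>)" for f g c d
    unfolding young_avg_def by (simp add: sum.distrib sum_distrib_left[symmetric] add_divide_distrib)
  show "young_avg N X f \<sigma> \<le> young_avg N X g \<sigma>" if "\<forall>\<sigma>\<in>sym_grp N. f \<sigma> \<le> g \<sigma>" "\<sigma> \<in> sym_grp N" for f g \<sigma>
    unfolding young_avg_def
    by (rule divide_right_mono[OF sum_mono]) (use that young_subset[of N X] sym_grp_comp in auto)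
  show "young_avg N X (\<lambda>_. c) = (\<lambda>_. c)" for c
    unfolding young_avg_def using c by (auto simp: fun_eq_iff)
  show "young_avg N X (\<lambda>\<sigma>. f (a \<circ> \<sigma>)) = (\<lambda>\<sigma>. young_avg N X f (a \<circ> \<sigma>))" for f a
    unfolding young_avg_def by (simp only: comp_assoc)
  show "(\<Sum>\<sigma>\<in>sym_grp N. young_avg N X f \<sigma>) = (\<Sum>\<sigma>\<in>sym_grp N. f \<sigma>)" for f
  proof -
    have "(\<Sum>\<sigma>\<in>sym_grp N. \<Sum>a\<in>young N X. f (\<sigma> \<circ> a)) = (\<Sum>a\<in>young N X. \<Sum>\<sigma>\<in>sym_grp N. f (\<sigma> \<circ> a))"
      by (rule sum.swap)
    also have "\<dots> = (\<Sum>a\<in>young N X. \<Sum>\<sigma>\<in>sym_grp N. f \<sigma>)"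
      using young_subset[of N X] by (intro sum.cong sum_sym_grp_comp) auto
    finally show ?thesis
      unfolding young_avg_def sum_divide_distrib[symmetric] using c id_in_young[of N X] by auto
  qed
qed

lemma young_avg_adjoint:
  "(\<Sum>\<sigma>\<in>sym_grp N. young_avg N X f \<sigma> * g \<sigma>) = (\<Sum>\<sigma>\<in>sym_grp N. f \<sigma> * young_avg N X g \<sigma>)"
proof -
  have "(\<Sum>\<sigma>\<in>sym_grp N. (\<Sum>a\<in>young N X. f (\<sigma> \<circ> a)) * g \<sigma>) = (\<Sum>a\<in>young N X. \<Sum>\<sigma>\<in>sym_grp N. f (\<sigma> \<circ> a) * g \<sigma>)"
    unfolding sum_distrib_right by (rule sum.swap)
  also have "\<dots> = (\<Sum>a\<in>young N X. \<Sum>\<sigma>\<in>sym_grp N. f \<sigma> * g (\<sigma> \<circ> inv a))"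
  proof (rule sum.cong[OF refl])
    fix a assume "a \<in> young N X"
    then have a: "inv a \<in> sym_grp N" "a permutes {1..N}"
      using young_inv young_subset by (auto simp: young_def sym_grp_def)
    show "(\<Sum>\<sigma>\<in>sym_grp N. f (\<sigma> \<circ> a) * g \<sigma>) = (\<Sum>\<sigma>\<in>sym_grp N. f \<sigma> * g (\<sigma> \<circ> inv a))"
      using sum_sym_grp_comp[OF a(1), of "\<lambda>\<sigma>. f (\<sigma> \<circ> a) * g \<sigma>"] permutes_inv_o(2)[OF a(2)]
      by (simp add: comp_assoc)
  qed
  also have "\<dots> = (\<Sum>a\<in>young N X. \<Sum>\<sigma>\<in>sym_grp N. f \<sigma> * g (\<sigma> \<circ> a))"
    by (rule sum_young_inv)
  also have "\<dots> = (\<Sum>\<sigma>\<in>sym_grp N. f \<sigma> * (\<Sum>a\<in>young N X. g (\<sigma> \<circ> a)))"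
    unfolding sum_distrib_left by (rule sum.swap)
  finally show ?thesis
    unfolding young_avg_def by (simp add: sum_divide_distrib[symmetric])
qed

section \<open>Comparing starting points without a coupling\<close>

lemma sym_grp_eqI_strong:
  assumes "\<sigma> \<in> sym_grp N" "\<tau> \<in> sym_grp N" "\<And>x y. x \<in> {1..N} \<Longrightarrow> y \<in> {1..N} \<Longrightarrow> ht \<sigma> x y = ht \<tau> x y"
  shows "\<sigma> = \<tau>"
proof
  fix x
  have p: "\<sigma> permutes {1..N}" "\<tau> permutes {1..N}" using assms by (auto simp: sym_grp_def)
  show "\<sigma> x = \<tau> x"
  proof (cases "x \<in> {1..N}")
    case False
    then show ?thesis using p unfolding permutes_def by auto
  next
    case True
    then obtain x' where x': "x = Suc x'" by (cases x) auto
    have h1: "ht \<sigma> x' y = ht \<tau> x' y" if "y \<in> {1..N}" for y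
      using assms(3)[of x' y] that True x' by (cases "x' = 0") auto
    have h2: "ht \<sigma> (Suc x') y = ht \<tau> (Suc x') y" if "y \<in> {1..N}" for y
      using assms(3)[OF True that] x' by simp
    have *: "(\<sigma> x \<le> y) = (\<tau> x \<le> y)" if "y \<in> {1..N}" for y
      using h1[OF that] h2[OF that] unfolding x' ht_Suc by (simp split: if_splits)
    have "\<sigma> x \<in> {1..N}" "\<tau> x \<in> {1..N}"
      using True permutes_in_image[OF p(1)] permutes_in_image[OF p(2)] by auto
    then show ?thesis using *[of "\<sigma> x"] *[of "\<tau> x"] by auto
  qed
qed

definition ht_sum :: "nat \<Rightarrow> (nat \<Rightarrow> nat) \<Rightarrow> real" where
  "ht_sum N \<sigma> = (\<Sum>(x, y)\<in>{1..N} \<times> {1..N}. real (ht \<sigma> x y))"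

lemma bruhat_le_ht_sum:
  assumes "\<sigma> \<in> sym_grp N" "\<tau> \<in> sym_grp N" "bruhat_le \<sigma> \<tau>" "\<sigma> \<noteq> \<tau>"
  shows "ht_sum N \<sigma> + 1 \<le> ht_sum N \<tau>"
proof -
  have le: "ht \<sigma> x y \<le> ht \<tau> x y" for x y using assms(3) by (simp add: bruhat_le_def)
  obtain x y where xy: "x \<in> {1..N}" "y \<in> {1..N}" "ht \<sigma> x y \<noteq> ht \<tau> x y"
    using sym_grp_eqI_strong[OF assms(1,2)] assms(4) by blast
  let ?d = "\<lambda>(x, y). real (ht \<tau> x y) - real (ht \<sigma> x y)"
  have "1 \<le> ?d (x, y)" using xy(3) le[of x y] by auto
  also have "\<dots> \<le> (\<Sum>p\<in>{1..N} \<times> {1..N}. ?d p)"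
    by (rule member_le_sum) (use xy le in auto)
  also have "\<dots> = ht_sum N \<tau> - ht_sum N \<sigma>"
    unfolding ht_sum_def sum_subtractf[symmetric] by (intro sum.cong) auto
  finally show ?thesis by simp
qed

text \<open>Heights are integers, so a strict increase in the order gains at least 2 in
  \<open>2 * ht_sum N\<close>, which pays for the largest possible drop of \<open>f\<close>.\<close>

lemma bruhat_mono_ht_sum:
  assumes "\<And>\<sigma>. \<sigma> \<in> sym_grp N \<Longrightarrow> \<bar>f \<sigma>\<bar> \<le> 1"
  shows "bruhat_mono N (\<lambda>\<sigma>. 2 * ht_sum N \<sigma> + f \<sigma>)"
  unfolding bruhat_mono_def
proof (intro ballI impI)
  fix \<sigma> \<tau> assume a: "\<sigma> \<in> sym_grp N" "\<tau> \<in> sym_grp N" "bruhat_le \<sigma> \<tau>"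
  show "2 * ht_sum N \<sigma> + f \<sigma> \<le> 2 * ht_sum N \<tau> + f \<tau>"
    using bruhat_le_ht_sum[OF a] assms[OF a(1)] assms[OF a(2)] by (cases "\<sigma> = \<tau>") auto
qed

text \<open>This replaces a monotone coupling: \<open>2 * ht_sum N \<plusminus> f\<close> is increasing, and the dynamics
  preserves increasing functions.\<close>

lemma coupling_bound:
  assumes "N \<ge> 2" "\<And>\<sigma>. \<sigma> \<in> sym_grp N \<Longrightarrow> \<bar>f \<sigma>\<bar> \<le> 1" "a \<in> sym_grp N"
  shows "\<bar>(avg_op N X ^^ s) f id - (avg_op N X ^^ s) f a\<bar>
     \<le> 2 * ((avg_op N X ^^ s) (ht_sum N) id - (avg_op N X ^^ s) (ht_sum N) a)"
proof -
  let ?C = "avg_op N X ^^ s"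
  have M: "markov_op N ?C" using markov_funpow[OF markov_avg_op[OF assms(1)]] .
  have *: "2 * ?C (ht_sum N) a + ?C g a \<le> 2 * ?C (ht_sum N) id + ?C g id"
    if "\<And>\<sigma>. \<sigma> \<in> sym_grp N \<Longrightarrow> \<bar>g \<sigma>\<bar> \<le> 1" for g
  proof -
    have "bruhat_mono N (?C (\<lambda>\<sigma>. 2 * ht_sum N \<sigma> + g \<sigma>))"
      by (intro bruhat_mono_avg_op_funpow bruhat_mono_ht_sum that)
    then have "?C (\<lambda>\<sigma>. 2 * ht_sum N \<sigma> + g \<sigma>) a \<le> ?C (\<lambda>\<sigma>. 2 * ht_sum N \<sigma> + g \<sigma>) id"
      using bruhat_le_id[OF assms(3)] assms(3) unfolding bruhat_mono_def by auto
    then show ?thesis using markov_linear[OF M, of 2 "ht_sum N" 1 g] by simp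
  qed
  show ?thesis using *[of f] *[of "\<lambda>\<sigma>. - f \<sigma>"] assms(2) markov_scale[OF M, of "-1" f] by auto
qed

section \<open>A parabolic supersolution and mixing inside the blocks\<close>

definition block_interior :: "nat \<Rightarrow> nat \<Rightarrow> nat set" where
  "block_interior n K = {x. \<not> (\<exists>i\<in>{1..K - 1}. x = i * n)}"

lemma ht_young:
  assumes "a \<in> young N X" "x \<in> {1..N - 1} - X"
  shows "ht (\<sigma> \<circ> a) x y = ht \<sigma> x y"
proof -
  have a: "a \<in> sym_grp N" and iff: "\<And>z. a z \<le> x \<longleftrightarrow> z \<le> x" using assms by (auto simp: young_def)
  have p: "a permutes {1..N}" using a by (simp add: sym_grp_def)
  have mem: "a z \<in> {1..x} \<longleftrightarrow> z \<in> {1..x}" for z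
    using iff[of z] sym_grp_pos[OF a, of z] sym_grp_0[OF a] by (cases "z = 0") auto
  have "bij_betw a {1..x} {1..x}"
    unfolding bij_betw_def
  proof (intro conjI set_eqI)
    show "inj_on a {1..x}" using permutes_inj[OF p] by (rule inj_on_subset) simp
    fix w
    obtain z where "w = a z" using permutes_surj[OF p] unfolding surj_def by blast
    then show "w \<in> a ` {1..x} \<longleftrightarrow> w \<in> {1..x}" 
      using mem[of z] inj_image_mem_iff[OF permutes_inj[OF p], of z "{1..x}"] by simp
  qed
  then have "bij_betw a {z \<in> {1..x}. (\<sigma> \<circ> a) z \<le> y} {z \<in> {1..x}. \<sigma> z \<le> y}"
    by (rule bij_betw_Collect) simp
  then show ?thesis unfolding ht_def by (rule bij_betw_same_card)
qed

text \<open>On each block \<phi> is the parabola \<open>t (2 n - t)\<close> in the offset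
  \<open>t\<close> from the left end. Its second difference is -2 and its maximum n^2, whence the
  rate 1 / n^2. The width 2 n is dictated by the last block, which absorbs the remainder; a shorter
  block cuts the parabola off, and the resulting drop to 0 only helps a supersolution.\<close>

lemma block_supersolution:
  fixes n K N :: nat
  defines "q \<equiv> \<lambda>x. min (x div n) (K - 1)"
  defines "\<phi> \<equiv> \<lambda>x. real (x - n * q x) * (2 * real n - real (x - n * q x))"
  assumes "n \<ge> 1" "K \<ge> 1" "(K - 1) * n < N" "N \<le> (K + 1) * n"
  shows "x \<le> N \<Longrightarrow> 0 \<le> \<phi> x" "x \<le> N \<Longrightarrow> \<phi> x \<le> real n ^ 2"
    "x \<in> {1..N - 1} \<Longrightarrow> x \<in> block_interior n K \<Longrightarrow> 1 \<le> \<phi> x"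
    "x \<in> {1..N - 1} \<Longrightarrow> x \<in> block_interior n K \<Longrightarrow> (\<phi> (x - 1) + \<phi> (x + 1)) / 2 - \<phi> x \<le> - (1 / real n ^ 2) * \<phi> x"
proof -
  have q_le: "n * q x \<le> x" for x
    unfolding q_def by (metis le_trans min.cobounded1 mult_le_mono2 times_div_less_eq_dividend)
  have q_mono: "q x \<le> q (x + 1)" for x
    unfolding q_def by (intro min.mono div_le_mono) auto
  have q_max: "q x \<le> K - 1" for x unfolding q_def by simp
  have t_lt: "x - n * q x < n \<or> q x = K - 1" for x
  proof (cases "x div n \<le> K - 1")
    case True
    then have "x - n * q x = x mod n" unfolding q_def by (simp add: minus_mult_div_eq_mod)
    then show ?thesis using assms(3) by simp
  qed (simp add: q_def)
  have t_le: "x - n * q x \<le> 2 * n" if "x \<le> N" for x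
  proof -
    have "q x = K - 1 \<Longrightarrow> x - n * q x \<le> 2 * n"
    proof -
      assume "q x = K - 1"
      moreover have "x \<le> n * (K - 1) + 2 * n"
        using that assms(4,6) by (cases K) (auto simp: algebra_simps)
      ultimately show ?thesis by simp
    qed
    then show ?thesis using t_lt[of x] by linarith
  qed
  show pos: "0 \<le> \<phi> x" if "x \<le> N" for x
  proof -
    have "real (x - n * q x) \<le> 2 * real n" using t_le[OF that] by linarith
    then show ?thesis unfolding \<phi>_def by simp
  qed
  show le: "\<phi> x \<le> real n ^ 2" for x
  proof -
    have "0 \<le> (real (x - n * q x) - real n)\<^sup>2" by simp
    then show ?thesis unfolding \<phi>_def by (simp add: power2_eq_square algebra_simps)
  qed
  have t_pos: "x - n * q x \<ge> 1" if "x \<in> {1..N - 1}" "x \<in> block_interior n K" for x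
  proof (rule ccontr)
    assume "\<not> ?thesis"
    then have "x = q x * n" using q_le[of x] by (simp add: mult.commute)
    moreover have "q x \<noteq> 0" using calculation that by (intro notI) auto
    moreover have "q x \<le> K - 1" unfolding q_def by simp
    ultimately have "\<exists>i\<in>{1..K - 1}. x = i * n" by (intro bexI[of _ "q x"]) auto
    then show False using that(2) by (simp add: block_interior_def)
  qed
  have t_lt2: "x - n * q x < 2 * n" if "x \<in> {1..N - 1}" for x
  proof -
    have "x < N" using that by auto
    then have "q (x + 1) = q x \<Longrightarrow> ?thesis" using t_le[of "x + 1"] q_le[of x] by simp
    moreover have "q (x + 1) \<noteq> q x \<Longrightarrow> q x < K - 1"
      using q_mono[of x] q_max[of "x + 1"] by linarith
    moreover have "q x < K - 1 \<Longrightarrow> ?thesis" using t_lt[of x] assms(3) by linarith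
    ultimately show ?thesis by blast
  qed
  show "1 \<le> \<phi> x" if "x \<in> {1..N - 1}" "x \<in> block_interior n K" for x
  proof -
    have "1 \<le> real (x - n * q x)" "1 \<le> 2 * real n - real (x - n * q x)"
      using t_pos[OF that] t_lt2[OF that(1)] by linarith+
    then have "1 * 1 \<le> \<phi> x" unfolding \<phi>_def by (rule mult_mono) simp_all
    then show ?thesis by simp
  qed
  show "(\<phi> (x - 1) + \<phi> (x + 1)) / 2 - \<phi> x \<le> - (1 / real n ^ 2) * \<phi> x" if x: "x \<in> {1..N - 1}" "x \<in> block_interior n K" for x
  proof -
    define t where "t = real (x - n * q x)"
    have tx: "x \<ge> n * q x + 1" using t_pos[OF x] by simp
    have q1: "q (x - 1) = q x"
    proof (rule antisym)
      show "q (x - 1) \<le> q x" unfolding q_def using div_le_mono[of "x - 1" x n] by (simp add: min.coboundedI1)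
      have "q x \<le> (x - 1) div n"
        using tx assms(3) by (subst less_eq_div_iff_mult_less_eq) (auto simp: mult.commute)
      then show "q x \<le> q (x - 1)" unfolding q_def by simp
    qed
    have p1: "\<phi> (x - 1) = (t - 1) * (2 * real n - (t - 1))"
      unfolding \<phi>_def q1 t_def using tx by (simp add: of_nat_diff algebra_simps)
    \<comment> \<open>If \<open>x + 1\<close> starts a new block, \<phi> restarts there at 0, while
      the continued parabola equals n^2; hence an inequality instead of the equality in
      \<open>p1\<close>.\<close>
    have p2: "\<phi> (x + 1) \<le> (t + 1) * (2 * real n - (t + 1))"
    proof (cases "q (x + 1) = q x")
      case True
      then show ?thesis unfolding \<phi>_def True t_def using q_le[of x] by (simp add: of_nat_diff algebra_simps)
    next
      case False
      have "q x < K - 1" using False q_mono[of x] q_max[of "x + 1"] by linarith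
      then have "x div n < K - 1" unfolding q_def by (simp add: min_def split: if_splits)
      have "(x + 1) div n \<noteq> x div n" using False unfolding q_def by metis
      then have "(x + 1) mod n = 0" "x div n + 1 = (x + 1) div n" by (auto simp: div_Suc split: if_splits)
      then have *: "q x = x div n" "q (x + 1) = (x + 1) div n"
        using \<open>x div n < K - 1\<close> unfolding q_def by simp_all
      have **: "x + 1 = n * q (x + 1)" using \<open>(x + 1) mod n = 0\<close> * mult_div_mod_eq[of n "x + 1"] by simp
      then have "x + 1 = n * q x + n" using * \<open>x div n + 1 = (x + 1) div n\<close> by (metis add.commute mult.right_neutral distrib_left)
      then have "x - n * q x + 1 = n" using tx by linarith
      then have "t + 1 = real n" unfolding t_def by linarith
      then have "0 \<le> (t + 1) * (2 * real n - (t + 1))" by simp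
      moreover have "\<phi> (x + 1) = 0" unfolding \<phi>_def using ** by simp
      ultimately show ?thesis by simp
    qed
    have "\<phi> x = t * (2 * real n - t)" unfolding \<phi>_def t_def by simp
    moreover have "(t - 1) * (2 * real n - (t - 1)) + (t + 1) * (2 * real n - (t + 1)) = 2 * (t * (2 * real n - t)) - 2"
      by (simp add: algebra_simps)
    ultimately have "(\<phi> (x - 1) + \<phi> (x + 1)) / 2 - \<phi> x \<le> - 1"
      using p1 p2 by argo
    moreover have "(1 / real n ^ 2) * \<phi> x \<le> 1" using le[of x] assms(3) by (simp add: field_simps)
    ultimately show ?thesis by linarith
  qed
qed

text \<open>Started from \<open>id\<close> and from \<open>a\<close>, the mean heights agree at all
  cuts forever, so their difference solves the heat equation with zero boundary values. As \<phi>
  \<ge> 1 in the interior, N \<phi> dominates the initial difference.\<close>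

lemma block_ht_bound:
  assumes "N \<ge> 2" "n \<ge> 1" "K \<ge> 1" "(K - 1) * n < N" "N \<le> (K + 1) * n"
    and a: "a \<in> young N (block_interior n K)" and x: "x \<le> N" and y: "y \<le> N"
  shows "(avg_op N (block_interior n K) ^^ s) (\<lambda>\<sigma>. real (ht \<sigma> x y)) id - (avg_op N (block_interior n K) ^^ s) (\<lambda>\<sigma>. real (ht \<sigma> x y)) a
     \<le> real N * real n ^ 2 * (1 - 1 / (real n ^ 2 * real (N - 1))) ^ s"
proof -
  let ?X = "block_interior n K"
  define q where "q = (\<lambda>x. min (x div n) (K - 1))"
  define \<phi> where "\<phi> = (\<lambda>x. real (x - n * q x) * (2 * real n - real (x - n * q x)))"
  define D where "D = (\<lambda>s x. (avg_op N ?X ^^ s) (\<lambda>\<sigma>. real (ht \<sigma> x y)) id - (avg_op N ?X ^^ s) (\<lambda>\<sigma>. real (ht \<sigma> x y)) a)"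
  have sup: "0 \<le> \<phi> x" "\<phi> x \<le> real n ^ 2" if "x \<le> N" for x
    unfolding \<phi>_def q_def by (rule block_supersolution(1)[OF assms(2-5) that], rule block_supersolution(2)[OF assms(2-5) that])
  have sup': "1 \<le> \<phi> x" "(\<phi> (x - 1) + \<phi> (x + 1)) / 2 - \<phi> x \<le> - (1 / real n ^ 2) * \<phi> x"
    if "x \<in> {1..N - 1}" "x \<in> ?X" for x
    unfolding \<phi>_def q_def by (rule block_supersolution(3)[OF assms(2-5) that], rule block_supersolution(4)[OF assms(2-5) that])
  have aS: "a \<in> sym_grp N" using a young_subset by auto
  have bd: "D s x \<le> 0" if "x = 0 \<or> x = N \<or> x \<notin> ?X" for s x
  proof -
    have "ht id x y = ht a x y"
      using that
    proof (elim disjE)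
      assume "x = 0" then show ?thesis by simp
    next
      assume "x = N" then show ?thesis using ht_full[OF id_in_sym_grp y] ht_full[OF aS y] by simp
    next
      assume nx: "x \<notin> ?X"
      then obtain i where i: "i \<in> {1..K - 1}" "x = i * n" by (auto simp: block_interior_def)
      then have "i * n \<le> (K - 1) * n" by (intro mult_le_mono1) auto
      then have "x \<le> N - 1" using i assms(4) by linarith
      moreover have "x \<ge> 1" using i assms(2) by simp
      ultimately have "x \<in> {1..N - 1} - ?X" using nx by simp
      then show ?thesis using ht_young[OF a, of x id y] by simp
    qed
    moreover have "x = 0 \<or> x \<notin> ?X \<or> x \<ge> N" using that by auto
    ultimately show ?thesis unfolding D_def by (simp add: avg_op_funpow_ht_fixed[OF assms(1)])
  qed
  have "D s x \<le> real N * (1 - 1 / real (N - 1) * (1 / real n ^ 2)) ^ s * \<phi> x"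
  proof (rule heat_supersolution[where N=N and X="?X"])
    show "D (Suc s) x = D s x + 1 / real (N - 1) * ((D s (x - 1) + D s (x + 1)) / 2 - D s x)"
      if "x \<in> {1..N - 1}" "x \<in> ?X" for s x
      unfolding D_def avg_op_funpow_ht_Suc[OF assms(1) that]
      by (simp add: algebra_simps add_divide_distrib diff_divide_distrib del: of_nat_diff)
    show "D 0 x \<le> real N * \<phi> x" if "x \<le> N" for x
    proof (cases "x \<in> {1..N - 1} \<and> x \<in> ?X")
      case True
      have "D 0 x \<le> real (ht id x y)" unfolding D_def by simp
      also have "\<dots> \<le> real N * 1" using x y that by (simp add: ht_id)
      also have "\<dots> \<le> real N * \<phi> x" using sup'(1)[of x] True by (intro mult_left_mono) auto
      finally show ?thesis .
    next
      case False
      then have "D 0 x \<le> 0" using that by (intro bd) auto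
      then show ?thesis using sup(1)[OF that] by (smt (verit) mult_nonneg_nonneg of_nat_0_le_iff)
    qed
    have "1 \<le> real (N - 1)" "1 \<le> real n ^ 2" using assms(1,2) by auto
    moreover have "1 / c \<le> 1" if "1 \<le> c" for c :: real using that by (simp add: divide_le_eq)
    ultimately have *: "1 / real (N - 1) \<le> 1" "1 / real n ^ 2 \<le> 1" by blast+
    show "1 / real (N - 1) \<le> 1" by (rule *)
    show "1 / real (N - 1) * (1 / real n ^ 2) \<le> 1" by (rule mult_le_one[OF *(1) _ *(2)]) simp
  qed (use bd sup(1) sup'(2) x in auto)
  also have "\<dots> \<le> real N * (1 - 1 / real (N - 1) * (1 / real n ^ 2)) ^ s * real n ^ 2"
  proof (rule mult_left_mono[OF sup(2)[OF x]])
    have "1 \<le> real (N - 1)" "1 \<le> real n ^ 2" using assms(1,2) by auto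
    moreover have "1 / c \<le> 1" if "1 \<le> c" for c :: real using that by (simp add: divide_le_eq)
    ultimately have "1 / real (N - 1) \<le> 1" "1 / real n ^ 2 \<le> 1" by blast+
    then have "1 / real (N - 1) * (1 / real n ^ 2) \<le> 1" by (intro mult_le_one) simp_all
    then show "0 \<le> real N * (1 - 1 / real (N - 1) * (1 / real n ^ 2)) ^ s" by simp
  qed
  finally show ?thesis unfolding D_def by (simp add: mult_ac del: of_nat_diff)
qed

text \<open>Left translation by \<sigma> reduces to the start \<open>id\<close>. That run is
  compared with the run from each \<open>a\<close> in the Young subgroup, and by stationarity the
  average over \<open>a\<close> is the equilibrium value. The prefactor collects 2 from
  \<open>coupling_bound\<close>, N^2 heights, and N n^2 from \<open>block_ht_bound\<close>.\<close>

lemma block_mixing: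
  assumes "N \<ge> 2" "n \<ge> 1" "K \<ge> 1" "(K - 1) * n < N" "N \<le> (K + 1) * n"
    and f: "\<And>\<sigma>. \<sigma> \<in> sym_grp N \<Longrightarrow> \<bar>f \<sigma>\<bar> \<le> 1" and \<sigma>: "\<sigma> \<in> sym_grp N"
  shows "\<bar>(avg_op N (block_interior n K) ^^ s) f \<sigma> - young_avg N (block_interior n K) f \<sigma>\<bar>
     \<le> 2 * real N ^ 3 * real n ^ 2 * (1 - 1 / (real n ^ 2 * real (N - 1))) ^ s"
proof -
  let ?X = "block_interior n K" let ?C = "avg_op N (block_interior n K) ^^ s"
  let ?Y = "young N ?X"
  define r where "r = real N * real n ^ 2 * (1 - 1 / (real n ^ 2 * real (N - 1))) ^ s"
  define g where "g = (\<lambda>\<tau>. f (\<sigma> \<circ> \<tau>))"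
  have M: "markov_op N ?C" using markov_funpow[OF markov_avg_op[OF assms(1)]] .
  have gb: "\<bar>g \<tau>\<bar> \<le> 1" if "\<tau> \<in> sym_grp N" for \<tau> unfolding g_def using f sym_grp_comp[OF \<sigma> that] by blast
  have Cg: "?C g = (\<lambda>\<tau>. ?C f (\<sigma> \<circ> \<tau>))" unfolding g_def by (rule markov_comp_left[OF M])
  have bound: "\<bar>?C g id - ?C g a\<bar> \<le> 2 * (real N ^ 2 * r)" if a: "a \<in> ?Y" for a
  proof -
    have "?C (ht_sum N) = (\<lambda>\<sigma>. \<Sum>p\<in>{1..N} \<times> {1..N}. ?C (\<lambda>\<sigma>. real (ht \<sigma> (fst p) (snd p))) \<sigma>)"
      unfolding ht_sum_def case_prod_beta by (rule markov_sum[OF M]) simp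
    then have "?C (ht_sum N) id - ?C (ht_sum N) a = (\<Sum>p\<in>{1..N} \<times> {1..N}.
        ?C (\<lambda>\<sigma>. real (ht \<sigma> (fst p) (snd p))) id - ?C (\<lambda>\<sigma>. real (ht \<sigma> (fst p) (snd p))) a)"
      by (simp add: sum_subtractf)
    also have "\<dots> \<le> (\<Sum>p\<in>{1..N} \<times> {1..N}. r)"
      unfolding r_def by (intro sum_mono block_ht_bound assms a) auto
    also have "\<dots> = real N ^ 2 * r" by (simp add: power2_eq_square)
    finally have "?C (ht_sum N) id - ?C (ht_sum N) a \<le> real N ^ 2 * r" .
    then show ?thesis using coupling_bound[where f=g and a=a and X="?X" and s=s, OF assms(1) gb] a young_subset[of N ?X] by auto
  qed
  have c: "real (card ?Y) > 0" using young_card_pos by simp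
  have "real (card ?Y) * young_avg N ?X f \<sigma> = (\<Sum>a\<in>?Y. g a)" unfolding young_avg_def g_def using c by simp
  also have "\<dots> = (\<Sum>a\<in>?Y. ?C g a)" by (simp add: sum_young_avg_op_funpow[OF assms(1)])
  finally have "real (card ?Y) * (?C f \<sigma> - young_avg N ?X f \<sigma>) = (\<Sum>a\<in>?Y. ?C g id - ?C g a)"
    by (simp add: sum_subtractf Cg right_diff_distrib)
  then have "real (card ?Y) * \<bar>?C f \<sigma> - young_avg N ?X f \<sigma>\<bar> = \<bar>\<Sum>a\<in>?Y. ?C g id - ?C g a\<bar>"
    using c by (metis abs_mult abs_of_nonneg less_imp_le)
  also have "\<dots> \<le> (\<Sum>a\<in>?Y. \<bar>?C g id - ?C g a\<bar>)" by (rule sum_abs)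
  also have "\<dots> \<le> (\<Sum>a\<in>?Y. 2 * (real N ^ 2 * r))" by (intro sum_mono bound)
  also have "\<dots> = real (card ?Y) * (2 * (real N ^ 2 * r))" by simp
  finally have "\<bar>?C f \<sigma> - young_avg N ?X f \<sigma>\<bar> \<le> 2 * (real N ^ 2 * r)" using c by simp
  then show ?thesis unfolding r_def by (simp add: power2_eq_square power3_eq_cube mult_ac)
qed

section \<open>The block-smoothed law\<close>

lemma bruhat_mono_mean_le_id:
  assumes "bruhat_mono N f"
  shows "(\<Sum>\<sigma>\<in>sym_grp N. f \<sigma>) / fact N \<le> f id"
proof -
  have "(\<Sum>\<sigma>\<in>sym_grp N. f \<sigma>) \<le> (\<Sum>\<sigma>\<in>sym_grp N. f id)"
    using assms bruhat_le_id by (intro sum_mono) (auto simp: bruhat_mono_def)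
  then show ?thesis by (simp add: card_sym_grp divide_le_eq mult.commute)
qed

locale blocks =
  fixes N n K :: nat
  assumes N2: "N \<ge> 2" and n1: "n \<ge> 1" and K1: "K \<ge> 1"
    and last_pos: "(K - 1) * n < N" and last_le: "N \<le> (K + 1) * n"
begin

abbreviation "Y \<equiv> young N (block_interior n K)"
abbreviation "U \<equiv> young_avg N (block_interior n K)"
abbreviation "C \<equiv> avg_op N (block_interior n K)"
abbreviation "P \<equiv> avg_op N UNIV"

definition mix_err :: "nat \<Rightarrow> real" where
  "mix_err s = 2 * real N ^ 3 * real n ^ 2 * (1 - 1 / (real n ^ 2 * real (N - 1))) ^ s"

lemma mixing:
  assumes "\<And>\<sigma>. \<sigma> \<in> sym_grp N \<Longrightarrow> \<bar>f \<sigma>\<bar> \<le> 1" "\<sigma> \<in> sym_grp N"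
  shows "\<bar>(C ^^ s) f \<sigma> - U f \<sigma>\<bar> \<le> mix_err s"
  unfolding mix_err_def by (rule block_mixing[OF N2 n1 K1 last_pos last_le assms])

lemma mix_err_tendsto: "mix_err \<longlonglongrightarrow> 0"
proof -
  have "real n ^ 2 * real (N - 1) \<ge> 1 * 1" using N2 n1 by (intro mult_mono) auto
  then have "\<bar>1 - 1 / (real n ^ 2 * real (N - 1))\<bar> < 1" by (simp add: abs_if field_simps del: of_nat_diff)
  then have "(\<lambda>s. 2 * real N ^ 3 * real n ^ 2 * (1 - 1 / (real n ^ 2 * real (N - 1))) ^ s) \<longlonglongrightarrow> 2 * real N ^ 3 * real n ^ 2 * 0"
    by (intro tendsto_mult_left LIMSEQ_power_zero) simp
  then show ?thesis unfolding mix_err_def[abs_def] by simp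
qed

lemma mixing_tendsto:
  assumes "\<sigma> \<in> sym_grp N"
  shows "(\<lambda>s. (C ^^ s) f \<sigma>) \<longlonglongrightarrow> U f \<sigma>"
proof -
  \<comment> \<open>The summand 1 keeps \<open>B\<close> positive when \<open>f\<close> vanishes;
    dividing by \<open>B\<close> brings \<open>f\<close> within the bound that \<open>mixing\<close>
    requires.\<close>
  define B where "B = 1 + (\<Sum>\<sigma>\<in>sym_grp N. \<bar>f \<sigma>\<bar>)"
  have B: "B > 0" unfolding B_def by (smt (verit) sum_nonneg abs_ge_zero)
  define g where "g = (\<lambda>\<sigma>. (1 / B) * f \<sigma>)"
  have "\<bar>f \<tau>\<bar> \<le> B" if "\<tau> \<in> sym_grp N" for \<tau>
  proof -
    have "\<bar>f \<tau>\<bar> \<le> (\<Sum>\<sigma>\<in>sym_grp N. \<bar>f \<sigma>\<bar>)" by (rule member_le_sum) (use that in auto)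
    then show ?thesis unfolding B_def by simp
  qed
  then have gb: "\<bar>g \<tau>\<bar> \<le> 1" if "\<tau> \<in> sym_grp N" for \<tau>
    unfolding g_def using B that by (simp add: abs_mult divide_le_eq)
  have "(\<lambda>s. (C ^^ s) g \<sigma> - U g \<sigma>) \<longlonglongrightarrow> 0"
    by (rule Lim_null_comparison[OF _ mix_err_tendsto]) (use mixing[OF gb assms] in auto)
  then have "(\<lambda>s. B * (C ^^ s) g \<sigma>) \<longlonglongrightarrow> B * U g \<sigma>"
    by (intro tendsto_mult_left) (simp add: LIM_zero_iff)
  moreover have "B * (C ^^ s) g \<sigma> = (C ^^ s) f \<sigma>" for s
    unfolding g_def markov_scale[OF markov_funpow[OF markov_avg_op[OF N2]]] using B by simp
  moreover have "B * U g \<sigma> = U f \<sigma>"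
    unfolding g_def markov_scale[OF markov_young_avg] using B by simp
  ultimately show ?thesis by simp
qed

text \<open>Block averaging is a limit of powers of the censored dynamics, which preserve increasing
  functions; this spares a direct comparison of averages over two cosets.\<close>

lemma bruhat_mono_young_avg:
  assumes "bruhat_mono N f"
  shows "bruhat_mono N (U f)"
  unfolding bruhat_mono_def
proof (intro ballI impI)
  fix \<sigma> \<tau> assume a: "\<sigma> \<in> sym_grp N" "\<tau> \<in> sym_grp N" "bruhat_le \<sigma> \<tau>"
  show "U f \<sigma> \<le> U f \<tau>"
  proof (rule LIMSEQ_le[OF mixing_tendsto[OF a(1)] mixing_tendsto[OF a(2)]])
    show "\<exists>M. \<forall>s\<ge>M. (C ^^ s) f \<sigma> \<le> (C ^^ s) f \<tau>"
      using bruhat_mono_avg_op_funpow[OF assms] a unfolding bruhat_mono_def by blast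
  qed
qed

text \<open>The outer averaging makes the density blind to the order of positions inside a block,
  the inner one to the order of labels inside a block. Together they reduce it to a function of the
  block counts.\<close>

definition smoothed :: "nat \<Rightarrow> (nat \<Rightarrow> nat) \<Rightarrow> real" where
  "smoothed t = U ((P ^^ t) (U dirac))"

lemma markov_UPU: "markov_op N (\<lambda>f. U ((P ^^ t) (U f)))"
proof -
  have "markov_op N (\<lambda>f. (P ^^ t) (U f))"
    by (rule markov_compose[OF markov_funpow[OF markov_avg_op[OF N2]] markov_young_avg])
  then show ?thesis by (rule markov_compose[OF markov_young_avg])
qed

lemma sum_smoothed: "(\<Sum>\<sigma>\<in>sym_grp N. smoothed t \<sigma> * f \<sigma>) = U ((P ^^ t) (U f)) id"
  unfolding smoothed_def by (simp add: young_avg_adjoint avg_op_funpow_adjoint sum_dirac)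

lemma smoothed_nonneg: "\<sigma> \<in> sym_grp N \<Longrightarrow> 0 \<le> smoothed t \<sigma>"
  using markov_mono[OF markov_UPU, of "\<lambda>_. 0" dirac \<sigma> t] markov_const[OF markov_UPU, of t 0]
  unfolding smoothed_def by (auto simp: dirac_def fun_eq_iff)

lemma smoothed_sum_1: "(\<Sum>\<sigma>\<in>sym_grp N. smoothed t \<sigma>) = 1"
  using markov_sum_sym_grp[OF markov_UPU, of t dirac] sum_dirac[of "\<lambda>_. 1" N]
  unfolding smoothed_def by simp

lemma smoothed_mono: "bruhat_mono N (smoothed t)"
  unfolding smoothed_def
  by (intro bruhat_mono_young_avg bruhat_mono_avg_op_funpow bruhat_mono_dirac)

lemma smoothed_right_invariant:
  assumes "a \<in> Y"
  shows "smoothed t (\<sigma> \<circ> a) = smoothed t \<sigma>"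
proof -
  have "U f (\<sigma> \<circ> a) = U f \<sigma>" for f
    unfolding young_avg_def using sum_young_comp(2)[OF assms, of "\<lambda>b. f (\<sigma> \<circ> b)"] by (simp add: comp_assoc)
  then show ?thesis unfolding smoothed_def by blast
qed

lemma smoothed_left_invariant:
  assumes "a \<in> Y"
  shows "smoothed t (a \<circ> \<sigma>) = smoothed t \<sigma>"
proof -
  have p: "a permutes {1..N}" using assms by (auto simp: young_def sym_grp_def)
  have i: "a \<circ> inv a = id" "inv a \<circ> a = id" using permutes_inv_o[OF p] by auto
  \<comment> \<open>The point mass at \<open>id\<close> is central, so a factor on the left can be
    moved to the right, where the inner averaging absorbs it; the operators applied afterwards
    commute with left multiplication.\<close>
  have dir: "dirac (a \<circ> x) = dirac (x \<circ> a)" for x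
  proof -
    have "a \<circ> x = id \<longleftrightarrow> x = inv a" using i by (metis comp_assoc id_comp comp_id)
    moreover have "x \<circ> a = id \<longleftrightarrow> x = inv a" using i by (metis comp_assoc id_comp comp_id)
    ultimately show ?thesis by (simp add: dirac_def)
  qed
  have "U dirac (a \<circ> \<sigma>) = U dirac \<sigma>" for \<sigma>
    unfolding young_avg_def using dir[of "\<sigma> \<circ> _"] sum_young_comp(1)[OF assms, of "\<lambda>b. dirac (\<sigma> \<circ> b)"]
    by (simp add: comp_assoc)
  then have "U ((P ^^ t) (\<lambda>\<sigma>. U dirac (a \<circ> \<sigma>))) \<sigma> = U ((P ^^ t) (U dirac)) \<sigma>" by simp
  then show ?thesis
    unfolding smoothed_def
    by (simp add: markov_comp_left[OF markov_funpow[OF markov_avg_op[OF N2]]] markov_comp_left[OF markov_young_avg])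
qed

text \<open>The smoothed dynamics preserves increasing functions and uniform means, and an
  increasing function is largest at \<open>id\<close>, where the chain starts.\<close>

lemma smoothed_dominates:
  assumes "bruhat_mono N f"
  shows "(\<Sum>\<sigma>\<in>sym_grp N. f \<sigma>) / fact N \<le> (\<Sum>\<sigma>\<in>sym_grp N. smoothed t \<sigma> * f \<sigma>)"
proof -
  have "bruhat_mono N (U ((P ^^ t) (U f)))"
    by (intro bruhat_mono_young_avg bruhat_mono_avg_op_funpow assms)
  then have "(\<Sum>\<sigma>\<in>sym_grp N. U ((P ^^ t) (U f)) \<sigma>) / fact N \<le> U ((P ^^ t) (U f)) id"
    by (rule bruhat_mono_mean_le_id)
  then show ?thesis using markov_sum_sym_grp[OF markov_UPU, of t f] by (simp add: sum_smoothed)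
qed

text \<open>At a cut the final block averaging does not affect the height; the initial one replaces
  the start \<open>id\<close> by lower permutations and can only decrease the mean.\<close>

lemma smoothed_ht_le:
  assumes "x \<in> {1..N - 1} - block_interior n K"
  shows "(\<Sum>\<sigma>\<in>sym_grp N. smoothed t \<sigma> * real (ht \<sigma> x y)) \<le> (P ^^ t) (\<lambda>\<sigma>. real (ht \<sigma> x y)) id"
proof -
  have c: "real (card Y) > 0" using young_card_pos by simp
  have "U (\<lambda>\<sigma>. real (ht \<sigma> x y)) = (\<lambda>\<sigma>. real (ht \<sigma> x y))"
    unfolding young_avg_def using ht_young[OF _ assms] c id_in_young[of N "block_interior n K"] by (intro ext) auto
  moreover have "bruhat_mono N (\<lambda>\<sigma>. real (ht \<sigma> x y))" by (auto simp: bruhat_mono_def bruhat_le_def)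
  then have m: "bruhat_mono N ((P ^^ t) (\<lambda>\<sigma>. real (ht \<sigma> x y)))" by (rule bruhat_mono_avg_op_funpow)
  have "(\<Sum>a\<in>Y. (P ^^ t) (\<lambda>\<sigma>. real (ht \<sigma> x y)) a) \<le> (\<Sum>a\<in>Y. (P ^^ t) (\<lambda>\<sigma>. real (ht \<sigma> x y)) id)"
    using m young_subset[of N "block_interior n K"] bruhat_le_id by (intro sum_mono) (auto simp: bruhat_mono_def)
  then have "U ((P ^^ t) (\<lambda>\<sigma>. real (ht \<sigma> x y))) id \<le> (P ^^ t) (\<lambda>\<sigma>. real (ht \<sigma> x y)) id"
    unfolding young_avg_def using c by (simp add: divide_le_eq mult.commute)
  ultimately show ?thesis by (simp add: sum_smoothed)
qed

text \<open>The optimal test set, where the density is at least the uniform one, is an up-set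
  because the density is increasing. Its indicator is thus admissible for censoring, so total
  variation itself passes to the smoothed law. Each of the two replacements of censored dynamics by
  block averaging costs one \<open>mix_err\<close>.\<close>

lemma tv_le_smoothed:
  "tv_dist (sym_grp N) (shuffle_law N (s + t + s)) (pmf_of_set (sym_grp N))
     \<le> (\<Sum>\<sigma>\<in>sym_grp N. \<bar>smoothed t \<sigma> - 1 / fact N\<bar>) + 2 * mix_err s"
proof -
  let ?S = "sym_grp N" and ?u = "1 / fact N :: real"
  define p where "p = (P ^^ s) ((P ^^ t) ((P ^^ s) dirac))"
  have p: "pmf (shuffle_law N (s + t + s)) = p"
    unfolding pmf_shuffle_law[OF N2] p_def by (simp add: funpow_add)
  define f where "f = (\<lambda>\<sigma>. if p \<sigma> \<ge> ?u then 1 else 0 :: real)"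
  have "bruhat_mono N p" unfolding p_def by (intro bruhat_mono_avg_op_funpow bruhat_mono_dirac)
  then have fm: "bruhat_mono N f" unfolding bruhat_mono_def f_def by (auto dest: order_trans)
  have su: "(\<Sum>\<sigma>\<in>?S. ?u) = 1" by (simp add: card_sym_grp)
  note MP = markov_funpow[OF markov_avg_op[OF N2]]
  have sp: "(\<Sum>\<sigma>\<in>?S. p \<sigma>) = 1"
    unfolding p_def markov_sum_sym_grp[OF MP] using sum_dirac[of "\<lambda>_. 1" N] by simp
  have z: "(\<Sum>\<sigma>\<in>?S. p \<sigma> - ?u) = 0" by (simp only: sum_subtractf su sp diff_self)
  have "tv_dist ?S (shuffle_law N (s + t + s)) (pmf_of_set ?S) = 1 / 2 * (\<Sum>\<sigma>\<in>?S. \<bar>p \<sigma> - ?u\<bar>)"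
    unfolding tv_dist_def p by (simp add: pmf_uniform_sym_grp)
  also have "(\<Sum>\<sigma>\<in>?S. \<bar>p \<sigma> - ?u\<bar>) = (\<Sum>\<sigma>\<in>?S. 2 * ((p \<sigma> - ?u) * f \<sigma>) - (p \<sigma> - ?u))"
    by (intro sum.cong) (auto simp: f_def abs_if)
  also have "\<dots> = 2 * (\<Sum>\<sigma>\<in>?S. (p \<sigma> - ?u) * f \<sigma>)"
    by (simp only: sum_subtractf[of "\<lambda>\<sigma>. 2 * ((p \<sigma> - ?u) * f \<sigma>)"] z sum_distrib_left diff_0_right)
  finally have tv: "tv_dist ?S (shuffle_law N (s + t + s)) (pmf_of_set ?S) = (\<Sum>\<sigma>\<in>?S. p \<sigma> * f \<sigma>) - (\<Sum>\<sigma>\<in>?S. ?u * f \<sigma>)"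
    by (simp add: left_diff_distrib sum_subtractf)
  have fb: "\<bar>f \<sigma>\<bar> \<le> 1" for \<sigma> by (simp add: f_def)
  have MC: "markov_op N (C ^^ s)" by (rule MP)
  have "(\<Sum>\<sigma>\<in>?S. p \<sigma> * f \<sigma>) = (P ^^ s) ((P ^^ t) ((P ^^ s) f)) id"
    unfolding p_def by (simp add: avg_op_funpow_adjoint sum_dirac)
  also have "\<dots> \<le> (C ^^ s) ((P ^^ t) ((C ^^ s) f)) id" by (rule censoring_sandwich[OF fm])
  also have "\<dots> \<le> U ((P ^^ t) ((C ^^ s) f)) id + mix_err s"
  proof -
    have "\<bar>(P ^^ t) ((C ^^ s) f) \<sigma>\<bar> \<le> 1" if "\<sigma> \<in> ?S" for \<sigma>
      by (intro markov_abs[OF MP _ that] markov_abs[OF MC]) (use fb in auto)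
    from mixing[where s = s and f = "(P ^^ t) ((C ^^ s) f)", OF this id_in_sym_grp] show ?thesis by linarith
  qed
  also have "U ((P ^^ t) ((C ^^ s) f)) id \<le> U ((P ^^ t) (U f)) id + mix_err s"
  proof -
    have "\<bar>U ((P ^^ t) ((C ^^ s) f)) id - U ((P ^^ t) (U f)) id\<bar> \<le> mix_err s"
      by (intro markov_dist[OF markov_young_avg] markov_dist[OF MP] mixing fb) auto
    then show ?thesis by linarith
  qed
  also have "U ((P ^^ t) (U f)) id = (\<Sum>\<sigma>\<in>?S. smoothed t \<sigma> * f \<sigma>)" by (simp add: sum_smoothed)
  finally have "(\<Sum>\<sigma>\<in>?S. p \<sigma> * f \<sigma>) \<le> (\<Sum>\<sigma>\<in>?S. smoothed t \<sigma> * f \<sigma>) + 2 * mix_err s" by simp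
  moreover have "(\<Sum>\<sigma>\<in>?S. smoothed t \<sigma> * f \<sigma>) - (\<Sum>\<sigma>\<in>?S. ?u * f \<sigma>) \<le> (\<Sum>\<sigma>\<in>?S. \<bar>smoothed t \<sigma> - ?u\<bar>)"
    unfolding sum_subtractf[symmetric]
    by (intro sum_mono) (auto simp: f_def)
  ultimately show ?thesis using tv by linarith
qed

end

section \<open>Moments of the heights under the uniform law\<close>

lemma ht_sum_of_bool: "real (ht \<sigma> x y) = (\<Sum>z\<in>{1..x}. of_bool (\<sigma> z \<le> y))"
  by (induction x) (auto simp: ht_Suc)

lemma transpose_in_sym_grp:
  "z \<in> {1..N} \<Longrightarrow> z' \<in> {1..N} \<Longrightarrow> Transposition.transpose z z' \<in> sym_grp N"
  unfolding sym_grp_def using permutes_swap_id[of z "{1..N}" z'] by simp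

text \<open>All positions contribute equally by symmetry, and together they contribute
  \<open>ht \<sigma> N y = y\<close>. Pairs of positions are treated alike below.\<close>

lemma sum_le_indicator:
  assumes "z \<in> {1..N}" "y \<le> N"
  shows "(\<Sum>\<sigma>\<in>sym_grp N. of_bool (\<sigma> z \<le> y)) = (fact N * real y / real N :: real)"
proof -
  let ?c = "\<lambda>z. \<Sum>\<sigma>\<in>sym_grp N. of_bool (\<sigma> z \<le> y) :: real"
  have eq: "?c z' = ?c z" if "z' \<in> {1..N}" for z'
    using sum_sym_grp_comp[OF transpose_in_sym_grp[OF assms(1) that], of "\<lambda>\<sigma>. of_bool (\<sigma> z \<le> y) :: real"]
    by simp
  have "real N * ?c z = (\<Sum>z'\<in>{1..N}. ?c z)" by simp
  also have "\<dots> = (\<Sum>z'\<in>{1..N}. ?c z')" by (rule sum.cong[OF refl eq[symmetric]])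
  also have "\<dots> = (\<Sum>\<sigma>\<in>sym_grp N. real (ht \<sigma> N y))"
    unfolding ht_sum_of_bool by (rule sum.swap)
  also have "\<dots> = fact N * real y" using assms(2) by (simp add: ht_full card_sym_grp)
  finally show ?thesis using assms(1) by (simp add: field_simps)
qed

lemma sum_le_indicator2:
  assumes "z \<in> {1..N}" "z' \<in> {1..N}" "z \<noteq> z'" "y \<le> N"
  shows "(\<Sum>\<sigma>\<in>sym_grp N. of_bool (\<sigma> z \<le> y) * of_bool (\<sigma> z' \<le> y)) = (fact N * real y / real N * (real y - 1) / real (N - 1) :: real)"
proof -
  let ?i = "\<lambda>\<sigma> z. of_bool (\<sigma> z \<le> y) :: real"
  let ?c = "\<lambda>w. \<Sum>\<sigma>\<in>sym_grp N. ?i \<sigma> z * ?i \<sigma> w"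
  have eq: "?c w = ?c z'" if "w \<in> {1..N} - {z}" for w
  proof -
    have "Transposition.transpose z' w z = z" using that assms(3) by (simp add: Transposition.transpose_def)
    then show ?thesis
      using sum_sym_grp_comp[OF transpose_in_sym_grp[OF assms(2), of w], of "\<lambda>\<sigma>. ?i \<sigma> z * ?i \<sigma> z'"] that
      by simp
  qed
  have "real (N - 1) * ?c z' = (\<Sum>w\<in>{1..N} - {z}. ?c z')" using assms(1) by simp
  also have "\<dots> = (\<Sum>w\<in>{1..N} - {z}. ?c w)" by (rule sum.cong[OF refl eq[symmetric]])
  also have "\<dots> = (\<Sum>\<sigma>\<in>sym_grp N. \<Sum>w\<in>{1..N} - {z}. ?i \<sigma> z * ?i \<sigma> w)" by (rule sum.swap)
  also have "\<dots> = (\<Sum>\<sigma>\<in>sym_grp N. (real y - 1) * ?i \<sigma> z)"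
  proof (rule sum.cong[OF refl])
    fix \<sigma> assume \<sigma>: "\<sigma> \<in> sym_grp N"
    have "(\<Sum>w\<in>{1..N} - {z}. ?i \<sigma> w) = real y - ?i \<sigma> z"
      using sum.remove[of "{1..N}" z "?i \<sigma>"] assms(1) ht_full[OF \<sigma> assms(4)] ht_sum_of_bool[of \<sigma> N y] by simp
    then show "(\<Sum>w\<in>{1..N} - {z}. ?i \<sigma> z * ?i \<sigma> w) = (real y - 1) * ?i \<sigma> z"
      by (simp add: sum_distrib_left[symmetric])
  qed
  also have "\<dots> = (real y - 1) * (fact N * real y / real N)"
    unfolding sum_distrib_left[symmetric] sum_le_indicator[OF assms(1,4)] ..
  finally have "real (N - 1) * ?c z' = (real y - 1) * (fact N * real y / real N)" .
  moreover have "real (N - 1) \<noteq> 0" using assms by (auto simp del: of_nat_diff)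
  ultimately show ?thesis by (simp add: field_simps del: of_nat_diff)
qed

lemma uniform_mean_ht:
  assumes "x \<le> N" "y \<le> N"
  shows "(\<Sum>\<sigma>\<in>sym_grp N. real (ht \<sigma> x y)) / fact N = real x * real y / real N"
proof -
  have "(\<Sum>\<sigma>\<in>sym_grp N. real (ht \<sigma> x y)) = (\<Sum>z\<in>{1..x}. \<Sum>\<sigma>\<in>sym_grp N. of_bool (\<sigma> z \<le> y))"
    unfolding ht_sum_of_bool by (rule sum.swap)
  also have "\<dots> = (\<Sum>z\<in>{1..x}. fact N * real y / real N)"
    using assms by (intro sum.cong sum_le_indicator) auto
  finally show ?thesis by simp
qed

lemma uniform_second_moment_ht:
  assumes "x \<le> N" "y \<le> N" "N \<ge> 2"
  shows "(\<Sum>\<sigma>\<in>sym_grp N. (real (ht \<sigma> x y))\<^sup>2) / fact N =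
     real x * real y / real N + real x * (real x - 1) * real y * (real y - 1) / (real N * real (N - 1))"
proof -
  let ?i = "\<lambda>\<sigma> z. of_bool (\<sigma> z \<le> y) :: real"
  let ?c = "fact N * real y / real N :: real"
  let ?d = "?c * (real y - 1) / real (N - 1)"
  have "(\<Sum>\<sigma>\<in>sym_grp N. (real (ht \<sigma> x y))\<^sup>2) = (\<Sum>\<sigma>\<in>sym_grp N. \<Sum>z\<in>{1..x}. \<Sum>w\<in>{1..x}. ?i \<sigma> z * ?i \<sigma> w)"
    unfolding ht_sum_of_bool power2_eq_square sum_product ..
  also have "\<dots> = (\<Sum>z\<in>{1..x}. \<Sum>w\<in>{1..x}. \<Sum>\<sigma>\<in>sym_grp N. ?i \<sigma> z * ?i \<sigma> w)"
    by (subst sum.swap, intro sum.cong refl sum.swap)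
  also have "\<dots> = (\<Sum>z\<in>{1..x}. \<Sum>w\<in>{1..x}. ?d + (if w = z then ?c - ?d else 0))"
  proof (intro sum.cong refl)
    fix z w assume zw: "z \<in> {1..x}" "w \<in> {1..x}"
    show "(\<Sum>\<sigma>\<in>sym_grp N. ?i \<sigma> z * ?i \<sigma> w) = ?d + (if w = z then ?c - ?d else 0)"
    proof (cases "w = z")
      case True
      have "(\<Sum>\<sigma>\<in>sym_grp N. ?i \<sigma> z * ?i \<sigma> z) = (\<Sum>\<sigma>\<in>sym_grp N. ?i \<sigma> z)"
        by (intro sum.cong) auto
      then show ?thesis using True zw assms sum_le_indicator[of z N y] by simp
    next
      case False
      then show ?thesis using zw assms sum_le_indicator2[of z N w y] by simp
    qed
  qed
  also have "\<dots> = real x * (real x * ?d + (?c - ?d))"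
    by (simp add: sum.distrib del: of_nat_diff)
  also have "\<dots> = fact N * (real x * real y / real N + real x * (real x - 1) * real y * (real y - 1) / (real N * real (N - 1)))"
    using assms(3) by (simp add: field_simps del: of_nat_diff)
  finally show ?thesis by simp
qed

text \<open>Draws without replacement are never positively correlated, so the variance is at most
  the mean, which is at most \<open>N\<close>.\<close>

lemma uniform_variance_ht:
  assumes "x \<le> N" "y \<le> N" "N \<ge> 2"
  shows "(\<Sum>\<sigma>\<in>sym_grp N. (real (ht \<sigma> x y) - real x * real y / real N)\<^sup>2) / fact N \<le> real N"
proof -
  define m where "m = real x * real y / real N"
  have "(\<Sum>\<sigma>\<in>sym_grp N. (real (ht \<sigma> x y) - m)\<^sup>2) =
      (\<Sum>\<sigma>\<in>sym_grp N. (real (ht \<sigma> x y))\<^sup>2) - 2 * m * (\<Sum>\<sigma>\<in>sym_grp N. real (ht \<sigma> x y)) + fact N * m\<^sup>2"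
    by (simp add: power2_diff sum.distrib sum_subtractf sum_distrib_left card_sym_grp mult_ac)
  then have "(\<Sum>\<sigma>\<in>sym_grp N. (real (ht \<sigma> x y) - m)\<^sup>2) / fact N =
      (\<Sum>\<sigma>\<in>sym_grp N. (real (ht \<sigma> x y))\<^sup>2) / fact N - 2 * m * ((\<Sum>\<sigma>\<in>sym_grp N. real (ht \<sigma> x y)) / fact N) + m\<^sup>2"
    by (simp add: field_simps)
  also have "\<dots> = m + real x * (real x - 1) * real y * (real y - 1) / (real N * real (N - 1)) - m\<^sup>2"
    unfolding uniform_mean_ht[OF assms(1,2)] uniform_second_moment_ht[OF assms] m_def[symmetric]
    by (simp add: power2_eq_square)
  also have "\<dots> \<le> m"
  proof (cases "x = 0 \<or> y = 0")
    case True
    then show ?thesis by auto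
  next
    case False
    have N: "real (N - 1) = real N - 1" "real N > 1" using assms(3) by auto
    have "(real x - 1) * real N \<le> real x * (real N - 1)" using assms(1) by (simp add: algebra_simps)
    then have "((real x - 1) * real N) * (real y - 1) \<le> (real x * (real N - 1)) * real y"
      by (rule mult_mono) (use False N in auto)
    then have le: "(real x * real y) * (((real x - 1) * real N) * (real y - 1)) \<le> (real x * real y) * ((real x * (real N - 1)) * real y)" (is "?l \<le> ?r")
      by (intro mult_left_mono) auto
    have "real x * (real x - 1) * real y * (real y - 1) / (real N * (real N - 1)) \<le> m\<^sup>2"
    proof -
      have "real x * (real x - 1) * real y * (real y - 1) / (real N * (real N - 1)) = ?l / (real N * real N * (real N - 1))"
        using N by simp
      also have "\<dots> \<le> ?r / (real N * real N * (real N - 1))"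
        by (rule divide_right_mono[OF le]) (use N in auto)
      also have "\<dots> = m\<^sup>2" unfolding m_def using N by (simp add: power2_eq_square)
      finally show ?thesis .
    qed
    then show ?thesis using N by simp
  qed
  also have "m \<le> real N"
  proof -
    have "real x * real y \<le> real N * real N" using assms by (intro mult_mono) auto
    then show ?thesis unfolding m_def using assms(3) by (simp add: field_simps)
  qed
  finally show ?thesis unfolding m_def .
qed

section \<open>Contingency tables\<close>

lemma sum_swap3:
  "(\<Sum>s\<in>S. \<Sum>a\<in>A. \<Sum>b\<in>B. g s a b) = (\<Sum>a\<in>A. \<Sum>b\<in>B. \<Sum>s\<in>S. g s a b)"
  by (subst sum.swap, intro sum.cong refl sum.swap)

lemma card_Suc_greaterThanAtMost:
  assumes "x \<le> x'"
  shows "card {z \<in> {x<..Suc x'}. Q z} = card {z \<in> {x<..x'}. Q z} + (if Q (Suc x') then 1 else 0)"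
proof -
  have "{z \<in> {x<..Suc x'}. Q z} = (if Q (Suc x') then insert (Suc x') {z \<in> {x<..x'}. Q z} else {z \<in> {x<..x'}. Q z})"
    using assms by (auto simp: le_Suc_eq)
  then show ?thesis by simp
qed

text \<open>Inclusion-exclusion, written additively to stay within the natural numbers.\<close>

lemma ht_rectangle:
  assumes "x \<le> x'" "y \<le> y'"
  shows "ht \<sigma> x' y' + ht \<sigma> x y = ht \<sigma> x y' + ht \<sigma> x' y + card {z \<in> {x<..x'}. \<sigma> z \<in> {y<..y'}}"
  using assms(1)
proof (induction x' rule: dec_induct)
  case base
  show ?case by simp
next
  case (step m)
  then show ?case using assms(2)
    by (auto simp: ht_Suc card_Suc_greaterThanAtMost simp del: greaterThanAtMost_iff) (auto split: if_splits)
qed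

lemma ht_transpose:
  assumes "z \<ge> 1" "z < z'"
  shows "int (ht (\<sigma> \<circ> Transposition.transpose z z') x y) = int (ht \<sigma> x y) +
    (if z \<le> x \<and> x < z' then of_bool (\<sigma> z' \<le> y) - of_bool (\<sigma> z \<le> y) else 0)"
proof (induction x)
  case 0
  then show ?case using assms by simp
next
  case (Suc x)
  then show ?case using assms by (auto simp: ht_Suc Transposition.transpose_def)
qed

section \<open>Block boundaries, counts and corner heights\<close>

context blocks
begin

text \<open>\<open>K * n\<close> need not equal \<open>N\<close>: the last block takes whatever
  length is left, and all indices from \<open>K\<close> on denote the right end.\<close>

definition bdy :: "nat \<Rightarrow> nat" where
  "bdy i = (if i < K then i * n else N)"

definition blk :: "nat \<Rightarrow> nat" where
  "blk z = min ((z - 1) div n) (K - 1)"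

abbreviation B :: "nat \<Rightarrow> nat set" where
  "B i \<equiv> {bdy i<..bdy (Suc i)}"

definition cnt :: "(nat \<Rightarrow> nat) \<Rightarrow> nat \<Rightarrow> nat \<Rightarrow> nat" where
  "cnt \<sigma> i j = card {z \<in> B i. \<sigma> z \<in> B j}"

text \<open>A table is stored by its corner sums: the order and the elementary moves are simple
  there, and \<open>cell\<close> recovers the counts as mixed second differences.\<close>

definition tab :: "(nat \<Rightarrow> nat) \<Rightarrow> nat \<Rightarrow> nat \<Rightarrow> int" where
  "tab \<sigma> i j = int (ht \<sigma> (bdy i) (bdy j))"

definition cell :: "(nat \<Rightarrow> nat \<Rightarrow> int) \<Rightarrow> nat \<Rightarrow> nat \<Rightarrow> int" where
  "cell k i j = k (Suc i) (Suc j) + k i j - k i (Suc j) - k (Suc i) j"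

text \<open>The elementary move of contingency tables with fixed margins: raising one corner adds 1
  to the cells \<open>(i, j)\<close> and \<open>(Suc i, Suc j)\<close> and takes 1 from
  \<open>(i, Suc j)\<close> and \<open>(Suc i, j)\<close>.\<close>

definition bump :: "nat \<Rightarrow> nat \<Rightarrow> (nat \<Rightarrow> nat \<Rightarrow> int) \<Rightarrow> nat \<Rightarrow> nat \<Rightarrow> int" where
  "bump i j k = (\<lambda>a b. k a b + (if a = Suc i \<and> b = Suc j then 1 else 0))"

lemma bdy_0 [simp]: "bdy 0 = 0" using K1 by (simp add: bdy_def)

lemma bdy_le_N: "bdy i \<le> N"
proof (cases "i < K")
  case True
  then have "i * n \<le> (K - 1) * n" by (intro mult_le_mono1) simp
  then have "i * n \<le> N" using last_pos by linarith
  then show ?thesis using True by (simp add: bdy_def)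
qed (simp add: bdy_def)

lemma bdy_Suc_le: "bdy i \<le> bdy (Suc i)"
  using bdy_le_N[of i] by (auto simp: bdy_def)

lemma bdy_mono: "i \<le> j \<Longrightarrow> bdy i \<le> bdy j"
  by (rule lift_Suc_mono_le[of bdy]) (rule bdy_Suc_le)

lemma bdy_interior: "1 \<le> i \<Longrightarrow> i < K \<Longrightarrow> bdy i \<in> {1..N - 1} - block_interior n K"
proof -
  assume i: "1 \<le> i" "i < K"
  then have "i * n \<le> (K - 1) * n" by (intro mult_le_mono1) simp
  then have "i * n \<le> N - 1" using last_pos by linarith
  moreover have "1 \<le> i * n" using i n1 by simp
  moreover have "\<exists>i'\<in>{1..K - 1}. i * n = i' * n" using i by (intro bexI[of _ i]) auto
  ultimately show ?thesis using i by (simp add: bdy_def block_interior_def)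
qed

lemma blk_ge: "z \<ge> 1 \<Longrightarrow> i < K \<Longrightarrow> i \<le> blk z \<longleftrightarrow> bdy i < z"
  unfolding blk_def bdy_def using n1 by (auto simp: less_eq_div_iff_mult_less_eq)

lemma blk_less: "blk z < K"
proof -
  have "blk z \<le> K - 1" unfolding blk_def by simp
  then show ?thesis using K1 by linarith
qed

lemma mem_B_iff:
  assumes "z \<in> {1..N}" "i < K"
  shows "z \<in> B i \<longleftrightarrow> blk z = i"
proof (cases "Suc i < K")
  case True
  then show ?thesis using blk_ge[of z i] blk_ge[of z "Suc i"] assms by auto
next
  case False
  then have "bdy (Suc i) = N" "i = K - 1" using assms by (auto simp: bdy_def)
  then show ?thesis using blk_ge[of z i] blk_less[of z] assms by auto
qed

lemma B_subset: "B i \<subseteq> {1..N}"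
  using bdy_le_N[of "Suc i"] by auto

lemma youngI_blk:
  assumes "a \<in> sym_grp N" "\<And>z. z \<in> {1..N} \<Longrightarrow> blk (a z) = blk z"
  shows "a \<in> Y"
  unfolding young_def
proof (intro CollectI conjI ballI allI assms(1))
  fix x z assume "x \<in> {1..N - 1} - block_interior n K"
  then obtain i where i: "1 \<le> i" "i \<le> K - 1" "x = i * n" by (auto simp: block_interior_def)
  then have iK: "i < K" "bdy i = x" using K1 by (auto simp: bdy_def)
  have p: "a permutes {1..N}" using assms(1) by (simp add: sym_grp_def)
  show "(a z \<le> x) = (z \<le> x)"
  proof (cases "z \<in> {1..N}")
    case True
    then have "a z \<ge> 1" using permutes_in_image[OF p, of z] by simp
    then show ?thesis using assms(2)[OF True] blk_ge[of z i] blk_ge[of "a z" i] iK True by auto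
  next
    case False
    then show ?thesis using permutes_not_in[OF p] by simp
  qed
qed

lemma cell_tab: "cell (tab \<sigma>) i j = int (cnt \<sigma> i j)"
  unfolding cell_def tab_def cnt_def
  using ht_rectangle[OF bdy_Suc_le[of i] bdy_Suc_le[of j], of \<sigma>] by linarith

lemma count_blk:
  assumes "\<sigma> \<in> sym_grp N"
  shows "count (image_mset (\<lambda>z. (blk z, blk (\<sigma> z))) (mset_set {1..N})) (i, j) = (if i < K \<and> j < K then cnt \<sigma> i j else 0)"
proof -
  have p: "\<sigma> permutes {1..N}" using assms by (simp add: sym_grp_def)
  have "count (image_mset (\<lambda>z. (blk z, blk (\<sigma> z))) (mset_set {1..N})) (i, j) =
     card {z \<in> {1..N}. (i, j) = (blk z, blk (\<sigma> z))}"
    unfolding count_image_mset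
    by (subst sum.cong[OF refl, of _ _ "\<lambda>_. 1"]) (auto intro!: arg_cong[where f = card])
  also have "\<dots> = (if i < K \<and> j < K then cnt \<sigma> i j else 0)"
  proof (cases "i < K \<and> j < K")
    case True
    have "z \<in> {1..N} \<and> (i, j) = (blk z, blk (\<sigma> z)) \<longleftrightarrow> z \<in> B i \<and> \<sigma> z \<in> B j" for z
    proof (cases "z \<in> {1..N}")
      case zin: True
      then have "\<sigma> z \<in> {1..N}" using permutes_in_image[OF p] by blast
      then show ?thesis using mem_B_iff[OF zin] mem_B_iff[of "\<sigma> z" j] True zin by auto
    next
      case False
      then show ?thesis using B_subset[of i] by auto
    qed
    then show ?thesis unfolding cnt_def using True by (auto intro: arg_cong[where f = card])
  next
    case False
    then have "{z \<in> {1..N}. (i, j) = (blk z, blk (\<sigma> z))} = {}" using blk_less by auto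
    then show ?thesis using False by (metis card.empty)
  qed
  finally show ?thesis .
qed

text \<open>Contingency tables classify the double cosets of a Young subgroup. Equal counts allow a
  permutation \<open>c\<close> of positions, inside blocks, after which \<sigma> \<circ>
  \<open>c\<close> and \<tau> send each position to the same label block; what remains is a
  relabelling inside blocks.\<close>

lemma same_table_double_coset:
  assumes "\<sigma> \<in> sym_grp N" "\<tau> \<in> sym_grp N" "tab \<sigma> = tab \<tau>"
  obtains a c where "a \<in> Y" "c \<in> Y" "\<tau> = a \<circ> \<sigma> \<circ> c"
proof -
  have eq: "cnt \<sigma> i j = cnt \<tau> i j" for i j using cell_tab[of \<sigma> i j] cell_tab[of \<tau> i j] assms(3) by simp
  have "image_mset (\<lambda>z. (blk z, blk (\<tau> z))) (mset_set {1..N}) = image_mset (\<lambda>z. (blk z, blk (\<sigma> z))) (mset_set {1..N})"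
  proof (rule multiset_eqI)
    fix p :: "nat \<times> nat"
    obtain i j where p: "p = (i, j)" by (cases p)
    show "count (image_mset (\<lambda>z. (blk z, blk (\<tau> z))) (mset_set {1..N})) p = count (image_mset (\<lambda>z. (blk z, blk (\<sigma> z))) (mset_set {1..N})) p"
      unfolding p count_blk[OF assms(1)] count_blk[OF assms(2)] eq ..
  qed
  then obtain c where c: "c permutes {1..N}" "\<forall>z\<in>{1..N}. (blk z, blk (\<tau> z)) = (blk (c z), blk (\<sigma> (c z)))"
    using image_mset_eq_implies_permutes[of "{1..N}" "\<lambda>z. (blk z, blk (\<tau> z))" "\<lambda>z. (blk z, blk (\<sigma> z))"] by auto
  have cS: "c \<in> sym_grp N" using c(1) by (simp add: sym_grp_def)
  have cY: "c \<in> Y" using c by (intro youngI_blk cS) auto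
  define s where "s = \<sigma> \<circ> c"
  have sS: "s \<in> sym_grp N" unfolding s_def by (intro sym_grp_comp assms cS)
  then have sp: "s permutes {1..N}" by (simp add: sym_grp_def)
  define a where "a = \<tau> \<circ> inv s"
  have aS: "a \<in> sym_grp N" unfolding a_def by (intro sym_grp_comp assms sym_grp_inv sS)
  have "blk (a w) = blk w" if "w \<in> {1..N}" for w
  proof -
    have z: "inv s w \<in> {1..N}" using permutes_in_image[OF permutes_inv[OF sp]] that by blast
    have "w = s (inv s w)" using permutes_inverses(1)[OF sp] by simp
    then have "blk w = blk (\<sigma> (c (inv s w)))" by (simp add: s_def)
    also have "\<dots> = blk (\<tau> (inv s w))" using c(2) z by auto
    finally show ?thesis by (simp add: a_def)
  qed
  then have aY: "a \<in> Y" by (intro youngI_blk aS)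
  have "a \<circ> \<sigma> \<circ> c = \<tau> \<circ> (inv s \<circ> s)" unfolding a_def s_def by (simp add: comp_assoc)
  then have "\<tau> = a \<circ> \<sigma> \<circ> c" using permutes_inv_o(2)[OF sp] by simp
  then show ?thesis using that aY cY by blast
qed

lemma sum_of_bool_cnt:
  "(\<Sum>z\<in>B i. \<Sum>z'\<in>B i'. of_bool (\<sigma> z \<in> B j \<and> \<sigma> z' \<in> B j')) = real (cnt \<sigma> i j) * real (cnt \<sigma> i' j')"
proof -
  have *: "(\<Sum>z\<in>B i. of_bool (\<sigma> z \<in> B j)) = real (cnt \<sigma> i j)" for i j
    unfolding cnt_def by (simp add: Int_def)
  have "(\<Sum>z\<in>B i. \<Sum>z'\<in>B i'. of_bool (\<sigma> z \<in> B j \<and> \<sigma> z' \<in> B j')) =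
     (\<Sum>z\<in>B i. \<Sum>z'\<in>B i'. of_bool (\<sigma> z \<in> B j) * of_bool (\<sigma> z' \<in> B j') :: real)"
    by (simp only: of_bool_conj)
  also have "\<dots> = real (cnt \<sigma> i j) * real (cnt \<sigma> i' j')"
    unfolding sum_product[symmetric] * ..
  finally show ?thesis .
qed

text \<open>For fixed \<open>z\<close> and \<open>z'\<close> the substitution of
  \<open>\<sigma> \<circ> transpose z z'\<close> for \<sigma> exchanges the two label conditions.
  This is reversibility of the random exchange of a pair between two blocks.\<close>

lemma swap_identity:
  "(\<Sum>\<sigma>\<in>sym_grp N. \<Sum>z\<in>B i. \<Sum>z'\<in>B i'. of_bool (\<sigma> z \<in> B j' \<and> \<sigma> z' \<in> B j) * f (\<sigma> \<circ> Transposition.transpose z z'))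
     = (\<Sum>\<sigma>\<in>sym_grp N. real (cnt \<sigma> i j) * real (cnt \<sigma> i' j') * f \<sigma>)"
proof -
  let ?t = Transposition.transpose
  have "(\<Sum>\<sigma>\<in>sym_grp N. \<Sum>z\<in>B i. \<Sum>z'\<in>B i'. of_bool (\<sigma> z \<in> B j' \<and> \<sigma> z' \<in> B j) * f (\<sigma> \<circ> ?t z z'))
    = (\<Sum>z\<in>B i. \<Sum>z'\<in>B i'. \<Sum>\<sigma>\<in>sym_grp N. of_bool (\<sigma> z \<in> B j' \<and> \<sigma> z' \<in> B j) * f (\<sigma> \<circ> ?t z z'))"
    by (rule sum_swap3)
  also have "\<dots> = (\<Sum>z\<in>B i. \<Sum>z'\<in>B i'. \<Sum>\<sigma>\<in>sym_grp N. of_bool (\<sigma> z \<in> B j \<and> \<sigma> z' \<in> B j') * f \<sigma>)"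
  proof (rule sum.cong[OF refl], rule sum.cong[OF refl])
    fix z z' assume "z \<in> B i" "z' \<in> B i'"
    then have t: "?t z z' \<in> sym_grp N" using B_subset[of i] B_subset[of i'] by (intro transpose_in_sym_grp) auto
    show "(\<Sum>\<sigma>\<in>sym_grp N. of_bool (\<sigma> z \<in> B j' \<and> \<sigma> z' \<in> B j) * f (\<sigma> \<circ> ?t z z'))
        = (\<Sum>\<sigma>\<in>sym_grp N. of_bool (\<sigma> z \<in> B j \<and> \<sigma> z' \<in> B j') * f \<sigma>)"
      using sum_sym_grp_comp[OF t, of "\<lambda>\<sigma>. of_bool (\<sigma> z \<in> B j \<and> \<sigma> z' \<in> B j') * f \<sigma>"]
      by (simp add: conj_commute del: greaterThanAtMost_iff)
  qed
  also have "\<dots> = (\<Sum>\<sigma>\<in>sym_grp N. \<Sum>z\<in>B i. \<Sum>z'\<in>B i'. of_bool (\<sigma> z \<in> B j \<and> \<sigma> z' \<in> B j') * f \<sigma>)"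
    by (rule sum_swap3[symmetric])
  also have "\<dots> = (\<Sum>\<sigma>\<in>sym_grp N. real (cnt \<sigma> i j) * real (cnt \<sigma> i' j') * f \<sigma>)"
    unfolding sum_distrib_right[symmetric] sum_of_bool_cnt ..
  finally show ?thesis .
qed

text \<open>The two blocks of positions are adjacent, and so are the two blocks of labels, so
  exactly one corner separates both pairs.\<close>

lemma tab_transpose:
  assumes "Suc i < K" "Suc j < K" "z \<in> B i" "z' \<in> B (Suc i)" "\<sigma> z \<in> B (Suc j)" "\<sigma> z' \<in> B j"
  shows "tab (\<sigma> \<circ> Transposition.transpose z z') = bump i j (tab \<sigma>)"
proof (intro ext)
  fix a b
  have z: "1 \<le> z" "z < z'" using assms(3,4) by auto
  have A: "z \<le> bdy a \<and> bdy a < z' \<longleftrightarrow> a = Suc i"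
  proof
    assume "z \<le> bdy a \<and> bdy a < z'"
    then have "bdy i < bdy a" "bdy a < bdy (Suc (Suc i))" using assms(3,4) by auto
    then have "i < a" "a < Suc (Suc i)" using bdy_mono[of a i] bdy_mono[of "Suc (Suc i)" a] by (meson not_le)+
    then show "a = Suc i" by simp
  qed (use assms(3,4) in auto)
  have h: "(of_bool (\<sigma> z' \<le> bdy b) - of_bool (\<sigma> z \<le> bdy b) :: int) = (if b = Suc j then 1 else 0)"
  proof -
    consider "b \<le> j" | "b = Suc j" | "Suc (Suc j) \<le> b" by linarith
    then show ?thesis
    proof cases
      case 1
      then show ?thesis using bdy_mono[of b j] bdy_mono[of j "Suc j"] assms(5,6) by auto
    next
      case 2
      then show ?thesis using assms(5,6) by auto
    next
      case 3
      then show ?thesis using bdy_mono[of "Suc (Suc j)" b] bdy_mono[of "Suc j" "Suc (Suc j)"] assms(5,6) by auto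
    qed
  qed
  show "tab (\<sigma> \<circ> Transposition.transpose z z') a b = bump i j (tab \<sigma>) a b"
    unfolding tab_def bump_def ht_transpose[OF z] A h by simp
qed

definition wt :: "(nat \<Rightarrow> nat \<Rightarrow> int) \<Rightarrow> real" where
  "wt k = real (card {\<sigma> \<in> sym_grp N. tab \<sigma> = k})"

text \<open>Detailed balance of the uniform weights under one move, from
  \<open>swap_identity\<close> applied to the indicator of the target table. It replaces the
  explicit product of factorials that counts the permutations with a given table.\<close>

lemma wt_balance:
  assumes "Suc i < K" "Suc j < K"
  shows "wt k * (of_int (cell k i (Suc j)) * of_int (cell k (Suc i) j)) =
     wt (bump i j k) * (of_int (cell (bump i j k) i j) * of_int (cell (bump i j k) (Suc i) (Suc j)))"
proof -
  let ?t = Transposition.transpose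
  let ?f = "\<lambda>\<sigma>. of_bool (tab \<sigma> = bump i j k) :: real"
  have inj: "bump i j k' = bump i j k \<longleftrightarrow> k' = k" for k' by (auto simp: bump_def fun_eq_iff)
  have weight: "(\<Sum>\<sigma>\<in>sym_grp N. of_bool (tab \<sigma> = k) * h (tab \<sigma>)) = wt k * h k" for k and h :: "_ \<Rightarrow> real"
  proof -
    have "(\<Sum>\<sigma>\<in>sym_grp N. of_bool (tab \<sigma> = k) * h (tab \<sigma>)) = (\<Sum>\<sigma>\<in>{\<sigma> \<in> sym_grp N. tab \<sigma> = k}. h k)"
      by (rule sum.mono_neutral_cong_right) auto
    then show ?thesis by (simp add: wt_def)
  qed
  have "(\<Sum>\<sigma>\<in>sym_grp N. \<Sum>z\<in>B i. \<Sum>z'\<in>B (Suc i). of_bool (\<sigma> z \<in> B (Suc j) \<and> \<sigma> z' \<in> B j) * ?f (\<sigma> \<circ> ?t z z'))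
     = (\<Sum>\<sigma>\<in>sym_grp N. \<Sum>z\<in>B i. \<Sum>z'\<in>B (Suc i). of_bool (\<sigma> z \<in> B (Suc j) \<and> \<sigma> z' \<in> B j) * of_bool (tab \<sigma> = k))"
    using tab_transpose[OF assms] inj by (intro sum.cong refl) (auto simp del: greaterThanAtMost_iff)
  also have "\<dots> = (\<Sum>\<sigma>\<in>sym_grp N. of_bool (tab \<sigma> = k) * (of_int (cell (tab \<sigma>) i (Suc j)) * of_int (cell (tab \<sigma>) (Suc i) j)))"
    unfolding sum_distrib_right[symmetric] sum_of_bool_cnt cell_tab of_int_of_nat_eq by (simp only: mult.commute)
  also have "\<dots> = wt k * (of_int (cell k i (Suc j)) * of_int (cell k (Suc i) j))"
    by (rule weight)
  finally have "wt k * (of_int (cell k i (Suc j)) * of_int (cell k (Suc i) j)) =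
     (\<Sum>\<sigma>\<in>sym_grp N. real (cnt \<sigma> i j) * real (cnt \<sigma> (Suc i) (Suc j)) * ?f \<sigma>)"
    using swap_identity[where i = i and i' = "Suc i" and j' = "Suc j" and j = j and f = ?f] by simp
  also have "\<dots> = (\<Sum>\<sigma>\<in>sym_grp N. of_bool (tab \<sigma> = bump i j k) * (of_int (cell (tab \<sigma>) i j) * of_int (cell (tab \<sigma>) (Suc i) (Suc j))))"
    unfolding cell_tab of_int_of_nat_eq by (simp only: mult.commute)
  also have "\<dots> = wt (bump i j k) * (of_int (cell (bump i j k) i j) * of_int (cell (bump i j k) (Suc i) (Suc j)))"
    by (rule weight)
  finally show ?thesis .
qed

end

section \<open>Means under an increasing density\<close>

text \<open>From here on the dynamics is forgotten. What is kept of it: an increasing density,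
  invariant under shuffles inside blocks on both sides, that dominates the uniform law and whose
  mean corner heights exceed the uniform ones by at most \<eta>.\<close>

locale block_density = blocks +
  fixes \<rho> :: "(nat \<Rightarrow> nat) \<Rightarrow> real" and \<eta> :: real
  assumes K_le: "K * n \<le> N"
    and \<rho>_nonneg: "\<And>\<sigma>. \<sigma> \<in> sym_grp N \<Longrightarrow> 0 \<le> \<rho> \<sigma>"
    and \<rho>_sum: "(\<Sum>\<sigma>\<in>sym_grp N. \<rho> \<sigma>) = 1"
    and \<rho>_mono: "bruhat_mono N \<rho>"
    and \<rho>_right: "\<And>a \<sigma>. a \<in> Y \<Longrightarrow> \<rho> (\<sigma> \<circ> a) = \<rho> \<sigma>"
    and \<rho>_left: "\<And>a \<sigma>. a \<in> Y \<Longrightarrow> \<rho> (a \<circ> \<sigma>) = \<rho> \<sigma>"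
    and \<rho>_dom: "\<And>f. bruhat_mono N f \<Longrightarrow> (\<Sum>\<sigma>\<in>sym_grp N. f \<sigma>) / fact N \<le> (\<Sum>\<sigma>\<in>sym_grp N. \<rho> \<sigma> * f \<sigma>)"
    and \<rho>_ht: "\<And>i j. 1 \<le> i \<Longrightarrow> i < K \<Longrightarrow> 1 \<le> j \<Longrightarrow> j < K \<Longrightarrow>
        (\<Sum>\<sigma>\<in>sym_grp N. \<rho> \<sigma> * real (ht \<sigma> (bdy i) (bdy j))) \<le> real (bdy i) * real (bdy j) / real N + \<eta>"
    and \<eta>1: "1 \<le> \<eta>"
begin

definition ctr :: "nat \<Rightarrow> nat \<Rightarrow> real" where
  "ctr i j = real (bdy i) * real (bdy j) / real N"

definition dev :: "nat \<Rightarrow> nat \<Rightarrow> (nat \<Rightarrow> nat) \<Rightarrow> real" where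
  "dev i j \<sigma> = real (ht \<sigma> (bdy i) (bdy j)) - ctr i j"

lemma N_pos: "real N > 0" using N2 by simp

lemma ht_le_N: "\<sigma> \<in> sym_grp N \<Longrightarrow> ht \<sigma> x (bdy j) \<le> N"
  using ht_le_min[of \<sigma> N x "bdy j"] bdy_le_N[of j] by simp

lemma dev_boundary:
  assumes "\<sigma> \<in> sym_grp N" "\<not> (1 \<le> i \<and> i < K \<and> 1 \<le> j \<and> j < K)"
  shows "dev i j \<sigma> = 0"
proof -
  consider "i = 0" | "j = 0" | "i \<ge> K" | "j \<ge> K" using assms(2) by linarith
  then show ?thesis
  proof cases
    case 1 then show ?thesis by (simp add: dev_def ctr_def)
  next
    case 2 then show ?thesis using ht_le_min[OF assms(1), of "bdy i" 0] by (simp add: dev_def ctr_def)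
  next
    case 3
    then have "bdy i = N" by (simp add: bdy_def)
    then show ?thesis using ht_full[OF assms(1) bdy_le_N[of j]] N_pos by (simp add: dev_def ctr_def)
  next
    case 4
    then have b: "bdy j = N" by (simp add: bdy_def)
    have "{z \<in> {1..bdy i}. \<sigma> z \<le> N} = {1..bdy i}"
    proof -
      have p: "\<sigma> permutes {1..N}" using assms(1) by (simp add: sym_grp_def)
      have "\<sigma> z \<le> N" if "z \<in> {1..bdy i}" for z
      proof -
        have "z \<in> {1..N}" using that bdy_le_N[of i] by simp
        then have "\<sigma> z \<in> {1..N}" using permutes_in_image[OF p] by blast
        then show ?thesis by simp
      qed
      then show ?thesis by blast
    qed
    then have "ht \<sigma> (bdy i) N = bdy i" by (simp add: ht_def)
    then show ?thesis using N_pos b by (simp add: dev_def ctr_def)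
  qed
qed

text \<open>The function \<open>L h - \<phi> h\<close> of the height \<open>h\<close> is increasing,
  so domination applies to it: the mean of \<phi> exceeds its uniform mean by at most
  \<open>L\<close> times the excess \<eta> of the mean height. This does the work of a monotone
  coupling.\<close>

lemma lipschitz_domination:
  assumes "\<And>m. m < N \<Longrightarrow> \<phi> (Suc m) - \<phi> m \<le> L" "0 \<le> L" "1 \<le> i" "i < K" "1 \<le> j" "j < K"
  shows "(\<Sum>\<sigma>\<in>sym_grp N. \<rho> \<sigma> * \<phi> (ht \<sigma> (bdy i) (bdy j)))
     \<le> (\<Sum>\<sigma>\<in>sym_grp N. \<phi> (ht \<sigma> (bdy i) (bdy j))) / fact N + L * \<eta>"
proof -
  let ?h = "\<lambda>\<sigma>. ht \<sigma> (bdy i) (bdy j)"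
  have inc: "L * real m - \<phi> m \<le> L * real m' - \<phi> m'" if "m \<le> m'" "m' \<le> N" for m m'
    using that
  proof (induction m' rule: dec_induct)
    case (step m')
    then show ?case using assms(1)[of m'] by (simp add: algebra_simps)
  qed simp
  have "bruhat_mono N (\<lambda>\<sigma>. L * real (?h \<sigma>) - \<phi> (?h \<sigma>))"
    unfolding bruhat_mono_def bruhat_le_def
  proof (intro ballI impI)
    fix \<sigma> \<tau> assume "\<sigma> \<in> sym_grp N" "\<tau> \<in> sym_grp N" "\<forall>x y. ht \<sigma> x y \<le> ht \<tau> x y"
    then show "L * real (?h \<sigma>) - \<phi> (?h \<sigma>) \<le> L * real (?h \<tau>) - \<phi> (?h \<tau>)"
      using inc[of "?h \<sigma>" "?h \<tau>"] ht_le_N[of \<tau>] by simp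
  qed
  from \<rho>_dom[OF this]
  have "L * ((\<Sum>\<sigma>\<in>sym_grp N. real (?h \<sigma>)) / fact N) - (\<Sum>\<sigma>\<in>sym_grp N. \<phi> (?h \<sigma>)) / fact N
     \<le> L * (\<Sum>\<sigma>\<in>sym_grp N. \<rho> \<sigma> * real (?h \<sigma>)) - (\<Sum>\<sigma>\<in>sym_grp N. \<rho> \<sigma> * \<phi> (?h \<sigma>))"
    by (simp add: sum_subtractf sum_distrib_left[symmetric] right_diff_distrib diff_divide_distrib mult.left_commute)
  moreover have "L * (\<Sum>\<sigma>\<in>sym_grp N. \<rho> \<sigma> * real (?h \<sigma>)) \<le> L * ((\<Sum>\<sigma>\<in>sym_grp N. real (?h \<sigma>)) / fact N + \<eta>)"
    using \<rho>_ht[OF assms(3-6)] unfolding uniform_mean_ht[OF bdy_le_N bdy_le_N]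
    by (intro mult_left_mono assms(2)) simp
  ultimately show ?thesis by (simp add: algebra_simps)
qed

lemma uniform_sq_dev: "(\<Sum>\<sigma>\<in>sym_grp N. (dev i j \<sigma>)\<^sup>2) / fact N \<le> real N"
  unfolding dev_def ctr_def by (rule uniform_variance_ht[OF bdy_le_N bdy_le_N N2])

lemma uniform_abs_dev: "(\<Sum>\<sigma>\<in>sym_grp N. \<bar>dev i j \<sigma>\<bar>) / fact N \<le> sqrt (real N)"
proof -
  let ?s = "sqrt (real N)"
  have s: "?s > 0" "?s * ?s = real N" using N_pos by auto
  \<comment> \<open>The arithmetic-geometric mean inequality, once summed, takes the place of
    Cauchy-Schwarz.\<close>
  have "2 * ?s * \<bar>dev i j \<sigma>\<bar> \<le> (dev i j \<sigma>)\<^sup>2 + real N" for \<sigma>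
  proof -
    have "(\<bar>dev i j \<sigma>\<bar> - ?s)\<^sup>2 = (dev i j \<sigma>)\<^sup>2 + real N - 2 * ?s * \<bar>dev i j \<sigma>\<bar>"
      by (simp add: power2_diff mult_ac)
    then show ?thesis using zero_le_power2[of "\<bar>dev i j \<sigma>\<bar> - ?s"] by argo
  qed
  then have "(\<Sum>\<sigma>\<in>sym_grp N. 2 * ?s * \<bar>dev i j \<sigma>\<bar>) \<le> (\<Sum>\<sigma>\<in>sym_grp N. (dev i j \<sigma>)\<^sup>2 + real N)"
    by (rule sum_mono)
  then have "2 * ?s * ((\<Sum>\<sigma>\<in>sym_grp N. \<bar>dev i j \<sigma>\<bar>) / fact N) \<le> (\<Sum>\<sigma>\<in>sym_grp N. (dev i j \<sigma>)\<^sup>2) / fact N + real N"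
    by (simp add: sum_distrib_left[symmetric] sum.distrib card_sym_grp field_simps)
  also have "\<dots> \<le> 2 * ?s * ?s" using uniform_sq_dev[of i j] unfolding mult.assoc s(2) by simp
  finally show ?thesis by (rule mult_left_le_imp_le) (use s(1) in simp)
qed

lemma rho_abs_dev: "(\<Sum>\<sigma>\<in>sym_grp N. \<rho> \<sigma> * \<bar>dev i j \<sigma>\<bar>) \<le> sqrt (real N) + \<eta>"
proof (cases "1 \<le> i \<and> i < K \<and> 1 \<le> j \<and> j < K")
  case True
  have "\<bar>real (Suc m) - ctr i j\<bar> - \<bar>real m - ctr i j\<bar> \<le> 1" for m by simp
  from lipschitz_domination[of "\<lambda>m. \<bar>real m - ctr i j\<bar>" 1 i j, OF this] True uniform_abs_dev[of i j]
  show ?thesis by (simp add: dev_def)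
next
  case False
  then have "(\<Sum>\<sigma>\<in>sym_grp N. \<rho> \<sigma> * \<bar>dev i j \<sigma>\<bar>) = 0" by (intro sum.neutral) (simp add: dev_boundary)
  then show ?thesis using \<eta>1 by simp
qed

text \<open>On heights up to \<open>N\<close> the square has slope at most 2 N, so \<eta> enters
  with a factor of order N. This is worse than the equilibrium variance, yet of the order N \<eta>
  that \<open>rho_det\<close> tolerates.\<close>

lemma rho_sq_dev: "(\<Sum>\<sigma>\<in>sym_grp N. \<rho> \<sigma> * (dev i j \<sigma>)\<^sup>2) \<le> real N + 2 * real N * \<eta>"
proof (cases "1 \<le> i \<and> i < K \<and> 1 \<le> j \<and> j < K")
  case True
  have "ctr i j \<ge> 0" by (simp add: ctr_def)
  then have "(real (Suc m) - ctr i j)\<^sup>2 - (real m - ctr i j)\<^sup>2 \<le> 2 * real N" if "m < N" for m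
    using that by (simp add: power2_eq_square algebra_simps)
  then show ?thesis
    using lipschitz_domination[of "\<lambda>m. (real m - ctr i j)\<^sup>2" "2 * real N" i j] uniform_sq_dev[of i j] True
    by (simp add: dev_def)
next
  case False
  then have "(\<Sum>\<sigma>\<in>sym_grp N. \<rho> \<sigma> * (dev i j \<sigma>)\<^sup>2) = 0" by (intro sum.neutral) (simp add: dev_boundary)
  then show ?thesis using \<eta>1 by simp
qed

lemma rho_dev: "0 \<le> (\<Sum>\<sigma>\<in>sym_grp N. \<rho> \<sigma> * dev i j \<sigma>)" "(\<Sum>\<sigma>\<in>sym_grp N. \<rho> \<sigma> * dev i j \<sigma>) \<le> \<eta>"
proof -
  have eq: "(\<Sum>\<sigma>\<in>sym_grp N. \<rho> \<sigma> * dev i j \<sigma>) = (\<Sum>\<sigma>\<in>sym_grp N. \<rho> \<sigma> * real (ht \<sigma> (bdy i) (bdy j))) - ctr i j"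
    unfolding dev_def using \<rho>_sum by (simp add: right_diff_distrib sum_subtractf sum_distrib_right[symmetric])
  have "bruhat_mono N (\<lambda>\<sigma>. real (ht \<sigma> (bdy i) (bdy j)))" by (auto simp: bruhat_mono_def bruhat_le_def)
  from \<rho>_dom[OF this] show "0 \<le> (\<Sum>\<sigma>\<in>sym_grp N. \<rho> \<sigma> * dev i j \<sigma>)"
    unfolding eq uniform_mean_ht[OF bdy_le_N bdy_le_N] ctr_def by simp
  show "(\<Sum>\<sigma>\<in>sym_grp N. \<rho> \<sigma> * dev i j \<sigma>) \<le> \<eta>"
  proof (cases "1 \<le> i \<and> i < K \<and> 1 \<le> j \<and> j < K")
    case True
    then show ?thesis using \<rho>_ht[of i j] unfolding eq ctr_def by simp
  next
    case False
    then have "(\<Sum>\<sigma>\<in>sym_grp N. \<rho> \<sigma> * dev i j \<sigma>) = 0" by (intro sum.neutral) (simp add: dev_boundary)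
    then show ?thesis using \<eta>1 by simp
  qed
qed

section \<open>Cell counts and the mean of a 2 x 2 minor\<close>

definition msize :: "nat \<Rightarrow> nat \<Rightarrow> real" where
  "msize i j = (real (bdy (Suc i)) - real (bdy i)) * (real (bdy (Suc j)) - real (bdy j)) / real N"

definition cdev :: "nat \<Rightarrow> nat \<Rightarrow> (nat \<Rightarrow> nat) \<Rightarrow> real" where
  "cdev i j \<sigma> = dev (Suc i) (Suc j) \<sigma> + dev i j \<sigma> - dev i (Suc j) \<sigma> - dev (Suc i) j \<sigma>"

lemma ctr_msize: "ctr (Suc i) (Suc j) + ctr i j - ctr i (Suc j) - ctr (Suc i) j = msize i j"
  using N_pos unfolding ctr_def msize_def by (simp add: field_simps)

lemma cnt_eq: "real (cnt \<sigma> i j) = msize i j + cdev i j \<sigma>"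
proof -
  have "real (cnt \<sigma> i j) = real (ht \<sigma> (bdy (Suc i)) (bdy (Suc j))) + real (ht \<sigma> (bdy i) (bdy j))
     - real (ht \<sigma> (bdy i) (bdy (Suc j))) - real (ht \<sigma> (bdy (Suc i)) (bdy j))"
    unfolding cnt_def using ht_rectangle[OF bdy_Suc_le[of i] bdy_Suc_le[of j], of \<sigma>] by linarith
  then show ?thesis unfolding cdev_def dev_def ctr_msize[symmetric] by linarith
qed

lemma msize_bounds: "0 \<le> msize i j" "msize i j \<le> real N"
proof -
  have b: "0 \<le> real (bdy (Suc i)) - real (bdy i)" "real (bdy (Suc i)) - real (bdy i) \<le> real N" for i
    using bdy_Suc_le[of i] bdy_le_N[of "Suc i"] by auto
  show "0 \<le> msize i j" unfolding msize_def using b N_pos by simp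
  have "(real (bdy (Suc i)) - real (bdy i)) * (real (bdy (Suc j)) - real (bdy j)) \<le> real N * real N"
    using b by (intro mult_mono) auto
  then show "msize i j \<le> real N" unfolding msize_def using N_pos by (simp add: divide_le_eq)
qed

lemma msize_det: "msize i j * msize (Suc i) (Suc j) = msize i (Suc j) * msize (Suc i) j"
  unfolding msize_def by simp

lemma msize_range:
  assumes "i < K" "j < K"
  shows "real n ^ 2 / real N \<le> msize i j" "msize i j \<le> 4 * (real n ^ 2 / real N)"
proof -
  have b: "real n \<le> real (bdy (Suc i)) - real (bdy i)" "real (bdy (Suc i)) - real (bdy i) \<le> 2 * real n" if "i < K" for i
  proof -
    have "bdy i + n \<le> bdy (Suc i) \<and> bdy (Suc i) \<le> bdy i + 2 * n"
    proof (cases "Suc i < K")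
      case True
      then show ?thesis by (simp add: bdy_def)
    next
      case False
      then have K: "K = Suc i" using that by simp
      have "bdy i = i * n" "bdy (Suc i) = N" using that False by (simp_all add: bdy_def)
      moreover have "i * n + n \<le> N" "N \<le> i * n + 2 * n" using K_le last_le unfolding K by simp_all
      ultimately show ?thesis by simp
    qed
    then show "real n \<le> real (bdy (Suc i)) - real (bdy i)" "real (bdy (Suc i)) - real (bdy i) \<le> 2 * real n"
      by linarith+
  qed
  have "real n * real n \<le> (real (bdy (Suc i)) - real (bdy i)) * (real (bdy (Suc j)) - real (bdy j))"
    using b[OF assms(1)] b[OF assms(2)] by (intro mult_mono) auto
  then show "real n ^ 2 / real N \<le> msize i j"
    unfolding msize_def power2_eq_square by (rule divide_right_mono) simp
  have "(real (bdy (Suc i)) - real (bdy i)) * (real (bdy (Suc j)) - real (bdy j)) \<le> (2 * real n) * (2 * real n)"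
    using b[OF assms(1)] b[OF assms(2)] by (intro mult_mono) auto
  then have "msize i j \<le> (2 * real n) * (2 * real n) / real N"
    unfolding msize_def by (rule divide_right_mono) simp
  then show "msize i j \<le> 4 * (real n ^ 2 / real N)" by (simp add: power2_eq_square)
qed

lemma rho_cdev: "\<bar>\<Sum>\<sigma>\<in>sym_grp N. \<rho> \<sigma> * cdev i j \<sigma>\<bar> \<le> 2 * \<eta>"
proof -
  have "(\<Sum>\<sigma>\<in>sym_grp N. \<rho> \<sigma> * cdev i j \<sigma>) = (\<Sum>\<sigma>\<in>sym_grp N. \<rho> \<sigma> * dev (Suc i) (Suc j) \<sigma>) + (\<Sum>\<sigma>\<in>sym_grp N. \<rho> \<sigma> * dev i j \<sigma>)
     - (\<Sum>\<sigma>\<in>sym_grp N. \<rho> \<sigma> * dev i (Suc j) \<sigma>) - (\<Sum>\<sigma>\<in>sym_grp N. \<rho> \<sigma> * dev (Suc i) j \<sigma>)"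
    unfolding cdev_def by (simp add: ring_distribs sum.distrib sum_subtractf)
  then show ?thesis
    using rho_dev[of "Suc i" "Suc j"] rho_dev[of i j] rho_dev[of i "Suc j"] rho_dev[of "Suc i" j] by linarith
qed

lemma rho_sq_cdev: "(\<Sum>\<sigma>\<in>sym_grp N. \<rho> \<sigma> * (cdev i j \<sigma>)\<^sup>2) \<le> 16 * (real N + 2 * real N * \<eta>)"
proof -
  have sq: "(a + b - c - d)\<^sup>2 \<le> 4 * (a\<^sup>2 + b\<^sup>2 + c\<^sup>2 + d\<^sup>2)" for a b c d :: real
  proof -
    have "0 \<le> (a - b)\<^sup>2 + (a + c)\<^sup>2 + (a + d)\<^sup>2 + (b + c)\<^sup>2 + (b + d)\<^sup>2 + (c - d)\<^sup>2" by simp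
    then show ?thesis by (simp add: power2_eq_square algebra_simps)
  qed
  have "(\<Sum>\<sigma>\<in>sym_grp N. \<rho> \<sigma> * (cdev i j \<sigma>)\<^sup>2) \<le> (\<Sum>\<sigma>\<in>sym_grp N. \<rho> \<sigma> * (4 * ((dev (Suc i) (Suc j) \<sigma>)\<^sup>2 + (dev i j \<sigma>)\<^sup>2 + (dev i (Suc j) \<sigma>)\<^sup>2 + (dev (Suc i) j \<sigma>)\<^sup>2)))"
    unfolding cdev_def by (intro sum_mono mult_left_mono sq \<rho>_nonneg)
  also have "\<dots> = 4 * ((\<Sum>\<sigma>\<in>sym_grp N. \<rho> \<sigma> * (dev (Suc i) (Suc j) \<sigma>)\<^sup>2) + (\<Sum>\<sigma>\<in>sym_grp N. \<rho> \<sigma> * (dev i j \<sigma>)\<^sup>2)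
      + (\<Sum>\<sigma>\<in>sym_grp N. \<rho> \<sigma> * (dev i (Suc j) \<sigma>)\<^sup>2) + (\<Sum>\<sigma>\<in>sym_grp N. \<rho> \<sigma> * (dev (Suc i) j \<sigma>)\<^sup>2))"
    unfolding sum.distrib[symmetric] sum_distrib_left by (intro sum.cong) (auto simp: algebra_simps)
  finally show ?thesis
    using rho_sq_dev[of "Suc i" "Suc j"] rho_sq_dev[of i j] rho_sq_dev[of i "Suc j"] rho_sq_dev[of "Suc i" j] by argo
qed

text \<open>The number of inverted pairs between the two blocks of positions whose exchange realises
  the move \<open>bump i j\<close>.\<close>

definition grad_weight :: "nat \<Rightarrow> nat \<Rightarrow> (nat \<Rightarrow> nat) \<Rightarrow> real" where
  "grad_weight i j \<sigma> = real (cnt \<sigma> i (Suc j)) * real (cnt \<sigma> (Suc i) j)"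

text \<open>The uniform means form a table of rank one, so by \<open>msize_det\<close> their minor
  vanishes. The terms linear in the deviations need mean heights only and are at most 2 N \<eta>
  each; the quadratic ones need second moments. In total this is at most 104 N \<eta>, rounded
  up.\<close>

lemma rho_det:
  "(\<Sum>\<sigma>\<in>sym_grp N. \<rho> \<sigma> * (real (cnt \<sigma> i j) * real (cnt \<sigma> (Suc i) (Suc j)) - grad_weight i j \<sigma>)) \<le> 128 * real N * \<eta>"
proof -
  let ?E = "\<lambda>f. \<Sum>\<sigma>\<in>sym_grp N. \<rho> \<sigma> * f \<sigma>"
  let ?m1 = "msize i j" let ?m2 = "msize i (Suc j)" let ?m3 = "msize (Suc i) j" let ?m4 = "msize (Suc i) (Suc j)"
  let ?d1 = "cdev i j" let ?d2 = "cdev i (Suc j)" let ?d3 = "cdev (Suc i) j" let ?d4 = "cdev (Suc i) (Suc j)"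
  have pt: "real (cnt \<sigma> i j) * real (cnt \<sigma> (Suc i) (Suc j)) - grad_weight i j \<sigma> \<le>
     ?m1 * ?d4 \<sigma> + ?m4 * ?d1 \<sigma> - ?m2 * ?d3 \<sigma> - ?m3 * ?d2 \<sigma> + (1/2) * ((?d1 \<sigma>)\<^sup>2 + (?d2 \<sigma>)\<^sup>2 + (?d3 \<sigma>)\<^sup>2 + (?d4 \<sigma>)\<^sup>2)" for \<sigma>
  proof -
    have "0 \<le> (?d1 \<sigma> - ?d4 \<sigma>)\<^sup>2 + (?d2 \<sigma> + ?d3 \<sigma>)\<^sup>2" by simp
    then have "?d1 \<sigma> * ?d4 \<sigma> - ?d2 \<sigma> * ?d3 \<sigma> \<le> (1/2) * ((?d1 \<sigma>)\<^sup>2 + (?d2 \<sigma>)\<^sup>2 + (?d3 \<sigma>)\<^sup>2 + (?d4 \<sigma>)\<^sup>2)"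
      by (simp add: power2_eq_square algebra_simps)
    moreover have "real (cnt \<sigma> i j) * real (cnt \<sigma> (Suc i) (Suc j)) - grad_weight i j \<sigma> =
      ?m1 * ?d4 \<sigma> + ?m4 * ?d1 \<sigma> - ?m2 * ?d3 \<sigma> - ?m3 * ?d2 \<sigma> + (?d1 \<sigma> * ?d4 \<sigma> - ?d2 \<sigma> * ?d3 \<sigma>)"
      unfolding grad_weight_def cnt_eq using msize_det[of i j] by (simp add: algebra_simps)
    ultimately show ?thesis by simp
  qed
  have "?E (\<lambda>\<sigma>. real (cnt \<sigma> i j) * real (cnt \<sigma> (Suc i) (Suc j)) - grad_weight i j \<sigma>) \<le>
    ?E (\<lambda>\<sigma>. ?m1 * ?d4 \<sigma> + ?m4 * ?d1 \<sigma> - ?m2 * ?d3 \<sigma> - ?m3 * ?d2 \<sigma> + (1/2) * ((?d1 \<sigma>)\<^sup>2 + (?d2 \<sigma>)\<^sup>2 + (?d3 \<sigma>)\<^sup>2 + (?d4 \<sigma>)\<^sup>2))"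
    by (intro sum_mono mult_left_mono pt \<rho>_nonneg)
  also have "\<dots> = ?m1 * ?E ?d4 + ?m4 * ?E ?d1 - ?m2 * ?E ?d3 - ?m3 * ?E ?d2 +
     (1/2) * (?E (\<lambda>\<sigma>. (?d1 \<sigma>)\<^sup>2) + ?E (\<lambda>\<sigma>. (?d2 \<sigma>)\<^sup>2) + ?E (\<lambda>\<sigma>. (?d3 \<sigma>)\<^sup>2) + ?E (\<lambda>\<sigma>. (?d4 \<sigma>)\<^sup>2))"
    unfolding sum_distrib_left sum.distrib[symmetric] sum_subtractf[symmetric] by (intro sum.cong) (auto simp: algebra_simps)
  also have "\<dots> \<le> 8 * real N * \<eta> + 32 * (real N + 2 * real N * \<eta>)"
  proof -
    have "\<bar>msize a b * ?E (cdev c d)\<bar> \<le> real N * (2 * \<eta>)" for a b c d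
      unfolding abs_mult using msize_bounds[of a b] rho_cdev[of c d] by (intro mult_mono) auto
    then have m: "msize a b * ?E (cdev c d) \<le> real N * (2 * \<eta>)" "- (msize a b * ?E (cdev c d)) \<le> real N * (2 * \<eta>)" for a b c d
      unfolding abs_le_iff by blast+
    have lin: "x1 + x2 - x3 - x4 + (1/2) * (y1 + y2 + y3 + y4) \<le> 4 * b + 32 * e"
      if "x1 \<le> b" "x2 \<le> b" "- x3 \<le> b" "- x4 \<le> b" "y1 \<le> 16 * e" "y2 \<le> 16 * e" "y3 \<le> 16 * e" "y4 \<le> 16 * e"
      for x1 x2 x3 x4 y1 y2 y3 y4 b e :: real
      using that by argo
    show ?thesis
      by (rule order_trans[OF lin[OF m(1) m(1) m(2) m(2) rho_sq_cdev rho_sq_cdev rho_sq_cdev rho_sq_cdev]]) simp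
  qed
  also have "\<dots> \<le> 128 * real N * \<eta>"
  proof -
    have le: "real N * 1 \<le> real N * \<eta>" using \<eta>1 by (intro mult_left_mono) auto
    have lin: "8 * a * \<eta> + 32 * (a + 2 * a * \<eta>) \<le> 128 * a * \<eta>" if "a * 1 \<le> a * \<eta>" "0 \<le> a" for a
    proof -
      have "0 \<le> a * \<eta>" using that by simp
      moreover have "8 * a * \<eta> + 32 * (a + 2 * a * \<eta>) = 72 * (a * \<eta>) + 32 * a" "128 * a * \<eta> = 128 * (a * \<eta>)"
        by (simp_all add: algebra_simps)
      ultimately show ?thesis using that by linarith
    qed
    show ?thesis by (rule lin[OF le]) simp
  qed
  finally show ?thesis .
qed

end

section \<open>Oscillation of the density over typical tables\<close>

text \<open>Both products equal \<open>m1 m4\<close> up to 9 q u and 8 q u respectively, while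
  \<open>m1 m4\<close> is at least q^2. The relative error is therefore of order u / q, and the
  factor 20 leaves room for the cross terms.\<close>

lemma window_ratio:
  fixes q u m1 m2 m3 m4 :: real
  assumes "q > 0" "0 \<le> u" "u \<le> q / 100" "m1 * m4 = m2 * m3"
    "q \<le> m1" "q \<le> m2" "q \<le> m3" "q \<le> m4" "m1 \<le> 4 * q" "m2 \<le> 4 * q" "m3 \<le> 4 * q" "m4 \<le> 4 * q"
  shows "(m1 + u) * (m4 + u) \<le> (1 + 20 * u / q) * ((m2 - u) * (m3 - u))"
proof -
  define p where "p = m1 * m4"
  have uq: "u * u \<le> q * u / 100" using mult_right_mono[OF assms(3,2)] by simp
  have qu: "0 \<le> q * u" using assms by simp
  have "u * (m1 + m4) \<le> u * (8 * q)" using assms by (intro mult_left_mono) auto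
  then have "u * (m1 + m4) \<le> 8 * (q * u)" by (simp add: mult_ac)
  moreover have "(m1 + u) * (m4 + u) = p + u * (m1 + m4) + u * u" unfolding p_def by (simp add: algebra_simps)
  ultimately have l: "(m1 + u) * (m4 + u) \<le> p + 9 * (q * u)" using uq qu by linarith
  have "u * (m2 + m3) \<le> u * (8 * q)" using assms by (intro mult_left_mono) auto
  then have "u * (m2 + m3) \<le> 8 * (q * u)" by (simp add: mult_ac)
  moreover have "(m2 - u) * (m3 - u) = p - u * (m2 + m3) + u * u" unfolding p_def assms(4) by (simp add: algebra_simps)
  ultimately have "p - 8 * (q * u) \<le> (m2 - u) * (m3 - u)" using zero_le_square[of u] by linarith
  then have r: "(1 + 20 * u / q) * (p - 8 * (q * u)) \<le> (1 + 20 * u / q) * ((m2 - u) * (m3 - u))"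
    using assms by (intro mult_left_mono) auto
  have "q * q \<le> p" unfolding p_def using assms by (intro mult_mono) auto
  then have "(20 * u / q) * (q * q) \<le> (20 * u / q) * p" using assms by (intro mult_left_mono) auto
  then have "20 * (q * u) \<le> (20 * u / q) * p" using assms(1) by (simp add: mult_ac)
  moreover have "(1 + 20 * u / q) * (p - 8 * (q * u)) = p - 8 * (q * u) + (20 * u / q) * p - 160 * (u * u)"
    using assms(1) by (simp add: field_simps)
  ultimately have "p + 9 * (q * u) \<le> (1 + 20 * u / q) * (p - 8 * (q * u))" using uq qu by linarith
  then show ?thesis using l r by linarith
qed

section \<open>Densities as functions of tables\<close>

context block_density
begin

definition V :: "(nat \<Rightarrow> nat \<Rightarrow> int) set" where
  "V = tab ` sym_grp N"

text \<open>The choice of a representative is immaterial on \<open>V\<close>: by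
  \<open>dens_tab\<close> permutations with the same table have the same density. Outside
  \<open>V\<close> the value carries no meaning.\<close>

definition dens :: "(nat \<Rightarrow> nat \<Rightarrow> int) \<Rightarrow> real" where
  "dens k = \<rho> (SOME \<sigma>. \<sigma> \<in> sym_grp N \<and> tab \<sigma> = k)"

definition near :: "real \<Rightarrow> (nat \<Rightarrow> nat \<Rightarrow> int) \<Rightarrow> bool" where
  "near R k \<longleftrightarrow> (\<forall>i j. \<bar>of_int (k i j) - ctr i j\<bar> \<le> R)"

lemma V_finite [simp]: "finite V" by (simp add: V_def)

lemma wt_nonneg [simp]: "0 \<le> wt k" by (simp add: wt_def)

lemma dens_tab:
  assumes "\<sigma> \<in> sym_grp N"
  shows "dens (tab \<sigma>) = \<rho> \<sigma>"
proof -
  define \<tau> where "\<tau> = (SOME \<tau>. \<tau> \<in> sym_grp N \<and> tab \<tau> = tab \<sigma>)"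
  have "\<tau> \<in> sym_grp N \<and> tab \<tau> = tab \<sigma>" unfolding \<tau>_def by (rule someI[of _ \<sigma>]) (use assms in simp)
  then have \<tau>: "\<tau> \<in> sym_grp N" "tab \<sigma> = tab \<tau>" by auto
  obtain a c where ac: "a \<in> Y" "c \<in> Y" "\<tau> = a \<circ> \<sigma> \<circ> c"
    by (rule same_table_double_coset[OF assms \<tau>])
  have "\<rho> \<tau> = \<rho> \<sigma>" unfolding ac(3) \<rho>_right[OF ac(2)] \<rho>_left[OF ac(1)] ..
  then show ?thesis unfolding dens_def \<tau>_def .
qed

lemma tab_dev: "of_int (tab \<sigma> i j) - ctr i j = dev i j \<sigma>"
  by (simp add: tab_def dev_def)

lemma V_boundary:
  assumes "k \<in> V" "k' \<in> V" "\<not> (1 \<le> i \<and> i < K \<and> 1 \<le> j \<and> j < K)"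
  shows "k i j = k' i j"
proof -
  have "of_int (k i j) = ctr i j" if kV: "k \<in> V" for k
  proof -
    obtain \<sigma> where \<sigma>: "\<sigma> \<in> sym_grp N" "k = tab \<sigma>" using kV unfolding V_def by auto
    have "dev i j \<sigma> = 0" by (rule dev_boundary[OF \<sigma>(1) assms(3)])
    then show ?thesis unfolding \<sigma>(2) using tab_dev[of \<sigma> i j] by linarith
  qed
  then have "real_of_int (k i j) = of_int (k' i j)" using assms(1,2) by simp
  then show ?thesis by simp
qed

lemma cell_near:
  assumes "near R k"
  shows "\<bar>of_int (cell k i j) - msize i j\<bar> \<le> 4 * R"
proof -
  have "\<bar>of_int (k a b) - ctr a b\<bar> \<le> R" for a b using assms by (simp add: near_def)
  from this[of "Suc i" "Suc j"] this[of i j] this[of i "Suc j"] this[of "Suc i" j]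
  show ?thesis unfolding cell_def ctr_msize[symmetric] of_int_add of_int_diff by linarith
qed

lemma bump_V:
  assumes "k \<in> V" "Suc i < K" "Suc j < K" "cell k i (Suc j) > 0" "cell k (Suc i) j > 0"
  shows "bump i j k \<in> V" "dens k \<le> dens (bump i j k)"
proof -
  obtain \<sigma> where \<sigma>: "\<sigma> \<in> sym_grp N" "k = tab \<sigma>" using assms(1) by (auto simp: V_def)
  have "cnt \<sigma> i (Suc j) > 0" "cnt \<sigma> (Suc i) j > 0" using assms(4,5) unfolding \<sigma>(2) cell_tab by simp_all
  then obtain z z' where z: "z \<in> B i" "\<sigma> z \<in> B (Suc j)" "z' \<in> B (Suc i)" "\<sigma> z' \<in> B j"
    unfolding cnt_def card_gt_0_iff by blast
  let ?\<tau> = "\<sigma> \<circ> Transposition.transpose z z'"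
  have \<tau>: "?\<tau> \<in> sym_grp N"
    using z B_subset[of i] B_subset[of "Suc i"] by (intro sym_grp_comp \<sigma> transpose_in_sym_grp) auto
  have t: "tab ?\<tau> = bump i j k" unfolding \<sigma>(2) by (rule tab_transpose[OF assms(2,3) z(1,3,2,4)])
  then show "bump i j k \<in> V" using \<tau> unfolding V_def by (metis imageI)
  have "bruhat_le \<sigma> ?\<tau>" using z by (intro bruhat_le_transpose) auto
  then have "\<rho> \<sigma> \<le> \<rho> ?\<tau>" using \<rho>_mono \<sigma>(1) \<tau> unfolding bruhat_mono_def by blast
  then show "dens k \<le> dens (bump i j k)" using dens_tab[OF \<sigma>(1)] dens_tab[OF \<tau>] t \<sigma>(2) by simp
qed

lemma class_sum:
  "(\<Sum>\<sigma>\<in>{\<sigma> \<in> sym_grp N. Q (tab \<sigma>)}. h (tab \<sigma>)) = (\<Sum>k\<in>{k \<in> V. Q k}. wt k * h k)"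
proof -
  let ?S = "{\<sigma> \<in> sym_grp N. Q (tab \<sigma>)}"
  have im: "tab ` ?S = {k \<in> V. Q k}" by (auto simp: V_def)
  have "(\<Sum>\<sigma>\<in>?S. h (tab \<sigma>)) = (\<Sum>k\<in>tab ` ?S. \<Sum>\<sigma>\<in>{\<sigma> \<in> ?S. tab \<sigma> = k}. h (tab \<sigma>))"
    by (rule sum.image_gen) simp
  also have "\<dots> = (\<Sum>k\<in>{k \<in> V. Q k}. wt k * h k)"
    unfolding im
  proof (rule sum.cong[OF refl])
    fix k assume "k \<in> {k \<in> V. Q k}"
    then have "{\<sigma> \<in> ?S. tab \<sigma> = k} = {\<sigma> \<in> sym_grp N. tab \<sigma> = k}" by auto
    then show "(\<Sum>\<sigma>\<in>{\<sigma> \<in> ?S. tab \<sigma> = k}. h (tab \<sigma>)) = wt k * h k" by (simp add: wt_def)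
  qed
  finally show ?thesis .
qed

text \<open>Summing \<open>\<rho> (\<sigma> \<circ> t) - \<rho> \<sigma> \<ge> 0\<close> over all order-increasing swaps \<open>t\<close> between two adjacent
  blocks gives an \<open>L\<^sup>1\<close> gradient bound without absolute values: by reversibility the sum is the
  \<open>\<rho>\<close>-mean of a \<open>2 \<times> 2\<close> minor of the table, which the height bounds make small.\<close>

lemma gradient_bound:
  assumes "Suc i < K" "Suc j < K" "c > 0" "\<And>k a b. near R k \<Longrightarrow> a < K \<Longrightarrow> b < K \<Longrightarrow> c \<le> of_int (cell k a b)"
  shows "(\<Sum>k\<in>{k \<in> V. near R k}. wt k * (dens (bump i j k) - dens k)) \<le> 128 * real N * \<eta> / c\<^sup>2"
proof -
  let ?t = Transposition.transpose
  define W where "W = (\<lambda>\<sigma>. \<Sum>z\<in>B i. \<Sum>z'\<in>B (Suc i). of_bool (\<sigma> z \<in> B (Suc j) \<and> \<sigma> z' \<in> B j) * (\<rho> (\<sigma> \<circ> ?t z z') - \<rho> \<sigma>))"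
  have term_nonneg: "0 \<le> of_bool (\<sigma> z \<in> B (Suc j) \<and> \<sigma> z' \<in> B j) * (\<rho> (\<sigma> \<circ> ?t z z') - \<rho> \<sigma>)"
    if "\<sigma> \<in> sym_grp N" "z \<in> B i" "z' \<in> B (Suc i)" for \<sigma> z z'
  proof (cases "\<sigma> z \<in> B (Suc j) \<and> \<sigma> z' \<in> B j")
    case True
    have "\<sigma> \<circ> ?t z z' \<in> sym_grp N"
      using that B_subset[of i] B_subset[of "Suc i"] by (intro sym_grp_comp transpose_in_sym_grp) auto
    moreover have "bruhat_le \<sigma> (\<sigma> \<circ> ?t z z')" using that True by (intro bruhat_le_transpose) auto
    ultimately have "\<rho> \<sigma> \<le> \<rho> (\<sigma> \<circ> ?t z z')" using \<rho>_mono that(1) unfolding bruhat_mono_def by blast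
    then show ?thesis by simp
  next
    case False
    then show ?thesis by (simp only: of_bool_eq(1) mult_zero_left order_refl)
  qed
  then have W_nonneg: "0 \<le> W \<sigma>" if "\<sigma> \<in> sym_grp N" for \<sigma>
    unfolding W_def using that by (intro sum_nonneg) blast
  have W_split: "W \<sigma> = (\<Sum>z\<in>B i. \<Sum>z'\<in>B (Suc i). of_bool (\<sigma> z \<in> B (Suc j) \<and> \<sigma> z' \<in> B j) * \<rho> (\<sigma> \<circ> ?t z z')) - grad_weight i j \<sigma> * \<rho> \<sigma>" for \<sigma>
    unfolding W_def right_diff_distrib sum_subtractf sum_distrib_right[symmetric] sum_of_bool_cnt grad_weight_def ..
  have "(\<Sum>\<sigma>\<in>sym_grp N. W \<sigma>) = (\<Sum>\<sigma>\<in>sym_grp N. real (cnt \<sigma> i j) * real (cnt \<sigma> (Suc i) (Suc j)) * \<rho> \<sigma>) - (\<Sum>\<sigma>\<in>sym_grp N. grad_weight i j \<sigma> * \<rho> \<sigma>)"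
    unfolding W_split sum_subtractf
    by (subst swap_identity[where i = i and i' = "Suc i" and j' = "Suc j" and j = j and f = \<rho>]) simp
  also have "\<dots> = (\<Sum>\<sigma>\<in>sym_grp N. \<rho> \<sigma> * (real (cnt \<sigma> i j) * real (cnt \<sigma> (Suc i) (Suc j)) - grad_weight i j \<sigma>))"
    unfolding sum_subtractf[symmetric] by (intro sum.cong refl) (simp add: algebra_simps)
  finally have W_sum: "(\<Sum>\<sigma>\<in>sym_grp N. W \<sigma>) \<le> 128 * real N * \<eta>" using rho_det[of i j] by simp
  \<comment> \<open>In the window both off-diagonal cells have at least \<open>c\<close> elements,
    so at least c^2 exchanges realise the move, all with the same increment of the density.\<close>
  have W_near: "c\<^sup>2 * (dens (bump i j (tab \<sigma>)) - dens (tab \<sigma>)) \<le> W \<sigma>" if \<sigma>: "\<sigma> \<in> sym_grp N" "near R (tab \<sigma>)" for \<sigma>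
  proof -
    have "W \<sigma> = (\<Sum>z\<in>B i. \<Sum>z'\<in>B (Suc i). of_bool (\<sigma> z \<in> B (Suc j) \<and> \<sigma> z' \<in> B j) * (dens (bump i j (tab \<sigma>)) - dens (tab \<sigma>)))"
      unfolding W_def
    proof (rule sum.cong[OF refl], rule sum.cong[OF refl])
      fix z z' assume z: "z \<in> B i" "z' \<in> B (Suc i)"
      show "of_bool (\<sigma> z \<in> B (Suc j) \<and> \<sigma> z' \<in> B j) * (\<rho> (\<sigma> \<circ> ?t z z') - \<rho> \<sigma>) =
         of_bool (\<sigma> z \<in> B (Suc j) \<and> \<sigma> z' \<in> B j) * (dens (bump i j (tab \<sigma>)) - dens (tab \<sigma>))"
      proof (cases "\<sigma> z \<in> B (Suc j) \<and> \<sigma> z' \<in> B j")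
        case True
        have "\<sigma> \<circ> ?t z z' \<in> sym_grp N"
          using z B_subset[of i] B_subset[of "Suc i"] by (intro sym_grp_comp transpose_in_sym_grp \<sigma>) auto
        moreover have "tab (\<sigma> \<circ> ?t z z') = bump i j (tab \<sigma>)"
          by (rule tab_transpose[OF assms(1,2) z]) (use True in auto)
        ultimately show ?thesis using dens_tab[of "\<sigma> \<circ> ?t z z'"] dens_tab[OF \<sigma>(1)] by simp
      next
        case False
        then show ?thesis by (simp only: of_bool_eq(1) mult_zero_left)
      qed
    qed
    also have "\<dots> = grad_weight i j \<sigma> * (dens (bump i j (tab \<sigma>)) - dens (tab \<sigma>))"
      unfolding sum_distrib_right[symmetric] sum_of_bool_cnt grad_weight_def ..
    finally have W: "W \<sigma> = grad_weight i j \<sigma> * (dens (bump i j (tab \<sigma>)) - dens (tab \<sigma>))" .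
    have c: "c \<le> real (cnt \<sigma> i (Suc j))" "c \<le> real (cnt \<sigma> (Suc i) j)"
      using assms(4)[OF \<sigma>(2), of i "Suc j"] assms(4)[OF \<sigma>(2), of "Suc i" j] assms(1,2) unfolding cell_tab by simp_all
    then have "c\<^sup>2 \<le> grad_weight i j \<sigma>"
      unfolding grad_weight_def power2_eq_square using assms(3) by (intro mult_mono) auto
    moreover have "dens (tab \<sigma>) \<le> dens (bump i j (tab \<sigma>))"
    proof (rule bump_V(2)[OF _ assms(1,2)])
      show "tab \<sigma> \<in> V" using \<sigma>(1) by (simp add: V_def)
      show "0 < cell (tab \<sigma>) i (Suc j)" "0 < cell (tab \<sigma>) (Suc i) j"
        unfolding cell_tab using c assms(3) by (simp_all add: of_nat_0_less_iff[symmetric, where 'a = real] del: of_nat_0_less_iff)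
    qed
    ultimately show ?thesis unfolding W by (intro mult_right_mono) auto
  qed
  have "c\<^sup>2 * (\<Sum>k\<in>{k \<in> V. near R k}. wt k * (dens (bump i j k) - dens k)) =
     (\<Sum>\<sigma>\<in>{\<sigma> \<in> sym_grp N. near R (tab \<sigma>)}. c\<^sup>2 * (dens (bump i j (tab \<sigma>)) - dens (tab \<sigma>)))"
    using class_sum[where Q = "near R" and h = "\<lambda>k. dens (bump i j k) - dens k"]
    unfolding sum_distrib_left[symmetric] by simp
  also have "\<dots> \<le> (\<Sum>\<sigma>\<in>{\<sigma> \<in> sym_grp N. near R (tab \<sigma>)}. W \<sigma>)"
    by (intro sum_mono W_near) auto
  also have "\<dots> \<le> (\<Sum>\<sigma>\<in>sym_grp N. W \<sigma>)"
    by (rule sum_mono2) (use W_nonneg in auto)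
  also have "\<dots> \<le> 128 * real N * \<eta>" by (rule W_sum)
  finally show ?thesis using assms(3) by (simp add: field_simps)
qed

end

section \<open>Elementary moves inside a window of typical tables\<close>

locale block_window = block_density +
  fixes R :: real
  assumes R_nonneg: "0 \<le> R" and R_small: "4 * R + 1 \<le> (real n ^ 2 / real N) / 100"
begin

text \<open>\<open>q\<close> bounds the mean cell sizes from below. In the window a cell is off its
  mean by at most 4 R, from its four corners, and one more unit pays for a move; \<theta> is the
  weight loss that \<open>window_ratio\<close> yields for the error 4 R + 1, and \<open>G\<close> is
  \<open>gradient_bound\<close> with c = q / 2.\<close>

definition q :: real where "q = real n ^ 2 / real N"
definition \<theta> :: real where "\<theta> = 20 * (4 * R + 1) / q"
definition G :: real where "G = 512 * real N * \<eta> / q\<^sup>2"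

lemma q_pos: "q > 0" unfolding q_def using n1 N_pos by simp

lemma \<theta>_nonneg: "\<theta> \<ge> 0" unfolding \<theta>_def using q_pos R_nonneg by simp

lemma G_nonneg: "G \<ge> 0" unfolding G_def using \<eta>1 by simp

lemma cell_bounds:
  assumes "near R k" "a < K" "b < K"
  shows "msize a b - (4 * R + 1) \<le> of_int (cell k a b)" "of_int (cell k a b) + 1 \<le> msize a b + (4 * R + 1)"
    "q / 2 \<le> of_int (cell k a b)" "0 < cell k a b"
proof -
  note c = cell_near[OF assms(1), of a b]
  show 1: "msize a b - (4 * R + 1) \<le> of_int (cell k a b)" "of_int (cell k a b) + 1 \<le> msize a b + (4 * R + 1)"
    using c by linarith+
  have "q \<le> msize a b" using msize_range(1)[OF assms(2,3)] by (simp add: q_def)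
  moreover have "4 * R + 1 \<le> q / 100" using R_small by (simp add: q_def)
  ultimately show 2: "q / 2 \<le> of_int (cell k a b)" using 1(1) q_pos by linarith
  then have "0 < real_of_int (cell k a b)" using q_pos by linarith
  then show "0 < cell k a b" by simp
qed

text \<open>\<open>wt_balance\<close> converts the ratio of the two weights into a ratio of cell
  products, to which \<open>window_ratio\<close> applies.\<close>

lemma bump_step:
  assumes "k \<in> V" "near R k" "Suc i < K" "Suc j < K"
  shows "bump i j k \<in> V" "dens k \<le> dens (bump i j k)" "wt k \<le> (1 + \<theta>) * wt (bump i j k)"
proof -
  have lt: "i < K" "j < K" using assms by auto
  show "bump i j k \<in> V" "dens k \<le> dens (bump i j k)"
    using bump_V[OF assms(1,3,4)] cell_bounds(4)[OF assms(2)] assms lt by auto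
  let ?u = "4 * R + 1"
  define a where "a = real_of_int (cell k i (Suc j)) * of_int (cell k (Suc i) j)"
  define a' where "a' = real_of_int (cell (bump i j k) i j) * of_int (cell (bump i j k) (Suc i) (Suc j))"
  have c: "cell (bump i j k) i j = cell k i j + 1" "cell (bump i j k) (Suc i) (Suc j) = cell k (Suc i) (Suc j) + 1"
    by (simp_all add: cell_def bump_def)
  note cb = cell_bounds[OF assms(2)]
  have a_pos: "a > 0" unfolding a_def using cb(4)[of i "Suc j"] cb(4)[of "Suc i" j] assms lt by simp
  have mr: "q \<le> msize i' j'" "msize i' j' \<le> 4 * q" if "i' < K" "j' < K" for i' j'
    using msize_range[OF that] by (simp_all add: q_def)
  have u: "0 \<le> ?u" "?u \<le> q / 100" using R_nonneg R_small by (simp_all add: q_def)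
  have "a' \<le> (msize i j + ?u) * (msize (Suc i) (Suc j) + ?u)"
    unfolding a'_def c of_int_add of_int_1
    using cb(2)[of i j] cb(2)[of "Suc i" "Suc j"] cb(4)[of i j] cb(4)[of "Suc i" "Suc j"] mr[of i j] mr[of "Suc i" "Suc j"] q_pos u(1) assms lt
    by (intro mult_mono) auto
  also have "\<dots> \<le> (1 + 20 * ?u / q) * ((msize i (Suc j) - ?u) * (msize (Suc i) j - ?u))"
    by (rule window_ratio[OF q_pos u msize_det]) (use mr assms lt in auto)
  also have "\<dots> \<le> (1 + \<theta>) * a"
  proof -
    have "0 \<le> msize i (Suc j) - ?u" "0 \<le> msize (Suc i) j - ?u"
      using mr[of i "Suc j"] mr[of "Suc i" j] u q_pos assms lt by auto
    then have "(msize i (Suc j) - ?u) * (msize (Suc i) j - ?u) \<le> a"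
      unfolding a_def using cb(1)[of i "Suc j"] cb(1)[of "Suc i" j] assms lt by (intro mult_mono) auto
    then show ?thesis unfolding \<theta>_def[symmetric] using \<theta>_nonneg by (intro mult_left_mono) auto
  qed
  finally have "wt (bump i j k) * a' \<le> wt (bump i j k) * ((1 + \<theta>) * a)" by (intro mult_left_mono) auto
  then have "wt k * a \<le> ((1 + \<theta>) * wt (bump i j k)) * a"
    using wt_balance[OF assms(3,4), of k] unfolding a_def a'_def by (simp add: mult_ac)
  then show "wt k \<le> (1 + \<theta>) * wt (bump i j k)" using a_pos by (simp add: mult_le_cancel_right)
qed

lemma gradient_window:
  assumes "Suc i < K" "Suc j < K"
  shows "(\<Sum>k\<in>{k \<in> V. near R k}. wt k * (dens (bump i j k) - dens k)) \<le> G"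
proof -
  have "(\<Sum>k\<in>{k \<in> V. near R k}. wt k * (dens (bump i j k) - dens k)) \<le> 128 * real N * \<eta> / (q / 2)\<^sup>2"
    by (rule gradient_bound[OF assms]) (use q_pos cell_bounds(3) in auto)
  also have "\<dots> = G" unfolding G_def by (simp add: power2_eq_square)
  finally show ?thesis .
qed

text \<open>Monotonicity of \<rho> compares permutations, not tables. Corners at which
  \<open>k\<close> is below \<open>k'\<close> are raised one at a time; every intermediate table
  lies between the two, hence in the window, where all cells are positive and each move is realised
  by an exchange. The induction is on the total height still missing.\<close>

lemma dens_mono:
  assumes "k \<in> V" "k' \<in> V" "near R k" "near R k'" "\<And>i j. k i j \<le> k' i j"
  shows "dens k \<le> dens k'"
  using assms
proof (induction "nat (\<Sum>i<K. \<Sum>j<K. k' i j - k i j)" arbitrary: k rule: less_induct)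
  case less
  show ?case
  proof (cases "k = k'")
    case False
    then obtain a b where ab: "k a b \<noteq> k' a b" by (auto simp: fun_eq_iff)
    then have in_ab: "1 \<le> a \<and> a < K \<and> 1 \<le> b \<and> b < K" using V_boundary[OF less.prems(1,2)] by blast
    then obtain i j where ij: "a = Suc i" "b = Suc j" by (metis Suc_le_D One_nat_def)
    let ?k = "bump i j k"
    have lt: "Suc i < K" "Suc j < K" using in_ab ij by auto
    note st = bump_step[OF less.prems(1,3) lt]
    have le: "?k x y \<le> k' x y" for x y
      using less.prems(5)[of x y] ab ij by (auto simp: bump_def)
    have nr: "near R ?k" unfolding near_def
    proof (intro allI)
      fix x y
      have "real_of_int (k x y) \<le> of_int (?k x y)" "real_of_int (?k x y) \<le> of_int (k' x y)"
        using le[of x y] by (auto simp: bump_def)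
      moreover have "\<bar>of_int (k x y) - ctr x y\<bar> \<le> R" "\<bar>of_int (k' x y) - ctr x y\<bar> \<le> R"
        using less.prems(3,4) by (auto simp: near_def)
      ultimately show "\<bar>of_int (?k x y) - ctr x y\<bar> \<le> R" by linarith
    qed
    have "(\<Sum>i<K. \<Sum>j<K. k' i j - ?k i j) < (\<Sum>i<K. \<Sum>j<K. k' i j - k i j)"
    proof (rule sum_strict_mono_ex1)
      show "\<forall>x\<in>{..<K}. (\<Sum>j<K. k' x j - ?k x j) \<le> (\<Sum>j<K. k' x j - k x j)"
        by (intro ballI sum_mono) (auto simp: bump_def)
      have "(\<Sum>j<K. k' a j - ?k a j) < (\<Sum>j<K. k' a j - k a j)"
        by (rule sum_strict_mono_ex1) (use in_ab ij in \<open>auto simp: bump_def intro!: bexI[of _ b]\<close>)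
      then show "\<exists>x\<in>{..<K}. (\<Sum>j<K. k' x j - ?k x j) < (\<Sum>j<K. k' x j - k x j)" using in_ab by blast
    qed simp
    moreover have "0 \<le> (\<Sum>i<K. \<Sum>j<K. k' i j - ?k i j)" by (intro sum_nonneg) (use le in auto)
    ultimately have "nat (\<Sum>i<K. \<Sum>j<K. k' i j - ?k i j) < nat (\<Sum>i<K. \<Sum>j<K. k' i j - k i j)" by linarith
    from less.hyps[OF this st(1) less.prems(2) nr less.prems(4) le] show ?thesis using st(2) by linarith
  qed simp
qed

section \<open>Sequences of moves and the shift estimate\<close>

definition bumps :: "(nat \<times> nat) list \<Rightarrow> (nat \<Rightarrow> nat \<Rightarrow> int) \<Rightarrow> nat \<Rightarrow> nat \<Rightarrow> int" where
  "bumps xs k = foldr (\<lambda>(i, j). bump i j) xs k"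

lemma bumps_apply:
  "bumps xs k a b = k a b + (if 1 \<le> a \<and> 1 \<le> b then int (count_list xs (a - 1, b - 1)) else 0)"
proof (induction xs)
  case (Cons x xs)
  obtain i j where "x = (i, j)" by (cases x)
  then show ?case using Cons by (auto simp: bumps_def bump_def)
qed (simp add: bumps_def)

lemma bumps_Cons: "bumps ((i, j) # xs) k = bump i j (bumps xs k)"
  by (simp add: bumps_def)

lemma inj_bumps: "inj (bumps xs)"
proof (rule injI, intro ext)
  fix k k' a b assume "bumps xs k = bumps xs k'"
  then have "bumps xs k a b = bumps xs k' a b" by simp
  then show "k a b = k' a b" unfolding bumps_apply by simp
qed

lemma near_bumps:
  assumes "near r k" "\<And>p. real (count_list xs p) \<le> R - r"
  shows "near R (bumps xs k)"
  unfolding near_def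
proof (intro allI)
  fix a b
  have "\<bar>of_int (k a b) - ctr a b\<bar> \<le> r" using assms(1) by (simp add: near_def)
  moreover have "real (count_list xs (a - 1, b - 1)) \<le> R - r" by (rule assms(2))
  ultimately show "\<bar>of_int (bumps xs k a b) - ctr a b\<bar> \<le> R" unfolding bumps_apply by auto
qed

lemma bumps_path:
  assumes "k \<in> V" "near r k" "\<And>p. real (count_list xs p) \<le> R - r" "\<And>i j. (i, j) \<in> set xs \<Longrightarrow> Suc i < K \<and> Suc j < K"
  shows "bumps xs k \<in> V \<and> wt k \<le> (1 + \<theta>) ^ length xs * wt (bumps xs k)"
  using assms(3,4)
proof (induction xs)
  case Nil
  show ?case using assms(1) by (simp add: bumps_def)
next
  case (Cons x xs)
  obtain i j where x: "x = (i, j)" by (cases x)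
  have cnt: "real (count_list xs p) \<le> R - r" for p using Cons.prems(1)[of p] by (auto split: if_splits)
  have IH: "bumps xs k \<in> V" "wt k \<le> (1 + \<theta>) ^ length xs * wt (bumps xs k)" using Cons.IH[OF cnt] Cons.prems(2) by auto
  have lt: "Suc i < K" "Suc j < K" using Cons.prems(2) x by auto
  note st = bump_step[OF IH(1) near_bumps[OF assms(2) cnt] lt]
  have "wt k \<le> (1 + \<theta>) ^ length xs * ((1 + \<theta>) * wt (bump i j (bumps xs k)))"
    by (rule order_trans[OF IH(2) mult_left_mono[OF st(3)]]) (use \<theta>_nonneg in simp)
  then show ?case using st(1) unfolding x bumps_Cons by (simp add: mult_ac)
qed

text \<open>Telescoping over the moves. A later increment sits at a shifted table but carries the
  weight of the original one; \<open>bumps_path\<close> exchanges the weights at the cost of powers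
  of 1 + \<theta>, and injectivity of the shift leads back to the unshifted gradient bound.\<close>

lemma shift_bound:
  assumes "\<And>p. real (count_list xs p) \<le> R - r" "\<And>i j. (i, j) \<in> set xs \<Longrightarrow> Suc i < K \<and> Suc j < K"
  shows "(\<Sum>k\<in>{k \<in> V. near r k}. wt k * (dens (bumps xs k) - dens k)) \<le> real (length xs) * (1 + \<theta>) ^ length xs * G"
  using assms
proof (induction xs)
  case Nil
  show ?case by (simp add: bumps_def)
next
  case (Cons x xs)
  obtain i j where x: "x = (i, j)" by (cases x)
  have cnt: "real (count_list xs p) \<le> R - r" for p using Cons.prems(1)[of p] by (auto split: if_splits)
  have mem: "Suc i < K \<and> Suc j < K" if "(i, j) \<in> set xs" for i j using Cons.prems(2) that by auto
  have lt: "Suc i < K" "Suc j < K" using Cons.prems(2) x by auto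
  let ?W = "{k \<in> V. near r k}" let ?p = "(1 + \<theta>) ^ length xs"
  have p1: "1 \<le> 1 + \<theta>" using \<theta>_nonneg by simp
  let ?g = "\<lambda>k. wt k * (dens (bump i j k) - dens k)"
  have g_nonneg: "0 \<le> ?g k" if "k \<in> V" "near R k" for k using bump_step(2)[OF that lt] by simp
  have "(\<Sum>k\<in>?W. wt k * (dens (bump i j (bumps xs k)) - dens (bumps xs k))) \<le> (\<Sum>k\<in>?W. ?p * ?g (bumps xs k))"
  proof (rule sum_mono)
    fix k assume k: "k \<in> ?W"
    then have b: "bumps xs k \<in> V" "wt k \<le> ?p * wt (bumps xs k)" using bumps_path[of k r xs] cnt mem by auto
    have "0 \<le> dens (bump i j (bumps xs k)) - dens (bumps xs k)"
      using bump_step(2)[OF b(1) near_bumps[OF _ cnt] lt] k by simp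
    from mult_right_mono[OF b(2) this]
    show "wt k * (dens (bump i j (bumps xs k)) - dens (bumps xs k)) \<le> ?p * ?g (bumps xs k)" by (simp add: mult_ac)
  qed
  also have "\<dots> = ?p * (\<Sum>k\<in>bumps xs ` ?W. ?g k)"
    by (subst sum.reindex) (auto intro: inj_on_subset[OF inj_bumps] simp: sum_distrib_left)
  also have "(\<Sum>k\<in>bumps xs ` ?W. ?g k) \<le> (\<Sum>k\<in>{k \<in> V. near R k}. ?g k)"
  proof (rule sum_mono2)
    show "bumps xs ` ?W \<subseteq> {k \<in> V. near R k}"
      using bumps_path[of _ r xs] near_bumps[of r _ xs] cnt mem by auto
  qed (use g_nonneg in auto)
  also have "\<dots> \<le> G" by (rule gradient_window[OF lt])
  finally have "(\<Sum>k\<in>?W. wt k * (dens (bump i j (bumps xs k)) - dens (bumps xs k))) \<le> ?p * G"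
    using p1 by simp
  moreover have "(\<Sum>k\<in>?W. wt k * (dens (bumps xs k) - dens k)) \<le> real (length xs) * ?p * G"
    by (rule Cons.IH[OF cnt mem])
  ultimately have "(\<Sum>k\<in>?W. wt k * (dens (bumps (x # xs) k) - dens k)) \<le> real (Suc (length xs)) * ?p * G"
    unfolding x bumps_Cons by (simp add: right_diff_distrib sum_subtractf algebra_simps)
  also have "\<dots> \<le> real (Suc (length xs)) * (1 + \<theta>) ^ Suc (length xs) * G"
    using p1 G_nonneg by (intro mult_right_mono mult_left_mono power_increasing) auto
  finally show ?case by simp
qed

end

section \<open>From oscillation to distance from the uniform law\<close>

lemma count_list_concat_replicate: "count_list (concat (replicate L xs)) p = L * count_list xs p"
  by (induction L) auto

lemma length_concat_replicate: "length (concat (replicate L xs)) = L * length xs"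
  by (induction L) auto

lemma count_list_of_distinct: "distinct xs \<Longrightarrow> count_list xs p = (if p \<in> set xs then 1 else 0)"
  by (induction xs) auto

context block_window
begin

text \<open>Two typical tables need not be comparable, so a common upper bound is used: raising
  every interior corner by L \<ge> 2 r lifts a table within r of the centre above all others of this
  kind. The mean gain of \<rho> under this shift bounds its oscillation. Atypical tables are handled
  by Markov's inequality at the K^2 corners, under both laws.\<close>

lemma table_distance_bound:
  assumes r: "0 < r" "2 * r \<le> real L" "R = r + real L"
  shows "(\<Sum>\<sigma>\<in>sym_grp N. \<bar>\<rho> \<sigma> - 1 / fact N\<bar>)
     \<le> 2 * (real (L * ((K - 1) * (K - 1))) * (1 + \<theta>) ^ (L * ((K - 1) * (K - 1))) * G)
       + 2 * (real K * real K * (2 * sqrt (real N) + \<eta>) / r)"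
proof -
  let ?S = "sym_grp N" and ?F = "fact N :: real"
  define ps where "ps = List.product [0..<K - 1] [0..<K - 1]"
  \<comment> \<open>Each interior corner occurs L times, so in whatever order the moves are made no
    corner leaves the window of radius R = r + L.\<close>
  define xs where "xs = concat (replicate L ps)"
  have F: "?F > 0" "real (card ?S) = ?F" by (simp_all add: card_sym_grp)
  have ps: "set ps = {0..<K - 1} \<times> {0..<K - 1}" "distinct ps" "length ps = (K - 1) * (K - 1)"
    unfolding ps_def by (auto simp: distinct_product)
  have cnt_xs: "count_list xs p = (if p \<in> {0..<K - 1} \<times> {0..<K - 1} then L else 0)" for p
    unfolding xs_def count_list_concat_replicate
    using count_list_of_distinct[OF ps(2)] ps(1) by simp
  have cnt: "real (count_list xs p) \<le> R - r" for p unfolding cnt_xs r(3) by auto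
  have "set xs \<subseteq> set ps" unfolding xs_def by (induction L) auto
  then have mem: "Suc i < K \<and> Suc j < K" if "(i, j) \<in> set xs" for i j using that ps(1) by auto
  have len: "length xs = L * ((K - 1) * (K - 1))" unfolding xs_def length_concat_replicate ps(3) ..
  define e where "e = (\<lambda>\<sigma>. dens (bumps xs (tab \<sigma>)) - \<rho> \<sigma>)"
  define Good where "Good = {\<sigma> \<in> ?S. near r (tab \<sigma>)}"
  define Bad where "Bad = {\<sigma> \<in> ?S. \<not> near r (tab \<sigma>)}"
  have fin: "finite Good" "finite Bad" "Good \<subseteq> ?S" "Bad \<subseteq> ?S" by (auto simp: Good_def Bad_def)
  have top: "\<rho> \<tau> \<le> \<rho> \<sigma> + e \<sigma>" if "\<sigma> \<in> Good" "\<tau> \<in> Good" for \<sigma> \<tau>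
  proof -
    have k: "tab \<sigma> \<in> V" "tab \<tau> \<in> V" "near r (tab \<sigma>)" "near r (tab \<tau>)" and S: "\<tau> \<in> ?S"
      using that by (auto simp: Good_def V_def)
    have b: "bumps xs (tab \<sigma>) \<in> V" "near R (bumps xs (tab \<sigma>))"
      using bumps_path[OF k(1,3) cnt mem] near_bumps[OF k(3) cnt] by auto
    have "r \<le> R" unfolding r(3) by simp
    then have "near R (tab \<tau>)" using k(4) order_trans unfolding near_def by blast
    moreover have "tab \<tau> i j \<le> bumps xs (tab \<sigma>) i j" for i j
    proof (cases "1 \<le> i \<and> i < K \<and> 1 \<le> j \<and> j < K")
      case True
      have "\<bar>of_int (tab \<sigma> i j) - ctr i j\<bar> \<le> r" "\<bar>of_int (tab \<tau> i j) - ctr i j\<bar> \<le> r"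
        using k(3,4) by (auto simp: near_def)
      then have "real_of_int (tab \<tau> i j) \<le> of_int (tab \<sigma> i j + int L)" using r(2) by simp
      then have "tab \<tau> i j \<le> tab \<sigma> i j + int L" by (simp only: of_int_le_iff)
      moreover have "(i - 1, j - 1) \<in> {0..<K - 1} \<times> {0..<K - 1}" using True by auto
      ultimately show ?thesis unfolding bumps_apply cnt_xs using True by simp
    next
      case False
      then show ?thesis using V_boundary[OF k(2) b(1)] by simp
    qed
    ultimately have "dens (tab \<tau>) \<le> dens (bumps xs (tab \<sigma>))" using dens_mono[OF k(2) b(1) _ b(2)] by blast
    then show ?thesis unfolding e_def dens_tab[OF S] by simp
  qed
  have e_nonneg: "0 \<le> e \<sigma>" if "\<sigma> \<in> Good" for \<sigma> using top[OF that that] by simp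
  have "(\<Sum>\<sigma>\<in>Good. e \<sigma>) = (\<Sum>\<sigma>\<in>Good. dens (bumps xs (tab \<sigma>)) - dens (tab \<sigma>))"
    unfolding e_def by (intro sum.cong) (auto simp: Good_def dens_tab)
  also have "\<dots> = (\<Sum>k\<in>{k \<in> V. near r k}. wt k * (dens (bumps xs k) - dens k))"
    unfolding Good_def by (rule class_sum[where Q = "near r" and h = "\<lambda>k. dens (bumps xs k) - dens k"])
  also have "\<dots> \<le> real (length xs) * (1 + \<theta>) ^ length xs * G" by (rule shift_bound[OF cnt mem])
  finally have e_sum: "(\<Sum>\<sigma>\<in>Good. e \<sigma>) \<le> real (L * ((K - 1) * (K - 1))) * (1 + \<theta>) ^ (L * ((K - 1) * (K - 1))) * G"
    unfolding len .

  define ge where "ge = (\<lambda>\<sigma>. if \<sigma> \<in> Good then e \<sigma> else 0)"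
  define bd where "bd = (\<lambda>\<sigma>. if \<sigma> \<in> Bad then 1 else 0 :: real)"
  \<comment> \<open>If both permutations are typical, one of the two gains bounds the difference;
    otherwise the sum of the densities does, and it is charged to an atypical one.\<close>
  have pt: "\<bar>\<rho> \<sigma> - \<rho> \<tau>\<bar> \<le> ge \<sigma> + ge \<tau> + (bd \<sigma> + bd \<tau>) * (\<rho> \<sigma> + \<rho> \<tau>)" if "\<sigma> \<in> ?S" "\<tau> \<in> ?S" for \<sigma> \<tau>
  proof (cases "\<sigma> \<in> Good \<and> \<tau> \<in> Good")
    case True
    then have "\<sigma> \<notin> Bad" "\<tau> \<notin> Bad" by (auto simp: Good_def Bad_def)
    then show ?thesis using True top[of \<sigma> \<tau>] top[of \<tau> \<sigma>] e_nonneg[of \<sigma>] e_nonneg[of \<tau>] by (auto simp: ge_def bd_def)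
  next
    case False
    then have "\<sigma> \<in> Bad \<or> \<tau> \<in> Bad" using that by (auto simp: Good_def Bad_def)
    then have one: "1 \<le> bd \<sigma> + bd \<tau>" by (auto simp: bd_def)
    have "\<bar>\<rho> \<sigma> - \<rho> \<tau>\<bar> \<le> 1 * (\<rho> \<sigma> + \<rho> \<tau>)" using \<rho>_nonneg[OF that(1)] \<rho>_nonneg[OF that(2)] by simp
    also have "\<dots> \<le> (bd \<sigma> + bd \<tau>) * (\<rho> \<sigma> + \<rho> \<tau>)"
      using \<rho>_nonneg that by (intro mult_right_mono[OF one] add_nonneg_nonneg) auto
    also have "\<dots> \<le> ge \<sigma> + ge \<tau> + (bd \<sigma> + bd \<tau>) * (\<rho> \<sigma> + \<rho> \<tau>)"
      using e_nonneg by (simp add: ge_def)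
    finally show ?thesis .
  qed
  have ge_sum: "(\<Sum>\<sigma>\<in>?S. ge \<sigma>) = (\<Sum>\<sigma>\<in>Good. e \<sigma>)"
    unfolding ge_def using fin by (simp add: sum.If_cases Int_absorb1 inf.absorb2)
  have "?F * (\<Sum>\<sigma>\<in>?S. \<bar>\<rho> \<sigma> - 1 / ?F\<bar>) = (\<Sum>\<sigma>\<in>?S. \<bar>\<Sum>\<tau>\<in>?S. \<rho> \<sigma> - \<rho> \<tau>\<bar>)"
    unfolding sum_distrib_left
  proof (rule sum.cong[OF refl])
    fix \<sigma>
    have "(\<Sum>\<tau>\<in>?S. \<rho> \<sigma> - \<rho> \<tau>) = ?F * (\<rho> \<sigma> - 1 / ?F)"
      using F by (simp only: sum_subtractf sum_constant \<rho>_sum) (simp add: right_diff_distrib)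
    then show "?F * \<bar>\<rho> \<sigma> - 1 / ?F\<bar> = \<bar>\<Sum>\<tau>\<in>?S. \<rho> \<sigma> - \<rho> \<tau>\<bar>" by (simp add: abs_mult)
  qed
  also have "\<dots> \<le> (\<Sum>\<sigma>\<in>?S. \<Sum>\<tau>\<in>?S. \<bar>\<rho> \<sigma> - \<rho> \<tau>\<bar>)" by (intro sum_mono sum_abs)
  also have "\<dots> \<le> (\<Sum>\<sigma>\<in>?S. \<Sum>\<tau>\<in>?S. ge \<sigma> + ge \<tau> + (bd \<sigma> + bd \<tau>) * (\<rho> \<sigma> + \<rho> \<tau>))" by (intro sum_mono pt)
  also have "\<dots> = ?F * (2 * (\<Sum>\<sigma>\<in>?S. ge \<sigma>) + 2 * (\<Sum>\<sigma>\<in>?S. bd \<sigma> * \<rho> \<sigma>)) + 2 * (\<Sum>\<sigma>\<in>?S. bd \<sigma>)"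
  proof -
    have "(\<Sum>\<tau>\<in>?S. ge \<sigma> + ge \<tau> + (bd \<sigma> + bd \<tau>) * (\<rho> \<sigma> + \<rho> \<tau>)) =
       ?F * ge \<sigma> + (\<Sum>\<tau>\<in>?S. ge \<tau>) + (?F * (bd \<sigma> * \<rho> \<sigma>) + bd \<sigma> + \<rho> \<sigma> * (\<Sum>\<tau>\<in>?S. bd \<tau>) + (\<Sum>\<tau>\<in>?S. bd \<tau> * \<rho> \<tau>))" for \<sigma>
    proof -
      have "(\<Sum>\<tau>\<in>?S. ge \<sigma> + ge \<tau> + (bd \<sigma> + bd \<tau>) * (\<rho> \<sigma> + \<rho> \<tau>)) =
        (\<Sum>\<tau>\<in>?S. (ge \<sigma> + bd \<sigma> * \<rho> \<sigma>) + ge \<tau> + bd \<sigma> * \<rho> \<tau> + \<rho> \<sigma> * bd \<tau> + bd \<tau> * \<rho> \<tau>)"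
        by (intro sum.cong refl) (simp add: algebra_simps)
      then show ?thesis
        unfolding sum.distrib sum_distrib_left[symmetric] \<rho>_sum sum_constant F(2) by (simp add: algebra_simps)
    qed
    then show ?thesis
      unfolding sum.distrib sum_distrib_left[symmetric] sum_distrib_right[symmetric] \<rho>_sum sum_constant F(2)
      by (simp add: sum.distrib sum_distrib_left[symmetric] sum_distrib_right[symmetric] \<rho>_sum F(2) algebra_simps)
  qed
  finally have main: "(\<Sum>\<sigma>\<in>?S. \<bar>\<rho> \<sigma> - 1 / ?F\<bar>) \<le> 2 * (\<Sum>\<sigma>\<in>Good. e \<sigma>) + 2 * (\<Sum>\<sigma>\<in>?S. bd \<sigma> * \<rho> \<sigma>) + 2 * ((\<Sum>\<sigma>\<in>?S. bd \<sigma>) / ?F)"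
    using F(1) unfolding ge_sum by (simp add: field_simps)
  have bd: "bd \<sigma> \<le> (\<Sum>(i, j)\<in>{..<K} \<times> {..<K}. \<bar>dev i j \<sigma>\<bar> / r)" if "\<sigma> \<in> ?S" for \<sigma>
  proof (cases "\<sigma> \<in> Bad")
    case True
    then obtain i j where ij: "\<bar>of_int (tab \<sigma> i j) - ctr i j\<bar> > r" by (auto simp: Bad_def near_def not_le)
    then have d: "\<bar>dev i j \<sigma>\<bar> > r" unfolding tab_dev .
    then have "i < K \<and> j < K" using dev_boundary[OF that, of i j] r(1) by fastforce
    then have "\<bar>dev i j \<sigma>\<bar> / r \<le> (\<Sum>p\<in>{..<K} \<times> {..<K}. case p of (i, j) \<Rightarrow> \<bar>dev i j \<sigma>\<bar> / r)"
      using member_le_sum[of "(i, j)" "{..<K} \<times> {..<K}" "\<lambda>p. case p of (i, j) \<Rightarrow> \<bar>dev i j \<sigma>\<bar> / r"] r(1) by auto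
    moreover have "1 \<le> \<bar>dev i j \<sigma>\<bar> / r" using d r(1) by simp
    ultimately show ?thesis using True by (simp add: bd_def)
  next
    case False
    then show ?thesis using r(1) by (auto simp: bd_def intro!: sum_nonneg)
  qed
  have "(\<Sum>\<sigma>\<in>?S. bd \<sigma> * \<rho> \<sigma>) \<le> (\<Sum>\<sigma>\<in>?S. (\<Sum>(i, j)\<in>{..<K} \<times> {..<K}. \<bar>dev i j \<sigma>\<bar> / r) * \<rho> \<sigma>)"
    by (intro sum_mono mult_right_mono bd \<rho>_nonneg)
  also have "\<dots> = (\<Sum>p\<in>{..<K} \<times> {..<K}. (\<Sum>\<sigma>\<in>?S. \<rho> \<sigma> * \<bar>dev (fst p) (snd p) \<sigma>\<bar>) / r)"
    unfolding sum_distrib_right sum_divide_distrib by (subst sum.swap) (simp add: case_prod_beta mult.commute)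
  also have "\<dots> \<le> (\<Sum>p\<in>{..<K} \<times> {..<K}. (sqrt (real N) + \<eta>) / r)"
    using r(1) by (intro sum_mono divide_right_mono rho_abs_dev) auto
  finally have b1: "(\<Sum>\<sigma>\<in>?S. bd \<sigma> * \<rho> \<sigma>) \<le> real K * real K * ((sqrt (real N) + \<eta>) / r)" by simp
  have "(\<Sum>\<sigma>\<in>?S. bd \<sigma>) \<le> (\<Sum>\<sigma>\<in>?S. \<Sum>(i, j)\<in>{..<K} \<times> {..<K}. \<bar>dev i j \<sigma>\<bar> / r)"
    by (intro sum_mono bd)
  also have "\<dots> = (\<Sum>p\<in>{..<K} \<times> {..<K}. (\<Sum>\<sigma>\<in>?S. \<bar>dev (fst p) (snd p) \<sigma>\<bar>) / r)"
    unfolding sum_divide_distrib by (subst sum.swap) (simp add: case_prod_beta)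
  finally have "(\<Sum>\<sigma>\<in>?S. bd \<sigma>) / ?F \<le> (\<Sum>p\<in>{..<K} \<times> {..<K}. (\<Sum>\<sigma>\<in>?S. \<bar>dev (fst p) (snd p) \<sigma>\<bar>) / r) / ?F"
    using F(1) by (intro divide_right_mono) auto
  also have "\<dots> = (\<Sum>p\<in>{..<K} \<times> {..<K}. ((\<Sum>\<sigma>\<in>?S. \<bar>dev (fst p) (snd p) \<sigma>\<bar>) / ?F) / r)"
    by (subst sum_divide_distrib, intro sum.cong refl) (simp add: mult.commute)
  also have "\<dots> \<le> (\<Sum>p\<in>{..<K} \<times> {..<K}. sqrt (real N) / r)"
    using r(1) by (intro sum_mono divide_right_mono uniform_abs_dev) auto
  finally have b2: "(\<Sum>\<sigma>\<in>?S. bd \<sigma>) / ?F \<le> real K * real K * (sqrt (real N) / r)" by simp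
  have "real K * real K * ((sqrt (real N) + \<eta>) / r) + real K * real K * (sqrt (real N) / r)
     = real K * real K * (2 * sqrt (real N) + \<eta>) / r"
    by (simp add: algebra_simps add_divide_distrib)
  then show ?thesis using main b1 b2 e_sum by linarith
qed

end

section \<open>Heat equation and spectral gap\<close>

text \<open>On the first half concavity puts the sine above its chord of slope 2; the second half
  follows by reflection. The parabola is the shape that bounds the initial height excess.\<close>

lemma sin_pi_ge:
  assumes "0 \<le> z" "z \<le> 1"
  shows "z * (1 - z) \<le> sin (pi * z)"
proof -
  have *: "2 * w \<le> sin (pi * w)" if "0 \<le> w" "w \<le> 1 / 2" for w :: real
  proof -
    have "concave_on {0..pi / 2} (sin :: real \<Rightarrow> real)"
    proof (rule f''_le0_imp_concave)
      show "convex {0..pi / 2}" by simp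
      show "(sin has_real_derivative cos x) (at x)" for x :: real by (rule DERIV_sin)
      show "(cos has_real_derivative - sin x) (at x)" for x :: real by (rule DERIV_cos)
      show "- sin x \<le> 0" if "x \<in> {0..pi / 2}" for x using that by (simp add: sin_ge_zero)
    qed
    from concave_onD_Icc[OF this, of "2 * w"] that show ?thesis by (simp add: mult.commute)
  qed
  show ?thesis
  proof (cases "z \<le> 1 / 2")
    case True
    have "z * (1 - z) \<le> z * 2" using assms by (intro mult_left_mono) auto
    then show ?thesis using *[of z] True assms by simp
  next
    case False
    have "z * (1 - z) \<le> 1 * (1 - z)" using assms by (intro mult_right_mono) auto
    moreover have "sin (pi * (1 - z)) = sin (pi * z)" by (simp add: right_diff_distrib sin_diff)
    ultimately show ?thesis using *[of "1 - z"] False assms by simp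
  qed
qed

text \<open>A given position is drawn with probability 1 / (N - 1), and 1 - cos (pi / N) is the
  lowest Dirichlet eigenvalue of the averaging Laplacian on {0..N}.\<close>

definition gap :: "nat \<Rightarrow> real" where
  "gap N = (1 - cos (pi / real N)) / real (N - 1)"

definition wave :: "nat \<Rightarrow> nat \<Rightarrow> real" where
  "wave N x = sin (pi * (real x / real N))"

lemma gap_bounds:
  assumes "N \<ge> 3"
  shows "0 < gap N" "gap N \<le> 1 / 2"
proof -
  have N: "real (N - 1) \<ge> 2" using assms by simp
  have b: "0 < pi / real N" "pi / real N \<le> pi / 2"
    using assms by simp (rule divide_left_mono, use assms in auto)
  have "cos (pi / real N) < cos 0" by (rule cos_monotone_0_pi) (use b pi_gt_zero in linarith)+
  moreover have "0 \<le> cos (pi / real N)" by (rule cos_ge_zero) (use b pi_gt_zero in linarith)+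
  ultimately show "0 < gap N" "gap N \<le> 1 / 2" unfolding gap_def using N by (auto simp: divide_le_eq)
qed

lemma wave_0 [simp]: "wave N 0 = 0" by (simp add: wave_def)

lemma wave_N [simp]: "N \<ge> 1 \<Longrightarrow> wave N N = 0" by (simp add: wave_def)

lemma wave_bounds: "x \<le> N \<Longrightarrow> 0 \<le> wave N x" "wave N x \<le> 1"
proof -
  assume "x \<le> N"
  then have "0 \<le> real x / real N" "real x / real N \<le> 1" by (auto simp: divide_le_eq)
  then have "0 \<le> pi * (real x / real N)" "pi * (real x / real N) \<le> pi * 1"
    using pi_ge_zero by (blast intro: mult_left_mono mult_nonneg_nonneg)+
  then show "0 \<le> wave N x" unfolding wave_def by (intro sin_ge_zero) auto
qed (simp add: wave_def)

lemma wave_eigen: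
  assumes "x \<ge> 1" "N \<ge> 1"
  shows "wave N (x - 1) + wave N (Suc x) = 2 * cos (pi / real N) * wave N x"
proof -
  have "pi * (real (x - 1) / real N) = pi * (real x / real N) - pi / real N"
       "pi * (real (Suc x) / real N) = pi * (real x / real N) + pi / real N"
    using assms by (auto simp: field_simps of_nat_diff)
  then show ?thesis unfolding wave_def by (simp add: sin_diff sin_add)
qed

lemma wave_ge:
  assumes "x \<le> N" "N \<ge> 1"
  shows "real x / real N * (1 - real x / real N) \<le> wave N x"
  unfolding wave_def using assms by (intro sin_pi_ge) auto

lemma min_minus_mean_le:
  assumes "x \<le> N" "y \<le> N" "N \<ge> 1"
  shows "real (min x y) - real x * real y / real N \<le> real N * (real x / real N * (1 - real x / real N))"
proof -
  have N: "real N > 0" using assms by simp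
  have eq: "real N * (real x / real N * (1 - real x / real N)) = real x * (real N - real x) / real N"
    using N by (simp add: field_simps)
  have "real (min x y) * real N - real x * real y \<le> real x * (real N - real x)"
  proof (cases "x \<le> y")
    case True
    then have "real x * real x \<le> real x * real y" by (intro mult_left_mono) auto
    then show ?thesis using True by (simp add: min_def algebra_simps)
  next
    case False
    then have "0 \<le> (real x - real y) * (real N - real x)" using assms by (intro mult_nonneg_nonneg) auto
    then show ?thesis using False by (simp add: min_def algebra_simps)
  qed
  then have "(real (min x y) * real N - real x * real y) / real N \<le> real x * (real N - real x) / real N"
    by (rule divide_right_mono) simp
  then show ?thesis unfolding eq using N by (simp add: diff_divide_distrib)
qed

text \<open>The profile x y / N is harmonic in x, so the excess over it solves the heat equation
  with zero boundary values. With z = x / N the initial excess is at most N z (1 - z), hence at most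
  N times the sine wave, an exact eigenfunction.\<close>

lemma main_heat:
  assumes "N \<ge> 3" "x \<le> N" "y \<le> N"
  shows "(avg_op N UNIV ^^ t) (\<lambda>\<sigma>. real (ht \<sigma> x y)) id - real x * real y / real N \<le> real N * (1 - gap N) ^ t"
proof -
  have N: "N \<ge> 2" "N \<ge> 1" using assms by auto
  let ?\<kappa> = "1 - cos (pi / real N)" let ?\<alpha> = "1 / real (N - 1)"
  have gap: "?\<alpha> * ?\<kappa> = gap N" unfolding gap_def by simp
  define D where "D = (\<lambda>s x. (avg_op N UNIV ^^ s) (\<lambda>\<sigma>. real (ht \<sigma> x y)) id - real x * real y / real N)"
  have "D t x \<le> real N * (1 - ?\<alpha> * ?\<kappa>) ^ t * wave N x"
  proof (rule heat_supersolution[where N = N and X = UNIV])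
    show "D (Suc s) x = D s x + ?\<alpha> * ((D s (x - 1) + D s (x + 1)) / 2 - D s x)"
      if "x \<in> {1..N - 1}" "x \<in> UNIV" for s x
    proof -
      have "real (x - 1) = real x - 1" using that by (simp add: of_nat_diff)
      then have "real (x - 1) * real y + real (x + 1) * real y = 2 * (real x * real y)" by (simp add: algebra_simps)
      then have lin: "(real (x - 1) * real y / real N + real (x + 1) * real y / real N) / 2 = real x * real y / real N"
        unfolding add_divide_distrib[symmetric] by simp
      define h where "h = (\<lambda>x. (avg_op N UNIV ^^ s) (\<lambda>\<sigma>. real (ht \<sigma> x y)) id)"
      define m where "m = (\<lambda>x. real x * real y / real N)"
      have "(m (x - 1) + m (x + 1)) / 2 = m x" using lin by (simp only: m_def)
      moreover have Ds: "D s z = h z - m z" for z by (simp add: D_def h_def m_def)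
      ultimately have lap: "(D s (x - 1) + D s (x + 1)) / 2 - D s x = (h (x - 1) + h (x + 1)) / 2 - h x"
        unfolding Ds by argo
      have "D (Suc s) x = h x + ((h (x - 1) + h (x + 1)) / 2 - h x) / real (N - 1) - m x"
        unfolding D_def avg_op_funpow_ht_Suc[OF N(1) that] h_def m_def ..
      then show ?thesis unfolding lap unfolding Ds[of x] by simp
    qed
    show "D s x \<le> 0" if "x = 0 \<or> x = N \<or> x \<notin> UNIV" for s x
    proof -
      have fx: "(avg_op N UNIV ^^ s) (\<lambda>\<sigma>. real (ht \<sigma> x y)) = (\<lambda>\<sigma>. real (ht \<sigma> x y))"
        by (rule avg_op_funpow_ht_fixed[OF N(1)]) (use that in auto)
      show ?thesis unfolding D_def fx using that ht_full[OF id_in_sym_grp assms(3)] N by auto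
    qed
    show "(wave N (x - 1) + wave N (x + 1)) / 2 - wave N x \<le> - ?\<kappa> * wave N x" if "x \<in> {1..N - 1}" "x \<in> UNIV" for x
      using wave_eigen[of x N] that N by (simp add: algebra_simps)
    show "D 0 x \<le> real N * wave N x" if "x \<le> N" for x
    proof -
      have "D 0 x \<le> real N * (real x / real N * (1 - real x / real N))"
        using min_minus_mean_le[OF that assms(3) N(2)] by (simp add: D_def ht_id)
      also have "\<dots> \<le> real N * wave N x" using wave_ge[OF that N(2)] by (intro mult_left_mono) auto
      finally show ?thesis .
    qed
    show "?\<alpha> \<le> 1" using assms by simp
    show "?\<alpha> * ?\<kappa> \<le> 1" unfolding gap using gap_bounds[OF assms(1)] by simp
  qed (use wave_bounds assms in auto)
  also have "\<dots> \<le> real N * (1 - gap N) ^ t * 1"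
    unfolding gap using gap_bounds[OF assms(1)] wave_bounds(2) by (intro mult_left_mono) auto
  finally show ?thesis unfolding D_def by simp
qed

section \<open>Wilson's lower bound\<close>

definition wilson :: "nat \<Rightarrow> nat \<Rightarrow> (nat \<Rightarrow> nat) \<Rightarrow> real" where
  "wilson N y \<sigma> = (\<Sum>x<N. wave N x * (real (ht \<sigma> x y) - real x * real y / real N))"

lemma wilson_eigen:
  assumes "N \<ge> 3" "y \<le> N" "\<sigma> \<in> sym_grp N"
  shows "avg_op N UNIV (wilson N y) \<sigma> = (1 - gap N) * wilson N y \<sigma>"
proof -
  have N: "N \<ge> 2" "N \<ge> 1" using assms by auto
  note M = markov_avg_op[OF N(1), of UNIV]
  define h where "h = (\<lambda>x. real (ht \<sigma> x y) - real x * real y / real N)"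
  have h0: "h 0 = 0" "h N = 0" using ht_full[OF assms(3,2)] N by (auto simp: h_def)
  obtain m where m: "N = Suc m" using N by (cases N) auto
  \<comment> \<open>Summation by parts. There are no boundary terms, since \<open>wave N\<close> and
    \<open>h\<close> both vanish at 0 and \<open>N\<close>; this also neutralises the truncated
    index \<open>x - 1\<close> at \<open>x = 0\<close>.\<close>
  have shift1: "(\<Sum>x<N. wave N x * h (x - 1)) = (\<Sum>x<N. wave N (Suc x) * h x)"
  proof -
    have "(\<Sum>x<Suc m. wave N x * h (x - 1)) = (\<Sum>x<m. wave N (Suc x) * h x)"
      by (subst sum.lessThan_Suc_shift) simp
    moreover have "(\<Sum>x<Suc m. wave N (Suc x) * h x) = (\<Sum>x<m. wave N (Suc x) * h x)"
      using wave_N[OF N(2)] m by simp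
    ultimately show ?thesis unfolding m[symmetric] by simp
  qed
  have shift2: "(\<Sum>x<N. wave N x * h (Suc x)) = (\<Sum>x<N. wave N (x - 1) * h x)"
  proof -
    have "(\<Sum>x<Suc m. wave N (x - 1) * h x) = (\<Sum>x<m. wave N x * h (Suc x))"
      by (subst sum.lessThan_Suc_shift) (simp add: h0)
    moreover have "(\<Sum>x<Suc m. wave N x * h (Suc x)) = (\<Sum>x<m. wave N x * h (Suc x))"
      using h0 m by simp
    ultimately show ?thesis unfolding m[symmetric] by simp
  qed
  have "(\<Sum>x<N. wave N x * ((h (x - 1) + h (Suc x)) / 2)) = ((\<Sum>x<N. wave N x * h (x - 1)) + (\<Sum>x<N. wave N x * h (Suc x))) / 2"
    by (simp add: sum.distrib[symmetric] sum_divide_distrib ring_distribs add_divide_distrib)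
  also have "\<dots> = (\<Sum>x<N. (wave N (x - 1) + wave N (Suc x)) * h x) / 2"
    unfolding shift1 shift2 by (simp add: sum.distrib[symmetric] ring_distribs add.commute)
  also have "(\<Sum>x<N. (wave N (x - 1) + wave N (Suc x)) * h x) = (\<Sum>x<N. 2 * cos (pi / real N) * (wave N x * h x))"
  proof (rule sum.cong[OF refl])
    fix x show "(wave N (x - 1) + wave N (Suc x)) * h x = 2 * cos (pi / real N) * (wave N x * h x)"
      using wave_eigen[of x N] h0 N by (cases "x = 0") auto
  qed
  finally have lap: "(\<Sum>x<N. wave N x * ((h (x - 1) + h (Suc x)) / 2)) = cos (pi / real N) * (\<Sum>x<N. wave N x * h x)"
    by (simp add: sum_distrib_left[symmetric])
  have one: "avg_op N UNIV (\<lambda>\<sigma>. wave N x * (real (ht \<sigma> x y) - real x * real y / real N)) \<sigma>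
     = wave N x * (h x + ((h (x - 1) + h (Suc x)) / 2 - h x) / real (N - 1))" if "x < N" for x
  proof (cases "x = 0")
    case True
    then show ?thesis using markov_const[OF M, of 0] by simp
  next
    case False
    then have x: "x \<in> {1..N - 1}" using that by auto
    have "real (x - 1) = real x - 1" using x by (simp add: of_nat_diff)
    then have mm: "(h (x - 1) + h (Suc x)) / 2 - h x = (real (ht \<sigma> (x - 1) y) + real (ht \<sigma> (x + 1) y)) / 2 - real (ht \<sigma> x y)"
      unfolding h_def using N by (simp add: field_simps)
    have "avg_op N UNIV (\<lambda>\<sigma>. wave N x * (real (ht \<sigma> x y) - real x * real y / real N)) \<sigma>
      = wave N x * (avg_op N UNIV (\<lambda>\<sigma>. real (ht \<sigma> x y)) \<sigma> - real x * real y / real N)"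
      unfolding markov_scale[OF M] markov_diff[OF M] markov_const[OF M] ..
    also have "\<dots> = wave N x * (h x + ((h (x - 1) + h (Suc x)) / 2 - h x) / real (N - 1))"
      unfolding avg_op_ht[OF N(1) x] mm by (simp add: h_def)
    finally show ?thesis .
  qed
  have "avg_op N UNIV (wilson N y) \<sigma> = (\<Sum>x<N. avg_op N UNIV (\<lambda>\<sigma>. wave N x * (real (ht \<sigma> x y) - real x * real y / real N)) \<sigma>)"
    unfolding wilson_def[abs_def] by (subst markov_sum[OF M]) simp_all
  also have "\<dots> = (\<Sum>x<N. wave N x * (h x + ((h (x - 1) + h (Suc x)) / 2 - h x) / real (N - 1)))"
    by (intro sum.cong refl one) auto
  also have "\<dots> = (\<Sum>x<N. wave N x * h x) + ((\<Sum>x<N. wave N x * ((h (x - 1) + h (Suc x)) / 2)) - (\<Sum>x<N. wave N x * h x)) / real (N - 1)"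
    unfolding sum_subtractf[symmetric] sum_divide_distrib sum.distrib[symmetric]
    by (intro sum.cong refl) (simp add: ring_distribs diff_divide_distrib del: of_nat_diff)
  also have "\<dots> = (1 - gap N) * (\<Sum>x<N. wave N x * h x)"
    unfolding lap gap_def by (simp add: left_diff_distrib diff_divide_distrib del: of_nat_diff)
  finally show ?thesis by (simp add: wilson_def h_def)
qed

lemma wilson_increment:
  assumes "N \<ge> 1" "x \<in> {1..N - 1}"
  shows "\<bar>wilson N y (\<sigma> \<circ> adj_transp x) - wilson N y \<sigma>\<bar> \<le> 1"
proof -
  let ?\<tau> = "\<sigma> \<circ> adj_transp x"
  have x: "x \<ge> 1" "x < N" using assms by auto
  have "wilson N y ?\<tau> - wilson N y \<sigma> = (\<Sum>x'<N. wave N x' * (real (ht ?\<tau> x' y) - real (ht \<sigma> x' y)))"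
    unfolding wilson_def sum_subtractf[symmetric] by (intro sum.cong refl) (simp add: algebra_simps)
  also have "\<dots> = (\<Sum>x'\<in>{x}. wave N x' * (real (ht ?\<tau> x' y) - real (ht \<sigma> x' y)))"
    by (rule sum.mono_neutral_right) (use x ht_adj_transp_other[OF x(1)] in auto)
  finally have "\<bar>wilson N y ?\<tau> - wilson N y \<sigma>\<bar> = \<bar>wave N x\<bar> * \<bar>real (ht ?\<tau> x y) - real (ht \<sigma> x y)\<bar>"
    by (simp add: abs_mult)
  also have "\<dots> \<le> 1 * 1"
    using wave_bounds(1)[of x N] wave_bounds(2)[of N x] x ht_adj_transp_same[OF x(1), of \<sigma> y] ht_pred[OF x(1), of \<sigma> y]
    by (intro mult_mono) auto
  finally show ?thesis by simp
qed

text \<open>One update changes the function by at most 1, and the cross term reproduces the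
  eigenvalue equation; so the square contracts at rate 2 \<open>gap N\<close> up to a bounded
  source.\<close>

lemma wilson_square:
  assumes "N \<ge> 3" "y \<le> N" "\<sigma> \<in> sym_grp N"
  shows "avg_op N UNIV (\<lambda>\<sigma>. (wilson N y \<sigma>)\<^sup>2) \<sigma> \<le> (1 - 2 * gap N) * (wilson N y \<sigma>)\<^sup>2 + 1"
proof -
  let ?f = "wilson N y" let ?n = "real (N - 1)"
  have N: "N \<ge> 1" "?n > 0" using assms by auto
  have "lazy x (\<lambda>\<sigma>. (?f \<sigma>)\<^sup>2) \<sigma> \<le> (?f \<sigma>)\<^sup>2 + 2 * ?f \<sigma> * (lazy x ?f \<sigma> - ?f \<sigma>) + 1" if x: "x \<in> {1..N - 1}" for x
  proof -
    let ?g = "?f (\<sigma> \<circ> adj_transp x)"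
    have "(?g - ?f \<sigma>)\<^sup>2 \<le> 1\<^sup>2" using wilson_increment[OF N(1) x, of y \<sigma>] by (subst abs_le_square_iff[symmetric]) simp
    moreover have "lazy x (\<lambda>\<sigma>. (?f \<sigma>)\<^sup>2) \<sigma> = (?f \<sigma>)\<^sup>2 + 2 * ?f \<sigma> * (lazy x ?f \<sigma> - ?f \<sigma>) + (?g - ?f \<sigma>)\<^sup>2 / 2"
      by (simp add: lazy_def power2_eq_square field_simps)
    ultimately show ?thesis by simp
  qed
  then have "avg_op N UNIV (\<lambda>\<sigma>. (?f \<sigma>)\<^sup>2) \<sigma> \<le> (\<Sum>x\<in>{1..N - 1}. (?f \<sigma>)\<^sup>2 + 2 * ?f \<sigma> * (lazy x ?f \<sigma> - ?f \<sigma>) + 1) / ?n"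
    unfolding avg_op_def by (intro divide_right_mono sum_mono) auto
  also have "(\<Sum>x\<in>{1..N - 1}. (?f \<sigma>)\<^sup>2 + 2 * ?f \<sigma> * (lazy x ?f \<sigma> - ?f \<sigma>) + 1)
     = ?n * ((?f \<sigma>)\<^sup>2 + 1) + 2 * ?f \<sigma> * ((\<Sum>x\<in>{1..N - 1}. lazy x ?f \<sigma>) - ?n * ?f \<sigma>)"
    by (simp add: sum.distrib sum_subtractf sum_distrib_left[symmetric] algebra_simps del: of_nat_diff)
  also have "\<dots> / ?n = (?f \<sigma>)\<^sup>2 + 1 + 2 * ?f \<sigma> * (avg_op N UNIV ?f \<sigma> - ?f \<sigma>)"
    unfolding avg_op_def using N(2) by (simp add: field_simps del: of_nat_diff)
  also have "\<dots> = (1 - 2 * gap N) * (?f \<sigma>)\<^sup>2 + 1"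
    unfolding wilson_eigen[OF assms] by (simp add: power2_eq_square algebra_simps)
  finally show ?thesis .
qed

lemma wilson_mean:
  assumes "N \<ge> 3" "y \<le> N"
  shows "\<sigma> \<in> sym_grp N \<Longrightarrow> (avg_op N UNIV ^^ n) (wilson N y) \<sigma> = (1 - gap N) ^ n * wilson N y \<sigma>"
proof (induction n arbitrary: \<sigma>)
  case (Suc n)
  have N: "N \<ge> 2" using assms by auto
  note M = markov_funpow[OF markov_avg_op[OF N], of n UNIV]
  have "(avg_op N UNIV ^^ Suc n) (wilson N y) \<sigma> = (avg_op N UNIV ^^ n) (avg_op N UNIV (wilson N y)) \<sigma>"
    by (simp add: funpow_swap1)
  also have "\<dots> = (avg_op N UNIV ^^ n) (\<lambda>\<sigma>. (1 - gap N) * wilson N y \<sigma>) \<sigma>"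
    by (intro antisym markov_mono[OF M _ Suc.prems]) (simp_all add: wilson_eigen[OF assms])
  also have "\<dots> = (1 - gap N) ^ Suc n * wilson N y \<sigma>"
    unfolding markov_scale[OF M] Suc.IH[OF Suc.prems] by simp
  finally show ?case .
qed simp

text \<open>The constant 1 / (2 \<open>gap N\<close>) is the fixed point of v = (1 - 2
  \<open>gap N\<close>) v + 1, the recursion that \<open>wilson_square\<close> provides.\<close>

lemma wilson_second_moment:
  assumes "N \<ge> 3" "y \<le> N"
  shows "\<sigma> \<in> sym_grp N \<Longrightarrow> (avg_op N UNIV ^^ n) (\<lambda>\<sigma>. (wilson N y \<sigma>)\<^sup>2) \<sigma>
     \<le> (1 - 2 * gap N) ^ n * (wilson N y \<sigma>)\<^sup>2 + 1 / (2 * gap N)"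
proof (induction n arbitrary: \<sigma>)
  case 0
  then show ?case using gap_bounds[OF assms(1)] by simp
next
  case (Suc n)
  have N: "N \<ge> 2" using assms by auto
  note M = markov_funpow[OF markov_avg_op[OF N], of n UNIV]
  note g = gap_bounds[OF assms(1)]
  let ?f = "\<lambda>\<sigma>. (wilson N y \<sigma>)\<^sup>2"
  have "(avg_op N UNIV ^^ Suc n) ?f \<sigma> = (avg_op N UNIV ^^ n) (avg_op N UNIV ?f) \<sigma>"
    by (simp add: funpow_swap1)
  also have "\<dots> \<le> (avg_op N UNIV ^^ n) (\<lambda>\<sigma>. (1 - 2 * gap N) * ?f \<sigma> + 1 * 1) \<sigma>"
    by (intro markov_mono[OF M _ Suc.prems]) (simp add: wilson_square[OF assms])
  also have "\<dots> = (1 - 2 * gap N) * (avg_op N UNIV ^^ n) ?f \<sigma> + 1"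
    by (subst markov_linear[OF M]) (simp add: markov_const[OF M])
  also have "\<dots> \<le> (1 - 2 * gap N) * ((1 - 2 * gap N) ^ n * ?f \<sigma> + 1 / (2 * gap N)) + 1"
    using g by (intro add_right_mono mult_left_mono Suc.IH[OF Suc.prems]) auto
  also have "\<dots> = (1 - 2 * gap N) ^ Suc n * ?f \<sigma> + 1 / (2 * gap N)"
    using g by (simp add: field_simps)
  finally show ?case .
qed

lemma wilson_uniform:
  assumes "N \<ge> 3" "y \<le> N"
  shows "(\<Sum>\<sigma>\<in>sym_grp N. (wilson N y \<sigma>)\<^sup>2) / fact N \<le> 1 / (2 * gap N)"
proof -
  let ?f = "\<lambda>\<sigma>. (wilson N y \<sigma>)\<^sup>2"
  have N: "N \<ge> 2" using assms by auto
  note g = gap_bounds[OF assms(1)]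
  have "(\<Sum>\<sigma>\<in>sym_grp N. ?f \<sigma>) = (\<Sum>\<sigma>\<in>sym_grp N. avg_op N UNIV ?f \<sigma>)"
    by (rule markov_sum_sym_grp[OF markov_avg_op[OF N], symmetric])
  also have "\<dots> \<le> (\<Sum>\<sigma>\<in>sym_grp N. (1 - 2 * gap N) * ?f \<sigma> + 1)" by (intro sum_mono wilson_square[OF assms])
  also have "\<dots> = (1 - 2 * gap N) * (\<Sum>\<sigma>\<in>sym_grp N. ?f \<sigma>) + fact N"
    by (simp add: sum.distrib sum_distrib_left card_sym_grp)
  finally have "2 * gap N * (\<Sum>\<sigma>\<in>sym_grp N. ?f \<sigma>) \<le> fact N" by (simp add: algebra_simps)
  then show ?thesis using g by (simp add: field_simps)
qed

lemma chebyshev_finite: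
  fixes p g :: "'a \<Rightarrow> real"
  assumes "finite S" "\<And>s. s \<in> S \<Longrightarrow> 0 \<le> p s" "c > 0" "A \<subseteq> S" "\<And>s. s \<in> A \<Longrightarrow> c \<le> \<bar>g s\<bar>"
  shows "(\<Sum>s\<in>A. p s) \<le> (\<Sum>s\<in>S. p s * (g s)\<^sup>2) / c\<^sup>2"
proof -
  have "(\<Sum>s\<in>A. p s) * c\<^sup>2 = (\<Sum>s\<in>A. p s * c\<^sup>2)" by (rule sum_distrib_right)
  also have "\<dots> \<le> (\<Sum>s\<in>A. p s * (g s)\<^sup>2)"
  proof (rule sum_mono)
    fix s assume s: "s \<in> A"
    have "c\<^sup>2 \<le> (g s)\<^sup>2" using assms(3) assms(5)[OF s] by (subst abs_le_square_iff[symmetric]) simp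
    then show "p s * c\<^sup>2 \<le> p s * (g s)\<^sup>2" using assms(2,4) s by (intro mult_left_mono) auto
  qed
  also have "\<dots> \<le> (\<Sum>s\<in>S. p s * (g s)\<^sup>2)" using assms by (intro sum_mono2) auto
  finally show ?thesis using assms(3) by (simp add: field_simps)
qed

text \<open>Chebyshev's inequality with threshold m / 2, halfway between 0 and the mean m at time n.
  The spread around 0 in equilibrium and around m at time n is at most 1 / (2 gap), so each law errs
  with probability at most 2 / (gap m^2).\<close>

lemma wilson_lower_bound:
  assumes "N \<ge> 3" "y \<le> N" "wilson N y id > 0"
  shows "1 - 4 / (gap N * ((1 - gap N) ^ n * wilson N y id)\<^sup>2)
    \<le> tv_dist (sym_grp N) (shuffle_law N n) (pmf_of_set (sym_grp N))"
proof -
  let ?S = "sym_grp N" let ?f = "wilson N y" let ?P = "avg_op N UNIV" let ?u = "1 / fact N :: real"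
  have N: "N \<ge> 2" using assms by auto
  note g = gap_bounds[OF assms(1)]
  note M = markov_funpow[OF markov_avg_op[OF N], of n UNIV]
  define p where "p = (?P ^^ n) dirac"
  have p: "pmf (shuffle_law N n) = p" unfolding p_def by (rule pmf_shuffle_law[OF N])
  have p0: "0 \<le> p \<sigma>" for \<sigma> using p pmf_nonneg by metis
  have E: "(\<Sum>\<sigma>\<in>?S. p \<sigma> * h \<sigma>) = (?P ^^ n) h id" for h
    unfolding p_def by (simp add: avg_op_funpow_adjoint sum_dirac)
  have p1: "(\<Sum>\<sigma>\<in>?S. p \<sigma>) = 1" using E[of "\<lambda>_. 1"] markov_const[OF M, of 1] by simp
  define m where "m = (1 - gap N) ^ n * ?f id"
  have m: "m > 0" unfolding m_def using g assms(3) by simp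
  define A where "A = {\<sigma> \<in> ?S. ?f \<sigma> \<ge> m / 2}"
  have "(\<Sum>\<sigma>\<in>?S. p \<sigma> * (?f \<sigma> - m)\<^sup>2) = (\<Sum>\<sigma>\<in>?S. p \<sigma> * (?f \<sigma>)\<^sup>2) - 2 * m * (\<Sum>\<sigma>\<in>?S. p \<sigma> * ?f \<sigma>) + m\<^sup>2 * (\<Sum>\<sigma>\<in>?S. p \<sigma>)"
    unfolding sum_distrib_left sum_subtractf[symmetric] sum.distrib[symmetric]
    by (intro sum.cong refl) (simp add: power2_eq_square algebra_simps)
  also have "\<dots> = (?P ^^ n) (\<lambda>\<sigma>. (?f \<sigma>)\<^sup>2) id - m\<^sup>2"
    unfolding E p1 wilson_mean[OF assms(1,2) id_in_sym_grp] m_def[symmetric] by (simp add: power2_eq_square)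
  also have "\<dots> \<le> 1 / (2 * gap N)"
  proof -
    \<comment> \<open>As 1 - 2 g \<le> (1 - g)^2, the transient part of the second moment is at most
      m^2 and cancels against the squared mean.\<close>
    have "(1 - 2 * gap N) ^ n \<le> ((1 - gap N)\<^sup>2) ^ n"
      using g by (intro power_mono) (auto simp: power2_eq_square algebra_simps)
    also have "\<dots> = ((1 - gap N) ^ n)\<^sup>2" by (simp add: power_mult[symmetric] mult.commute)
    finally have "(1 - 2 * gap N) ^ n * (?f id)\<^sup>2 \<le> m\<^sup>2"
      unfolding m_def power_mult_distrib by (intro mult_right_mono) auto
    then show ?thesis using wilson_second_moment[OF assms(1,2) id_in_sym_grp, of n] by linarith
  qed
  finally have var: "(\<Sum>\<sigma>\<in>?S. p \<sigma> * (?f \<sigma> - m)\<^sup>2) \<le> 1 / (2 * gap N)" .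
  have "(\<Sum>\<sigma>\<in>?S - A. p \<sigma>) \<le> (\<Sum>\<sigma>\<in>?S. p \<sigma> * (?f \<sigma> - m)\<^sup>2) / (m / 2)\<^sup>2"
    by (rule chebyshev_finite) (use p0 m in \<open>auto simp: A_def\<close>)
  also have "\<dots> \<le> (1 / (2 * gap N)) / (m / 2)\<^sup>2" by (intro divide_right_mono var) simp
  finally have pA: "(\<Sum>\<sigma>\<in>?S - A. p \<sigma>) \<le> 2 / (gap N * m\<^sup>2)" by (simp add: power2_eq_square field_simps)
  have "(\<Sum>\<sigma>\<in>A. ?u) \<le> (\<Sum>\<sigma>\<in>?S. ?u * (?f \<sigma>)\<^sup>2) / (m / 2)\<^sup>2"
    by (rule chebyshev_finite) (use m in \<open>auto simp: A_def\<close>)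
  also have "\<dots> \<le> (1 / (2 * gap N)) / (m / 2)\<^sup>2"
    using wilson_uniform[OF assms(1,2)] by (intro divide_right_mono) (simp_all add: sum_divide_distrib)
  finally have uA: "(\<Sum>\<sigma>\<in>A. ?u) \<le> 2 / (gap N * m\<^sup>2)" by (simp add: power2_eq_square field_simps)
  have AS: "A \<subseteq> ?S" by (auto simp: A_def)
  have "(\<Sum>\<sigma>\<in>?S. p \<sigma> - ?u) = 0" by (simp only: sum_subtractf p1) (simp add: card_sym_grp)
  then have z: "(\<Sum>\<sigma>\<in>A. p \<sigma> - ?u) = - (\<Sum>\<sigma>\<in>?S - A. p \<sigma> - ?u)"
    using sum.subset_diff[OF AS, of "\<lambda>\<sigma>. p \<sigma> - ?u"] by simp
  have "2 * (\<Sum>\<sigma>\<in>A. p \<sigma> - ?u) = (\<Sum>\<sigma>\<in>A. p \<sigma> - ?u) - (\<Sum>\<sigma>\<in>?S - A. p \<sigma> - ?u)" using z by simp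
  also have "\<dots> \<le> (\<Sum>\<sigma>\<in>A. \<bar>p \<sigma> - ?u\<bar>) + (\<Sum>\<sigma>\<in>?S - A. \<bar>p \<sigma> - ?u\<bar>)"
  proof -
    have "(\<Sum>\<sigma>\<in>A. p \<sigma> - ?u) \<le> (\<Sum>\<sigma>\<in>A. \<bar>p \<sigma> - ?u\<bar>)" by (intro sum_mono) simp
    moreover have "(\<Sum>\<sigma>\<in>?S - A. - (p \<sigma> - ?u)) \<le> (\<Sum>\<sigma>\<in>?S - A. \<bar>p \<sigma> - ?u\<bar>)" by (intro sum_mono) simp
    ultimately show ?thesis unfolding sum_negf by linarith
  qed
  also have "\<dots> = (\<Sum>\<sigma>\<in>?S. \<bar>p \<sigma> - ?u\<bar>)" using sum.subset_diff[OF AS, of "\<lambda>\<sigma>. \<bar>p \<sigma> - ?u\<bar>"] by simp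
  also have "\<dots> = 2 * tv_dist ?S (shuffle_law N n) (pmf_of_set ?S)"
    unfolding tv_dist_def p by (simp add: pmf_uniform_sym_grp)
  finally have tv: "(\<Sum>\<sigma>\<in>A. p \<sigma>) - (\<Sum>\<sigma>\<in>A. ?u) \<le> tv_dist ?S (shuffle_law N n) (pmf_of_set ?S)"
    unfolding sum_subtractf by (rule mult_left_le_imp_le) simp
  have "(\<Sum>\<sigma>\<in>A. p \<sigma>) = 1 - (\<Sum>\<sigma>\<in>?S - A. p \<sigma>)" using sum.subset_diff[OF AS, of p] p1 by simp
  moreover have "2 / (gap N * m\<^sup>2) + 2 / (gap N * m\<^sup>2) = 4 / (gap N * m\<^sup>2)" by simp
  ultimately show ?thesis using tv pA uA unfolding m_def by linarith
qed

section \<open>Asymptotics\<close>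

text \<open>At least N / 3 positions \<open>x\<close> away from the ends have wave at least 1 / 15
  and height excess at least N / 45; the product of 3, 15 and 45 is 2025, and all other terms are
  nonnegative.\<close>

lemma wilson_id_ge:
  assumes "N \<ge> 3"
  shows "real N ^ 2 / 2025 \<le> wilson N (N div 2) id"
proof -
  define m where "m = N div 3"
  define y where "y = N div 2"
  have N: "real N > 0" "N \<ge> 1" using assms by auto
  have m: "5 * m \<ge> N" "3 * m \<le> N" "3 * (m + 1) \<ge> N" unfolding m_def using assms by presburger+
  have y: "y \<le> N" "3 * y \<ge> N" "2 * y \<le> N" unfolding y_def using assms by presburger+
  let ?h = "\<lambda>x. real (min x y) - real x * real y / real N"
  have h_nonneg: "0 \<le> ?h x" if "x \<le> N" for x
  proof -
    have "real x * real y \<le> real (min x y) * real N" using that y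
    proof (cases "x \<le> y")
      case True
      then show ?thesis using y by (simp add: min_def mult_left_mono)
    next
      case False
      then show ?thesis using that by (simp add: min_def mult.commute[of "real y"] mult_right_mono)
    qed
    then show ?thesis using N by (simp add: divide_le_eq)
  qed
  have big: "real N / 675 \<le> wave N x * ?h x" if x: "x \<in> {m..2 * m}" for x
  proof -
    have "x < N" using x m assms by (auto simp: m_def)
    then have xN: "x \<le> N" by simp
    have z: "1 / 5 \<le> real x / real N" "1 / 3 \<le> 1 - real x / real N"
      using x m N by (auto simp: field_simps)
    have "1 / 5 * (1 / 3) \<le> real x / real N * (1 - real x / real N)" using z by (intro mult_mono) auto
    then have "1 / 5 * (1 / 3) \<le> wave N x" using wave_ge[OF xN N(2)] by (rule order_trans)
    then have w: "1 / 15 \<le> wave N x" by simp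
    have "real N / 45 \<le> ?h x"
    proof (cases "x \<le> y")
      case True
      have "real N * (2 * real y) \<le> real N * real N"
        using y(3) by (intro mult_left_mono) linarith+
      then have "real x * (real N * (2 * real y)) \<le> real x * (real N * real N)" by (rule mult_left_mono) simp
      then have "real x / 2 \<le> ?h x" using True N by (simp add: min_def field_simps)
      moreover have "real N / 45 \<le> real x / 2" using x m by auto
      ultimately show ?thesis by linarith
    next
      case False
      have "?h x = real y * (1 - real x / real N)" using False by (simp add: min_def right_diff_distrib mult.commute)
      moreover have "real N / 3 * (1 / 3) \<le> real y * (1 - real x / real N)"
        using z y by (intro mult_mono) auto
      ultimately show ?thesis using N by linarith
    qed
    then have "1 / 15 * (real N / 45) \<le> wave N x * ?h x" using w N by (intro mult_mono) auto
    then show ?thesis by simp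
  qed
  have "real N / 3 * (real N / 675) \<le> real (card {m..2 * m}) * (real N / 675)"
    using m(3) by (intro mult_right_mono) auto
  also have "\<dots> = (\<Sum>x\<in>{m..2 * m}. real N / 675)" by simp
  also have "\<dots> \<le> (\<Sum>x\<in>{m..2 * m}. wave N x * ?h x)" by (intro sum_mono big)
  also have "\<dots> \<le> (\<Sum>x<N. wave N x * ?h x)"
  proof (rule sum_mono2)
    show "{m..2 * m} \<subseteq> {..<N}" using m assms by (auto simp: m_def)
    show "0 \<le> wave N x * ?h x" if "x \<in> {..<N} - {m..2 * m}" for x
      using that wave_bounds(1)[of x N] h_nonneg[of x] by (intro mult_nonneg_nonneg) auto
  qed simp
  also have "\<dots> = wilson N (N div 2) id" unfolding wilson_def y_def ht_id ..
  finally show ?thesis by (simp add: power2_eq_square)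
qed

section \<open>Decay rates and the lower bound on the mixing time\<close>

definition cutoff :: "nat \<Rightarrow> real" where
  "cutoff N = real N ^ 3 * ln (real N) / pi\<^sup>2"

lemma gap_eq: "N \<ge> 1 \<Longrightarrow> gap N = (1 - cos (pi / real N)) / (real N - 1)"
  unfolding gap_def by (simp add: of_nat_diff)

lemma gap_asymp: "(\<lambda>N. real N ^ 3 * gap N) \<longlonglongrightarrow> pi\<^sup>2 / 2"
proof -
  have "(\<lambda>N. real N ^ 3 * ((1 - cos (pi / real N)) / (real N - 1))) \<longlonglongrightarrow> pi * pi / 2" by real_asymp
  then show ?thesis
    unfolding power2_eq_square[symmetric]
    by (rule Lim_transform_eventually) (use eventually_ge_at_top[of 1] in \<open>eventually_elim; simp add: gap_eq\<close>)
qed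

text \<open>The lower bound calls for the true decay rate - ln (1 - gap), whereas the upper bound
  works with 1 - gap \<le> exp (- gap).\<close>

lemma ln_gap_asymp: "(\<lambda>N. real N ^ 3 * - ln (1 - gap N)) \<longlonglongrightarrow> pi\<^sup>2 / 2"
proof -
  have "(\<lambda>N. real N ^ 3 * - ln (1 - (1 - cos (pi / real N)) / (real N - 1))) \<longlonglongrightarrow> pi * pi / 2" by real_asymp
  then show ?thesis
    unfolding power2_eq_square[symmetric]
    by (rule Lim_transform_eventually) (use eventually_ge_at_top[of 1] in \<open>eventually_elim; simp add: gap_eq\<close>)
qed

text \<open>The squared mean is at least of order N^4 (1 - gap)^(2 n), the variance of order N^3.
  Granting the rate an error factor 1 + \<delta> and the time a factor 1 - \<delta> leaves the
  exponent 1 - \<delta>^2 of the decay, so their ratio exceeds a multiple of N^(\<delta>^2).\<close>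

lemma tv_lower_eventually:
  assumes "\<epsilon> < 1" "0 < \<delta>" "\<delta> < 1"
  shows "\<forall>\<^sub>F N in sequentially. \<forall>n. real n \<le> (1 - \<delta>) * cutoff N \<longrightarrow>
     \<epsilon> < tv_dist (sym_grp N) (shuffle_law N n) (pmf_of_set (sym_grp N))"
proof -
  have e1: "\<forall>\<^sub>F N in sequentially. real N ^ 3 * - ln (1 - gap N) < pi\<^sup>2 / 2 * (1 + \<delta>)"
    by (rule order_tendstoD(2)[OF ln_gap_asymp]) (use assms in simp)
  have e2: "\<forall>\<^sub>F N in sequentially. pi\<^sup>2 / 4 < real N ^ 3 * gap N"
    by (rule order_tendstoD(1)[OF gap_asymp]) simp
  have "filterlim (\<lambda>N. real N powr \<delta>\<^sup>2) at_top sequentially" using assms by real_asymp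
  then have e3: "\<forall>\<^sub>F N in sequentially. 4 * 2025\<^sup>2 / (1 - \<epsilon>) < real N powr \<delta>\<^sup>2"
    by (simp add: filterlim_at_top_dense)
  show ?thesis
    using e1 e2 e3 eventually_ge_at_top[of 3]
  proof eventually_elim
    case (elim N)
    have N: "N \<ge> 3" "real N > 0" "ln (real N) > 0" using elim(4) by auto
    note g = gap_bounds[OF N(1)]
    define l where "l = - ln (1 - gap N)"
    have l: "l \<ge> 0" unfolding l_def using g by simp
    define \<Phi> where "\<Phi> = wilson N (N div 2) id"
    have \<Phi>: "real N ^ 2 / 2025 \<le> \<Phi>" unfolding \<Phi>_def by (rule wilson_id_ge[OF N(1)])
    moreover have "0 < real N ^ 2 / 2025" using N(2) by simp
    ultimately have \<Phi>_pos: "\<Phi> > 0" by linarith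
    show ?case
    proof (intro allI impI)
      fix n assume n: "real n \<le> (1 - \<delta>) * cutoff N"
      have "real n * l \<le> (1 - \<delta>) * cutoff N * l" using n l by (rule mult_right_mono)
      also have "\<dots> = (1 - \<delta>) * ln (real N) / pi\<^sup>2 * (real N ^ 3 * l)" by (simp add: cutoff_def)
      also have "\<dots> \<le> (1 - \<delta>) * ln (real N) / pi\<^sup>2 * (pi\<^sup>2 / 2 * (1 + \<delta>))"
        using elim(1) assms N unfolding l_def by (intro mult_left_mono) auto
      also have "\<dots> = (1 - \<delta>\<^sup>2) / 2 * ln (real N)"
      proof -
        have *: "(1 - \<delta>) * b / c * (c / 2 * (1 + \<delta>)) = (1 - \<delta>\<^sup>2) / 2 * b" if "c \<noteq> 0" for b c :: real
          using that by (simp add: field_simps power2_eq_square)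
        show ?thesis by (rule *) simp
      qed
      finally have nl: "real n * l \<le> (1 - \<delta>\<^sup>2) / 2 * ln (real N)" .
      have pe: "(1 - gap N) ^ n = exp (- (real n * l))"
        using g exp_of_nat_mult[of n "ln (1 - gap N)"] unfolding l_def by simp
      have "((1 - gap N) ^ n)\<^sup>2 = exp (2 * - (real n * l))"
        unfolding pe exp_double ..
      then have "((1 - gap N) ^ n)\<^sup>2 = exp (- (2 * (real n * l)))" by simp
      moreover have "exp (- (2 * (real n * l))) \<ge> exp ((\<delta>\<^sup>2 - 1) * ln (real N))"
        using nl by (simp add: algebra_simps)
      ultimately have pw: "real N powr (\<delta>\<^sup>2 - 1) \<le> ((1 - gap N) ^ n)\<^sup>2"
        using N by (simp add: powr_def)
      define D where "D = gap N * ((1 - gap N) ^ n * \<Phi>)\<^sup>2"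
      have "(real N ^ 2 / 2025)\<^sup>2 \<le> \<Phi>\<^sup>2" using \<Phi> by (intro power_mono) auto
      then have "real N powr (\<delta>\<^sup>2 - 1) * (real N ^ 2 / 2025)\<^sup>2 \<le> ((1 - gap N) ^ n * \<Phi>)\<^sup>2"
        unfolding power_mult_distrib[of _ \<Phi>] using pw by (intro mult_mono) auto
      then have "gap N * (real N powr (\<delta>\<^sup>2 - 1) * (real N ^ 2 / 2025)\<^sup>2) \<le> D"
        unfolding D_def using g by (intro mult_left_mono) auto
      moreover have "gap N * (real N powr (\<delta>\<^sup>2 - 1) * (real N ^ 2 / 2025)\<^sup>2) = (real N ^ 3 * gap N) * real N powr \<delta>\<^sup>2 / 2025\<^sup>2"
        using N by (simp add: powr_diff power_divide field_simps power_numeral_reduce)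
      moreover have "1 * real N powr \<delta>\<^sup>2 \<le> (real N ^ 3 * gap N) * real N powr \<delta>\<^sup>2"
      proof (rule mult_right_mono)
        have "2 * 2 \<le> pi * pi" using pi_ge_two by (intro mult_mono) auto
        then show "1 \<le> real N ^ 3 * gap N" using elim(2) by (simp add: power2_eq_square)
      qed simp
      ultimately have "real N powr \<delta>\<^sup>2 / 2025\<^sup>2 \<le> D" by simp
      then have D: "4 / (1 - \<epsilon>) < D" using elim(3) by (simp add: field_simps)
      then have "4 < D * (1 - \<epsilon>)" using assms by (simp add: divide_less_eq)
      moreover have "D > 0" using D assms by (smt (verit) divide_pos_pos)
      ultimately have "4 / D < 1 - \<epsilon>" by (simp add: divide_less_eq mult.commute)
      then show "\<epsilon> < tv_dist (sym_grp N) (shuffle_law N n) (pmf_of_set (sym_grp N))"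
        using wilson_lower_bound[OF N(1) _ \<Phi>_pos[unfolded \<Phi>_def], of n] unfolding D_def \<Phi>_def by simp
    qed
  qed
qed

text \<open>The typical radius is r = A sqrt N and the shift L about 2 r, so R = r + L \<le> 3 r + 1
  and 4 R + 1 \<le> 17 r. The crucial point is that T moves with weight loss \<theta> give T
  \<theta> \<le> 4080 A^2 K^4, free of N. The gain per move is of order K^4 \<eta> / N, and T is at
  most 3 r K^2; atypical tables contribute the term 6 K^2 / A.\<close>

lemma smoothed_distance:
  assumes N: "N \<ge> 3" "K * K \<le> N" "K \<ge> 2" and A: "A \<ge> 1"
    and window: "17 * A * sqrt (real N) \<le> real N / (400 * real K ^ 2)"
    and \<eta>: "1 \<le> \<eta>" "\<eta> \<le> sqrt (real N)" "real N * (1 - gap N) ^ t \<le> \<eta>"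
  shows "blocks N (N div K) K"
    "(\<Sum>\<sigma>\<in>sym_grp N. \<bar>blocks.smoothed N (N div K) K t \<sigma> - 1 / fact N\<bar>)
      \<le> 49152 * A * real K ^ 6 * exp (4080 * A\<^sup>2 * real K ^ 4) * (sqrt (real N) * \<eta> / real N) + 6 * real K ^ 2 / A"
proof -
  define n where "n = N div K"
  \<comment> \<open>\<open>K * K \<le> N\<close> makes blocks at least K long, so the remainder of N
    modulo K fits into the last block without doubling it.\<close>
  have nK: "n \<ge> K" unfolding n_def using N by (simp add: less_eq_div_iff_mult_less_eq)
  have Kn: "K * n \<le> N" unfolding n_def by simp
  have "N < K * n + K" unfolding n_def using N(3) dividend_less_times_div[of K N] by simp
  then have N_lt: "N < K * n + n" using nK by linarith
  have "(K - 1) * n < K * n" using N nK by simp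
  then have last: "(K - 1) * n < N" using Kn by linarith
  show bl: "blocks N (N div K) K"
    unfolding n_def[symmetric]
  proof unfold_locales
    show "N \<le> (K + 1) * n" using N_lt by simp
  qed (use N nK last in linarith)+
  interpret blocks N n K using bl by (simp add: n_def)
  have Np: "real N > 0" using N by simp
  interpret block_density N n K "smoothed t" \<eta>
  proof
    show "K * n \<le> N" by (rule Kn)
    show "1 \<le> \<eta>" by (rule \<eta>(1))
    show "(\<Sum>\<sigma>\<in>sym_grp N. smoothed t \<sigma> * real (ht \<sigma> (bdy i) (bdy j))) \<le> real (bdy i) * real (bdy j) / real N + \<eta>"
      if "1 \<le> i" "i < K" "1 \<le> j" "j < K" for i j
      using smoothed_ht_le[OF bdy_interior[OF that(1,2)], of t "bdy j"] main_heat[OF N(1) bdy_le_N[of i] bdy_le_N[of j], of t] \<eta>(3)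
      by linarith
  qed (use smoothed_nonneg smoothed_sum_1 smoothed_mono smoothed_right_invariant smoothed_left_invariant smoothed_dominates in auto)
  define s where "s = sqrt (real N)"
  have s: "s \<ge> 1" "s * s = real N" "s > 0" unfolding s_def using N by auto
  define r where "r = A * s"
  have r1: "r \<ge> 1" unfolding r_def using A s mult_mono[of 1 A 1 s] by simp
  define L where "L = nat \<lceil>2 * r\<rceil>"
  have L: "2 * r \<le> real L" "real L \<le> 2 * r + 1" unfolding L_def using r1 by linarith+
  define R where "R = r + real L"
  have R: "4 * R + 1 \<le> 17 * r" "0 \<le> R" unfolding R_def using L r1 by auto
  define K2 where "K2 = real K ^ 2"
  have K2: "K2 > 0" unfolding K2_def using N by simp
  define q' where "q' = real n ^ 2 / real N"
  have "N \<le> 2 * (K * n)" using N_lt N(3) mult_le_mono1[of 1 K n] by linarith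
  then have "real N \<le> real (2 * (K * n))" by (simp only: of_nat_le_iff)
  then have "real N \<le> 2 * (real K * real n)" by simp
  then have "real N * real N \<le> (2 * (real K * real n)) * (2 * (real K * real n))" by (intro mult_mono) auto
  then have q': "real N / (4 * K2) \<le> q'"
    unfolding q'_def K2_def using Np N by (simp add: field_simps power2_eq_square)
  have win: "17 * r \<le> q' / 100"
  proof -
    have "17 * r \<le> real N / (400 * K2)" using window unfolding r_def s_def K2_def by simp
    also have "\<dots> = real N / (4 * K2) / 100" by simp
    also have "\<dots> \<le> q' / 100" using q' by (rule divide_right_mono) simp
    finally show ?thesis .
  qed
  interpret block_window N n K "smoothed t" \<eta> R
    by unfold_locales (use R win in \<open>auto simp: q'_def\<close>)
  define T where "T = L * ((K - 1) * (K - 1))"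
  have T: "real T \<le> 3 * r * K2"
  proof -
    have "real ((K - 1) * (K - 1)) \<le> K2" unfolding K2_def power2_eq_square of_nat_mult by (intro mult_mono) auto
    then have "real L * real ((K - 1) * (K - 1)) \<le> (3 * r) * K2" using L r1 by (intro mult_mono) auto
    then show ?thesis unfolding T_def by (simp only: of_nat_mult)
  qed
  have q: "q = q'" unfolding q_def q'_def ..
  have q_ge: "real N / (4 * K2) \<le> q" "0 < real N / (4 * K2)" using q' K2 Np unfolding q by auto
  have th: "\<theta> \<le> 1360 * r * K2 / real N"
  proof -
    have "\<theta> \<le> 20 * (17 * r) / q" unfolding \<theta>_def using R q_pos by (intro divide_right_mono) auto
    also have "\<dots> \<le> 20 * (17 * r) / (real N / (4 * K2))" using q_ge r1 K2 Np q_pos by (intro divide_left_mono) auto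
    finally show ?thesis by simp
  qed
  have "real T * \<theta> \<le> (3 * r * K2) * (1360 * r * K2 / real N)"
    using T th \<theta>_nonneg r1 K2 by (intro mult_mono) auto
  also have "\<dots> = 4080 * A\<^sup>2 * real K ^ 4"
    unfolding r_def using s Np by (simp add: K2_def power2_eq_square power4_eq_xxxx s(2)[symmetric] field_simps)
  finally have Tth: "real T * \<theta> \<le> 4080 * A\<^sup>2 * real K ^ 4" .
  have "(1 + \<theta>) ^ T \<le> exp \<theta> ^ T" using \<theta>_nonneg exp_ge_add_one_self[of \<theta>] by (intro power_mono) auto
  also have "\<dots> = exp (real T * \<theta>)" by (simp add: exp_of_nat_mult)
  also have "\<dots> \<le> exp (4080 * A\<^sup>2 * real K ^ 4)" using Tth by simp
  finally have pw: "(1 + \<theta>) ^ T \<le> exp (4080 * A\<^sup>2 * real K ^ 4)" .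
  have Gb: "G \<le> 8192 * K2\<^sup>2 * \<eta> / real N"
  proof -
    have "(real N / (4 * K2))\<^sup>2 \<le> q\<^sup>2" using q_ge by (intro power_mono) auto
    then have "G \<le> 512 * real N * \<eta> / (real N / (4 * K2))\<^sup>2"
      unfolding G_def using \<eta>(1) q_ge q_pos Np K2 by (intro divide_left_mono) auto
    also have "\<dots> = 8192 * K2\<^sup>2 * \<eta> / real N" using Np K2 by (simp add: power2_eq_square field_simps)
    finally show ?thesis .
  qed
  have "real T * (1 + \<theta>) ^ T * G \<le> (3 * r * K2) * exp (4080 * A\<^sup>2 * real K ^ 4) * (8192 * K2\<^sup>2 * \<eta> / real N)"
    using T pw Gb G_nonneg \<theta>_nonneg r1 K2 by (intro mult_mono) auto
  also have "\<dots> = 24576 * A * real K ^ 6 * exp (4080 * A\<^sup>2 * real K ^ 4) * (s * \<eta> / real N)"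
    unfolding r_def K2_def by (simp add: power_mult[symmetric] power_add[symmetric] power2_eq_square power_numeral_reduce mult_ac)
  finally have t1: "2 * (real T * (1 + \<theta>) ^ T * G) \<le> 49152 * A * real K ^ 6 * exp (4080 * A\<^sup>2 * real K ^ 4) * (s * \<eta> / real N)"
    by linarith
  have "real K * real K * (2 * s + \<eta>) / r \<le> real K * real K * (3 * s) / r"
    using \<eta>(2) r1 by (intro divide_right_mono mult_left_mono) (auto simp: s_def)
  also have "\<dots> = 3 * real K ^ 2 / A" unfolding r_def using s A by (simp add: power2_eq_square)
  finally have t2: "2 * (real K * real K * (2 * s + \<eta>) / r) \<le> 6 * real K ^ 2 / A" by simp
  have "(\<Sum>\<sigma>\<in>sym_grp N. \<bar>smoothed t \<sigma> - 1 / fact N\<bar>) \<le> 2 * (real T * (1 + \<theta>) ^ T * G) + 2 * (real K * real K * (2 * s + \<eta>) / r)"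
    unfolding T_def s_def by (rule table_distance_bound) (use r1 L in \<open>auto simp: R_def\<close>)
  then show "(\<Sum>\<sigma>\<in>sym_grp N. \<bar>blocks.smoothed N (N div K) K t \<sigma> - 1 / fact N\<bar>)
      \<le> 49152 * A * real K ^ 6 * exp (4080 * A\<^sup>2 * real K ^ 4) * (sqrt (real N) * \<eta> / real N) + 6 * real K ^ 2 / A"
    using t1 t2 unfolding n_def[symmetric] s_def by linarith
qed

text \<open>The prefactor of \<open>mix_err\<close> is at most 2 N^5, so a decay by N^(-6) leaves 1
  / N; hence the 6. The subtracted 1 makes room for rounding \<open>s\<close> down and costs the
  factor \<open>exp 1\<close>.\<close>

lemma (in blocks) mix_err_le:
  assumes "real s * real K ^ 2 \<ge> real N ^ 3 * (6 * ln (real N) - 1)" "K * n \<le> N"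
  shows "mix_err s \<le> 2 * exp 1 / real N"
proof -
  define M where "M = real n ^ 2 * real (N - 1)"
  have Np: "real N > 0" "real K > 0" using N2 K1 by auto
  have nN: "real n \<le> real N" using assms(2) K1 by (metis le_trans mult_le_mono1 nat_mult_1 of_nat_le_iff)
  have "1 * 1 \<le> M" unfolding M_def using N2 n1 by (intro mult_mono) auto
  then have M: "M \<ge> 1" by simp
  have "real K * real n \<le> real N" using assms(2) by (simp only: of_nat_mult[symmetric] of_nat_le_iff)
  then have "(real K * real n)\<^sup>2 * real (N - 1) \<le> (real N)\<^sup>2 * real N" by (intro mult_mono power_mono) auto
  then have KM: "real K ^ 2 * M \<le> real N ^ 3" unfolding M_def by (simp add: power_mult_distrib power2_eq_square power3_eq_cube mult_ac del: of_nat_diff)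
  have "(6 * ln (real N) - 1) * M \<le> real s"
  proof (cases "6 * ln (real N) - 1 \<ge> 0")
    case True
    have "real K ^ 2 * ((6 * ln (real N) - 1) * M) = (6 * ln (real N) - 1) * (real K ^ 2 * M)" by simp
    also have "\<dots> \<le> (6 * ln (real N) - 1) * real N ^ 3" using KM True by (rule mult_left_mono)
    also have "\<dots> \<le> real K ^ 2 * real s" using assms(1) by (simp add: mult.commute)
    finally show ?thesis using Np by simp
  next
    case False
    then have "(6 * ln (real N) - 1) * M \<le> 0" using M by (intro mult_nonpos_nonneg) auto
    then show ?thesis by linarith
  qed
  then have sM: "6 * ln (real N) - 1 \<le> real s / M" using M by (simp add: le_divide_eq)
  have "(1 - 1 / M) ^ s \<le> exp (- (1 / M)) ^ s"
    using M exp_ge_add_one_self[of "- (1 / M)"] by (intro power_mono) auto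
  also have "\<dots> = exp (- (real s / M))" using exp_of_nat_mult[of s "- (1 / M)"] by simp
  also have "\<dots> \<le> exp (1 - 6 * ln (real N))" using sM by simp
  also have "\<dots> = exp 1 / real N ^ 6" using Np exp_of_nat_mult[of 6 "ln (real N)"] by (simp add: exp_diff)
  finally have p: "(1 - 1 / M) ^ s \<le> exp 1 / real N ^ 6" .
  have "mix_err s = 2 * real N ^ 3 * real n ^ 2 * (1 - 1 / M) ^ s" unfolding mix_err_def M_def ..
  also have "\<dots> \<le> 2 * real N ^ 3 * real N ^ 2 * (exp 1 / real N ^ 6)"
    using p nN M by (intro mult_mono power_mono) auto
  also have "\<dots> = 2 * exp 1 / real N" using Np by (simp add: power_numeral_reduce field_simps)
  finally show ?thesis .
qed

lemma tv_upper_eventually: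
  assumes "0 < \<epsilon>" "0 < \<delta>" "\<delta> < 1"
  shows "\<forall>\<^sub>F N in sequentially. \<exists>n. real n \<le> (1 + \<delta>) * cutoff N \<and>
     tv_dist (sym_grp N) (shuffle_law N n) (pmf_of_set (sym_grp N)) \<le> \<epsilon>"
proof -
  \<comment> \<open>Chosen so that 6 pi^2 \<le> (\<delta> / 8) K^2: then the fraction \<delta> / 8
    of the cutoff time suffices for \<open>mix_err_le\<close>.\<close>
  define K where "K = max 2 (nat \<lceil>sqrt (48 * pi\<^sup>2 / \<delta>)\<rceil>)"
  have K2: "K \<ge> 2" by (simp add: K_def)
  have "sqrt (48 * pi\<^sup>2 / \<delta>) \<le> real K" unfolding K_def by linarith
  then have "(sqrt (48 * pi\<^sup>2 / \<delta>))\<^sup>2 \<le> real K ^ 2" using assms by (intro power_mono) auto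
  then have Ksq: "48 * pi\<^sup>2 / \<delta> \<le> real K ^ 2" using assms by simp
  \<comment> \<open>Brings the atypical part down to \<epsilon> / 4. Only K and \<epsilon> enter, so
    \<open>c\<close> below is a constant as N grows.\<close>
  define A where "A = max 1 (24 * real K ^ 2 / \<epsilon>)"
  have A: "A \<ge> 1" "24 * real K ^ 2 / \<epsilon> \<le> A" by (auto simp: A_def)
  have A4: "6 * real K ^ 2 / A \<le> \<epsilon> / 4" using A assms by (simp add: field_simps)
  define c where "c = 49152 * A * real K ^ 6 * exp (4080 * A\<^sup>2 * real K ^ 4)"
  have c: "c > 0" unfolding c_def using A K2 by simp
  have w0: "0 < 1 / (17 * A * (400 * real K ^ 2))" using A K2 by simp
  have "(\<lambda>N. sqrt (real N) / real N) \<longlonglongrightarrow> 0" by real_asymp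
  then have e1: "\<forall>\<^sub>F N in sequentially. sqrt (real N) / real N < 1 / (17 * A * (400 * real K ^ 2))"
    using w0 by (rule order_tendstoD(2))
  have e2: "\<forall>\<^sub>F N in sequentially. (1 - \<delta> / 8) * (pi\<^sup>2 / 2) < real N ^ 3 * gap N"
    by (rule order_tendstoD(1)[OF gap_asymp]) (use assms in simp)
  have "(\<lambda>N. real N powr (- \<delta> / 8)) \<longlonglongrightarrow> 0" using assms by real_asymp
  then have e3: "\<forall>\<^sub>F N in sequentially. real N powr (- \<delta> / 8) < \<epsilon> / 4 / c"
    by (rule order_tendstoD(2)) (use assms c in simp)
  have "(\<lambda>N. 4 * exp 1 / real N) \<longlonglongrightarrow> 0" by real_asymp
  then have e4: "\<forall>\<^sub>F N in sequentially. 4 * exp 1 / real N < \<epsilon> / 2"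
    by (rule order_tendstoD(2)) (use assms in simp)
  have "filterlim cutoff at_top sequentially" unfolding cutoff_def by real_asymp
  then have e5: "\<forall>\<^sub>F N in sequentially. 4 / \<delta> < cutoff N" by (simp add: filterlim_at_top_dense)
  show ?thesis
    using e1 e2 e3 e4 e5 eventually_ge_at_top[of "max 3 (K * K)"]
  proof eventually_elim
    case (elim N)
    have N: "N \<ge> 3" "K * K \<le> N" "real N > 0" "real N \<ge> 1" "ln (real N) > 0" using elim(6) by auto
    note g = gap_bounds[OF N(1)]
    define X where "X = cutoff N"
    have X: "X > 0" "real N ^ 3 * ln (real N) = pi\<^sup>2 * X" "4 / \<delta> < X"
      using elim(5) N unfolding X_def cutoff_def by auto
    \<comment> \<open>Time budget in units of the cutoff: 1 + \<delta> / 2 for the uncensored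
      middle, \<delta> / 8 for each censored end; the remaining \<delta> / 4 absorbs rounding
      \<open>t\<close> up.\<close>
    define t where "t = nat \<lceil>(1 + \<delta> / 2) * X\<rceil>"
    define s where "s = nat \<lfloor>\<delta> / 8 * X\<rfloor>"
    have "0 \<le> (1 + \<delta> / 2) * X" "0 \<le> \<delta> / 8 * X" using X(1) assms by auto
    then have t: "(1 + \<delta> / 2) * X \<le> real t" "real t \<le> (1 + \<delta> / 2) * X + 1"
      and s: "\<delta> / 8 * X - 1 \<le> real s" "real s \<le> \<delta> / 8 * X"
      unfolding t_def s_def by linarith+
    define \<eta> where "\<eta> = real N powr (1 / 2 - \<delta> / 8)"
    have \<eta>1: "1 \<le> \<eta>" unfolding \<eta>_def using N assms by (intro ge_one_powr_ge_zero) auto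
    have \<eta>2: "\<eta> \<le> sqrt (real N)"
      unfolding \<eta>_def powr_half_sqrt[OF less_imp_le[OF N(3)], symmetric] using N assms by (intro powr_mono) auto
    have \<eta>3: "real N * (1 - gap N) ^ t \<le> \<eta>"
    proof -
      \<comment> \<open>The extra time \<delta> / 2 outweighs the error \<delta> / 8 in the gap,
        which leaves \<eta> below sqrt N by the factor N^(- \<delta> / 8).\<close>
      have "(1 / 2 + \<delta> / 8) * ln (real N) \<le> (1 + \<delta> / 2) * (1 - \<delta> / 8) / 2 * ln (real N)"
      proof (rule mult_right_mono)
        have "\<delta> * \<delta> \<le> \<delta> * 1" using assms by (intro mult_left_mono) auto
        then show "1 / 2 + \<delta> / 8 \<le> (1 + \<delta> / 2) * (1 - \<delta> / 8) / 2" using assms by (simp add: field_simps)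
      qed (use N in simp)
      also have "\<dots> = (1 + \<delta> / 2) * ln (real N) / pi\<^sup>2 * ((1 - \<delta> / 8) * (pi\<^sup>2 / 2))"
        by (simp add: field_simps)
      also have "\<dots> \<le> (1 + \<delta> / 2) * ln (real N) / pi\<^sup>2 * (real N ^ 3 * gap N)"
        using elim(2) assms N by (intro mult_left_mono) auto
      also have "\<dots> = (1 + \<delta> / 2) * X * gap N" by (simp add: X_def cutoff_def)
      also have "\<dots> \<le> real t * gap N" using t(1) g by (intro mult_right_mono) auto
      finally have tg: "(1 / 2 + \<delta> / 8) * ln (real N) \<le> real t * gap N" .
      have "(1 - gap N) ^ t \<le> exp (- gap N) ^ t"
        using g exp_ge_add_one_self[of "- gap N"] by (intro power_mono) auto
      also have "\<dots> = exp (- (real t * gap N))" using exp_of_nat_mult[of t "- gap N"] by simp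
      also have "\<dots> \<le> exp (- ((1 / 2 + \<delta> / 8) * ln (real N)))" using tg by simp
      also have "\<dots> = real N powr - (1 / 2 + \<delta> / 8)" unfolding powr_def using N(3) by (simp add: algebra_simps)
      finally have "real N * (1 - gap N) ^ t \<le> real N powr 1 * real N powr - (1 / 2 + \<delta> / 8)"
        using N by (simp add: mult_left_mono)
      also have "\<dots> = \<eta>" unfolding \<eta>_def powr_add[symmetric] by (simp add: algebra_simps)
      finally show ?thesis .
    qed
    have window: "17 * A * sqrt (real N) \<le> real N / (400 * real K ^ 2)"
    proof -
      have "17 * A * (400 * real K ^ 2) * (sqrt (real N) / real N) \<le> 17 * A * (400 * real K ^ 2) * (1 / (17 * A * (400 * real K ^ 2)))"
        using elim(1) A by (intro mult_left_mono) auto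
      also have "\<dots> = 1" using A K2 by simp
      finally show ?thesis using N A K2 by (simp add: field_simps)
    qed
    note sd = smoothed_distance[OF N(1,2) K2 A(1) window \<eta>1 \<eta>2 \<eta>3]
    interpret blocks N "N div K" K by (rule sd(1))
    have "sqrt (real N) * \<eta> / real N = real N powr (1 / 2) * real N powr (1 / 2 - \<delta> / 8) / real N powr 1"
      unfolding \<eta>_def using N by (simp add: powr_half_sqrt)
    also have "\<dots> = real N powr (- \<delta> / 8)"
      unfolding powr_add[symmetric] powr_diff[symmetric] by simp
    finally have "sqrt (real N) * \<eta> / real N = real N powr (- \<delta> / 8)" .
    then have d1: "(\<Sum>\<sigma>\<in>sym_grp N. \<bar>smoothed t \<sigma> - 1 / fact N\<bar>) \<le> c * real N powr (- \<delta> / 8) + 6 * real K ^ 2 / A"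
      using sd(2) unfolding c_def by simp
    have "c * real N powr (- \<delta> / 8) \<le> c * (\<epsilon> / 4 / c)" using elim(3) c by (intro mult_left_mono) auto
    then have d2: "c * real N powr (- \<delta> / 8) \<le> \<epsilon> / 4" using c by simp
    have "mix_err s \<le> 2 * exp 1 / real N"
    proof (rule mix_err_le)
      have "real N ^ 3 * (6 * ln (real N) - 1) = 6 * pi\<^sup>2 * X - real N ^ 3"
        using X(2) by (simp add: algebra_simps)
      also have "\<dots> \<le> (\<delta> / 8 * X) * real K ^ 2 - real K ^ 2"
      proof -
        have "48 * pi\<^sup>2 \<le> real K ^ 2 * \<delta>" using Ksq assms by (simp add: divide_le_eq)
        then have "48 * pi\<^sup>2 * X \<le> real K ^ 2 * \<delta> * X" using X by (intro mult_right_mono) auto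
        moreover have "real K ^ 2 \<le> real N ^ 3"
        proof -
          have "real (K * K) \<le> real N" using N(2) by (simp only: of_nat_le_iff)
          also have "\<dots> \<le> real N ^ 3" using N(4) by (intro self_le_power) auto
          finally show ?thesis by (simp add: power2_eq_square)
        qed
        ultimately show ?thesis by (simp add: field_simps)
      qed
      also have "\<dots> = (\<delta> / 8 * X - 1) * real K ^ 2" by (simp add: algebra_simps)
      also have "\<dots> \<le> real s * real K ^ 2" using s(1) by (intro mult_right_mono) auto
      finally show "real N ^ 3 * (6 * ln (real N) - 1) \<le> real s * real K ^ 2" .
    qed simp
    then have d3: "2 * mix_err s \<le> \<epsilon> / 2" using elim(4) by simp
    have "tv_dist (sym_grp N) (shuffle_law N (s + t + s)) (pmf_of_set (sym_grp N)) \<le> \<epsilon>"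
      using tv_le_smoothed[of s t] d1 d2 d3 A4 by linarith
    moreover have "real (s + t + s) \<le> (1 + \<delta>) * cutoff N"
    proof -
      have "1 \<le> \<delta> / 4 * X" using X(3) assms by (simp add: field_simps)
      moreover have "(1 + \<delta>) * X = (1 + \<delta> / 2) * X + \<delta> / 4 * X + \<delta> / 8 * X + \<delta> / 8 * X" by (simp add: algebra_simps)
      ultimately show ?thesis using t(2) s(2) unfolding X_def[symmetric] of_nat_add by linarith
    qed
    ultimately show ?case by blast
  qed
qed

theorem theoremB2:
  fixes \<epsilon> :: real
  assumes "0 < \<epsilon>" and "\<epsilon> < 1"
  shows "(\<lambda>N::nat. pi\<^sup>2 * real (mixing_time N \<epsilon>) / (real N ^ 3 * ln (real N))) \<longlonglongrightarrow> 1"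
proof (rule tendstoI)
  fix e :: real assume e: "0 < e"
  define \<delta> where "\<delta> = min (e / 2) (1 / 2)"
  have \<delta>: "0 < \<delta>" "\<delta> < 1" "\<delta> < e" using e by (auto simp: \<delta>_def)
  show "\<forall>\<^sub>F N in sequentially. dist (pi\<^sup>2 * real (mixing_time N \<epsilon>) / (real N ^ 3 * ln (real N))) 1 < e"
    using tv_lower_eventually[OF assms(2) \<delta>(1,2)] tv_upper_eventually[OF assms(1) \<delta>(1,2)] eventually_ge_at_top[of 3]
  proof eventually_elim
    case (elim N)
    let ?M = "{n. tv_dist (sym_grp N) (shuffle_law N n) (pmf_of_set (sym_grp N)) \<le> \<epsilon>}"
    have X: "cutoff N > 0" using elim(3) by (simp add: cutoff_def)
    obtain n where n: "real n \<le> (1 + \<delta>) * cutoff N" "n \<in> ?M" using elim(2) by auto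
    \<comment> \<open>An infimum of naturals is attained only for a nonempty set, so the witness
      \<open>n\<close> of the upper bound serves the lower bound as well.\<close>
    have "mixing_time N \<epsilon> \<in> ?M" unfolding mixing_time_def using n(2) by (intro Inf_nat_def1) auto
    then have "\<not> real (mixing_time N \<epsilon>) \<le> (1 - \<delta>) * cutoff N" using elim(1) by force
    moreover have "mixing_time N \<epsilon> \<le> n" unfolding mixing_time_def using n(2) by (intro cInf_lower) auto
    ultimately have b: "(1 - \<delta>) * cutoff N \<le> real (mixing_time N \<epsilon>)" "real (mixing_time N \<epsilon>) \<le> (1 + \<delta>) * cutoff N"
      using n(1) by linarith+
    have "pi\<^sup>2 * real (mixing_time N \<epsilon>) / (real N ^ 3 * ln (real N)) = real (mixing_time N \<epsilon>) / cutoff N"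
      by (simp add: cutoff_def)
    moreover have "1 - \<delta> \<le> real (mixing_time N \<epsilon>) / cutoff N" "real (mixing_time N \<epsilon>) / cutoff N \<le> 1 + \<delta>"
      using b X by (simp_all add: le_divide_eq divide_le_eq)
    ultimately show ?case using \<delta>(3) by (simp add: dist_real_def abs_less_iff)
  qed
qed

end
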